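(* Let $(X,\sigma)$ be a symplectic space of arbitrary (finite or infinite) dimension, with resolvent algebra $\mathcal{R}(X,\sigma)$. (i) Let $Z\subset X$ be an isotropic subspace, i.e. $\sigma(f,g)=0$ for all $f,g\in Z$, let $\mathcal{A}(Z)\subset\mathcal{R}(X,\sigma)$ be the abelian C*-algebra generated by $R(\lambda,f)$, $\lambda\in\mathbb{R}\setminus\{0\}$, $f\in Z$, and let $\chi$ be a pure state on $\mathcal{A}(Z)$ which has none of these generating resolvents in its kernel. The closed two-sided ideal $\mathcal{J}$ generated by $$\{R(\lambda,f)-\chi(R(\lambda,f))\,\mathbf{1} : \lambda\in\mathbb{R}\setminus\{0\},\ f\in Z\}\quad\text{and}\quad\{R(\mu,g):\mu\in\mathbb{R}\setminus\{0\},\ g\in X\setminus Z\}$$ is a proper maximal ideal of $\mathcal{R}(X,\sigma)$. (ii) Conversely, let $\mathcal{J}\subset\mathcal{R}(X,\sigma)$ be a proper maximal ideal of $\mathcal{R}(X,\sigma)$. There exist an isotropic subspace $Z\subset X$ and a pure state $\chi$ on the abelian C*-algebra $\mathcal{A}(Z)$ generated by $R(\lambda,f)$ with $\lambda\in\mathbb{R}\setminus\{0\}$, $f\in Z$, which has none of these generating resolvents in its kernel, such that $\mathcal{J}$ coincides with the closed two-sided ideal generated by $$\{R(\lambda,f)-\chi(R(\lambda,f))\,\mathbf{1} : \lambda\in\mathbb{R}\setminus\{0\},\ f\in Z\}\quad\text{and}\quad\{R(\mu,g):\mu\in\mathbb{R}\setminus\{0\},\ g\in X\setminus Z\}.$$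
   Context: A symplectic space $(X,\sigma)$ is a real vector space $X$ with a nondegenerate symplectic (bilinear, antisymmetric) form $\sigma : X\times X\to\mathbb{R}$. Standing assumption: $(X,\sigma)$ admits a complex structure, i.e. a real linear map $J:X\to X$ with $J^2=-1$, $\sigma(Jf,Jg)=\sigma(f,g)$ and $\sigma(f,Jf)>0$ for $f\neq 0$ (automatic if $\dim X<\infty$). Resolvent algebra: let $\mathcal{R}_0$ be the universal unital *-algebra (over $\mathbb{C}$) generated by symbols $R(\lambda,f)$, $\lambda\in\mathbb{R}\setminus\{0\}$, $f\in X$, subject to the relations, for all $\lambda,\mu,\nu\in\mathbb{R}\setminus\{0\}$ and $f,g\in X$: (1) $R(\lambda,f)-R(\mu,f)=i(\mu-\lambda)R(\lambda,f)R(\mu,f)$; (2) $R(\lambda,f)^*=R(-\lambda,f)$; (3) $[R(\lambda,f),R(\mu,g)]=i\sigma(f,g)R(\lambda,f)R(\mu,g)^2R(\lambda,f)$; (4) $\nu R(\nu\lambda,\nu f)=R(\lambda,f)$; (5) $R(\lambda,f)R(\mu,g)=R(\lambda+\mu,f+g)\big(R(\lambda,f)+R(\mu,g)+i\sigma(f,g)R(\lambda,f)^2R(\mu,g)\big)$ if $\lambda+\mu\neq0$; (6) $R(\lambda,0)=-\frac{i}{\lambda}\mathbf{1}$. Let $\mathfrak{S}$ be the set of positive normalized functionals $\omega$ on $\mathcal{R}_0$, with GNS-representations $(\pi_\omega,\mathcal{H}_\omega)$ (these are uniformly bounded over $\mathfrak{S}$). Then $\|A\|=\sup_{\omega\in\mathfrak{S}}\|\pi_\omega(A)\|$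 is a C*-seminorm on $\mathcal{R}_0$, and $\mathcal{R}(X,\sigma)$ is the C*-completion of $\mathcal{R}_0/\ker\|\cdot\|$. "Ideal" always means closed two-sided ideal; an ideal is proper if it differs from $\mathcal{R}(X,\sigma)$, and a proper ideal is maximal if it is not strictly contained in another proper ideal. *)

theory Defs
  imports "HOL-Analysis.Analysis" "HOL-Library.Nonpos_Ints"
begin

section \<open>Symplectic spaces\<close>

class symplectic_space = real_vector +
  fixes sympl :: "'a \<Rightarrow> 'a \<Rightarrow> real"
  assumes sympl_add_left: "sympl (f + g) h = sympl f h + sympl g h"
    and sympl_scaleR_left: "sympl (r *\<^sub>R f) h = r * sympl f h"
    and sympl_antisym: "sympl f g = - sympl g f"
    and sympl_nondegenerate: "(\<And>g. sympl f g = 0) \<Longrightarrow> f = 0"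
    and sympl_complex_structure:
      "\<exists>J. (\<forall>f g. J (f + g) = J f + J g) \<and> (\<forall>r f. J (r *\<^sub>R f) = r *\<^sub>R J f) \<and>
           (\<forall>f. J (J f) = - f) \<and> (\<forall>f g. sympl (J f) (J g) = sympl f g) \<and>
           (\<forall>f. f \<noteq> 0 \<longrightarrow> 0 < sympl f (J f))"

lemma sympl_bilinear: "bilinear (sympl :: 'x::symplectic_space \<Rightarrow> 'x \<Rightarrow> real)"
proof -
  have "linear (\<lambda>f. sympl f g)" for g :: 'x
    by (rule linearI) (simp_all add: sympl_add_left sympl_scaleR_left)
  moreover have "sympl f = (\<lambda>g. - sympl g f)" for f :: 'x
    using sympl_antisym by blast
  ultimately show ?thesis unfolding bilinear_def by (metis linear_compose_neg)
qed

definition isotropic :: "'x::symplectic_space set \<Rightarrow> bool" where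
  "isotropic Z \<longleftrightarrow> (\<forall>f\<in>Z. \<forall>g\<in>Z. sympl f g = 0)"


section \<open>Complex *-algebras and C*-algebras\<close>

class scaleC =
  fixes scaleC :: "complex \<Rightarrow> 'a \<Rightarrow> 'a"  (infixr \<open>*\<^sub>C\<close> 75)

class star =
  fixes star :: "'a \<Rightarrow> 'a"

class complex_star_algebra = ring_1 + scaleC + star +
  assumes scaleC_add_right: "c *\<^sub>C (a + b) = c *\<^sub>C a + c *\<^sub>C b"
    and scaleC_add_left: "(c + d) *\<^sub>C a = c *\<^sub>C a + d *\<^sub>C a"
    and scaleC_scaleC: "c *\<^sub>C d *\<^sub>C a = (c * d) *\<^sub>C a"
    and scaleC_one: "1 *\<^sub>C a = a"
    and mult_scaleC_left: "(c *\<^sub>C a) * b = c *\<^sub>C (a * b)"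
    and mult_scaleC_right: "a * (c *\<^sub>C b) = c *\<^sub>C (a * b)"
    and star_add: "star (a + b) = star a + star b"
    and star_scaleC: "star (c *\<^sub>C a) = cnj c *\<^sub>C star a"
    and star_mult: "star (a * b) = star b * star a"
    and star_star: "star (star a) = a"

class cstar_algebra = complex_star_algebra + real_normed_algebra_1 + banach +
  assumes scaleR_eq_scaleC: "r *\<^sub>R a = complex_of_real r *\<^sub>C a"
    and norm_scaleC: "norm (c *\<^sub>C a) = cmod c * norm a"
    and norm_star_mult_self: "norm (star a * a) = (norm a)\<^sup>2"

instantiation complex :: complex_star_algebra
begin
definition scaleC_complex :: "complex \<Rightarrow> complex \<Rightarrow> complex" where "scaleC_complex c z = c * z"
definition star_complex :: "complex \<Rightarrow> complex" where "star_complex z = cnj z"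
instance by standard (simp_all add: scaleC_complex_def star_complex_def algebra_simps)
end

context complex_star_algebra
begin

lemma scaleC_zero_left: "0 *\<^sub>C a = 0"
  using scaleC_add_left[of 0 0 a] by simp

lemma scaleC_zero_right: "c *\<^sub>C 0 = 0"
  using scaleC_add_right[of c 0 0] by simp

lemma scaleC_minus_right: "c *\<^sub>C (- a) = - (c *\<^sub>C a)"
  using scaleC_add_right[of c a "-a"] by (simp add: scaleC_zero_right eq_neg_iff_add_eq_0 add.commute)

lemma scaleC_diff_right: "c *\<^sub>C (a - b) = c *\<^sub>C a - c *\<^sub>C b"
  using scaleC_add_right[of c a "-b"] by (simp add: scaleC_minus_right)

lemma star_zero: "star 0 = 0"
  using star_add[of 0 0] by simp

lemma star_minus: "star (- a) = - star a"
  using star_add[of a "-a"] by (simp add: star_zero eq_neg_iff_add_eq_0 add.commute)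

lemma star_diff: "star (a - b) = star a - star b"
  using star_add[of a "-b"] by (simp add: star_minus)

lemma star_one: "star 1 = 1"
  by (metis mult_1_left mult_1_right star_mult star_star)

end

lemma scaleC_minus1: "(-1) *\<^sub>C a = - (a::'a::complex_star_algebra)"
proof -
  have "0 *\<^sub>C a = 0" using scaleC_add_left[of 0 0 a] by simp
  moreover have "(1 + (-1)) *\<^sub>C a = a + (-1) *\<^sub>C a" by (simp only: scaleC_add_left scaleC_one)
  ultimately show ?thesis by (simp add: eq_neg_iff_add_eq_0 add.commute)
qed

definition complex_subspace :: "'a::complex_star_algebra set \<Rightarrow> bool" where
  "complex_subspace B \<longleftrightarrow> 0 \<in> B \<and> (\<forall>a\<in>B. \<forall>b\<in>B. a + b \<in> B) \<and> (\<forall>c. \<forall>a\<in>B. c *\<^sub>C a \<in> B)"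

definition cstar_subalgebra :: "'a::cstar_algebra set \<Rightarrow> bool" where
  "cstar_subalgebra B \<longleftrightarrow>
     complex_subspace B \<and> (\<forall>a\<in>B. \<forall>b\<in>B. a * b \<in> B) \<and> (\<forall>a\<in>B. star a \<in> B) \<and> closed B"

definition closed_ideal :: "'a::cstar_algebra set \<Rightarrow> bool" where
  "closed_ideal J \<longleftrightarrow> complex_subspace J \<and> (\<forall>a. \<forall>x\<in>J. a * x \<in> J \<and> x * a \<in> J) \<and> closed J"

definition proper_maximal_ideal :: "'a::cstar_algebra set \<Rightarrow> bool" where
  "proper_maximal_ideal J \<longleftrightarrow>
     closed_ideal J \<and> J \<noteq> UNIV \<and> (\<forall>K. closed_ideal K \<and> K \<noteq> UNIV \<longrightarrow> \<not> J \<subset> K)"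


section \<open>C*-completion\<close>

class pre_cstar_algebra = complex_star_algebra +
  fixes snorm :: "'a \<Rightarrow> real"
  assumes snorm_triangle: "snorm (a + b) \<le> snorm a + snorm b"
    and snorm_scaleC: "snorm (c *\<^sub>C a) = cmod c * snorm a"
    and snorm_mult: "snorm (a * b) \<le> snorm a * snorm b"
    and snorm_star: "snorm (star a) = snorm a"
    and snorm_star_mult_self: "snorm (star a * a) = (snorm a)\<^sup>2"
    and snorm_one: "snorm 1 = 1"

context pre_cstar_algebra
begin

lemma snorm_zero: "snorm 0 = 0"
  using snorm_scaleC[of 0 0] by (simp add: scaleC_zero_left)

lemma snorm_minus: "snorm (- a) = snorm a"
proof -
  have "(-1) *\<^sub>C a = - a"
    using scaleC_add_left[of 1 "-1" a] by (simp add: scaleC_one scaleC_zero_left eq_neg_iff_add_eq_0 add.commute)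
  then show ?thesis using snorm_scaleC[of "-1" a] by simp
qed

lemma snorm_nonneg: "0 \<le> snorm a"
  using snorm_triangle[of a "-a"] by (simp add: snorm_minus snorm_zero)

lemma snorm_minus_commute: "snorm (a - b) = snorm (b - a)"
  using snorm_minus[of "a - b"] by simp

lemma snorm_diff_triangle: "snorm (a - c) \<le> snorm (a - b) + snorm (b - c)"
  using snorm_triangle[of "a - b" "b - c"] by (simp add: algebra_simps)

lemma snorm_diff_le: "\<bar>snorm a - snorm b\<bar> \<le> snorm (a - b)"
  using snorm_triangle[of "a - b" b] snorm_triangle[of "b - a" a]
  by (simp add: snorm_minus_commute abs_le_iff)

definition scauchy :: "(nat \<Rightarrow> 'a) \<Rightarrow> bool" where
  "scauchy X \<longleftrightarrow> (\<forall>e>0. \<exists>N. \<forall>m\<ge>N. \<forall>n\<ge>N. snorm (X m - X n) < e)"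

definition snull :: "(nat \<Rightarrow> 'a) \<Rightarrow> bool" where
  "snull X \<longleftrightarrow> (\<lambda>n. snorm (X n)) \<longlonglongrightarrow> 0"

lemma snull_bound:
  assumes "\<And>n. snorm (X n) \<le> u n" and "u \<longlonglongrightarrow> 0"
  shows "snull X"
  unfolding snull_def
  by (rule tendsto_sandwich[OF _ _ tendsto_const assms(2)]) (simp_all add: snorm_nonneg assms(1))

lemma snull_zero: "snull (\<lambda>n. 0)"
  by (simp add: snull_def snorm_zero)

lemma snull_add: "snull X \<Longrightarrow> snull Y \<Longrightarrow> snull (\<lambda>n. X n + Y n)"
  by (rule snull_bound[where u = "\<lambda>n. snorm (X n) + snorm (Y n)"])
    (auto simp: snull_def snorm_triangle intro!: tendsto_add_zero)

lemma snull_scaleC: "snull X \<Longrightarrow> snull (\<lambda>n. c *\<^sub>C X n)"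
  by (simp add: snull_def snorm_scaleC tendsto_mult_right_zero)

lemma snull_minus: "snull X \<Longrightarrow> snull (\<lambda>n. - X n)"
  by (simp add: snull_def snorm_minus)

lemma snull_star: "snull X \<Longrightarrow> snull (\<lambda>n. star (X n))"
  by (simp add: snull_def snorm_star)

lemma snull_mult_left:
  assumes "snull X" and "\<And>n. snorm (Y n) \<le> K"
  shows "snull (\<lambda>n. X n * Y n)"
proof (rule snull_bound[where u = "\<lambda>n. snorm (X n) * K"])
  show "snorm (X n * Y n) \<le> snorm (X n) * K" for n
    by (rule order_trans[OF snorm_mult mult_left_mono[OF assms(2) snorm_nonneg]])
qed (use assms(1) in \<open>simp add: snull_def tendsto_mult_left_zero\<close>)

lemma snull_mult_right:
  assumes "snull X" and "\<And>n. snorm (Y n) \<le> K"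
  shows "snull (\<lambda>n. Y n * X n)"
proof (rule snull_bound[where u = "\<lambda>n. K * snorm (X n)"])
  show "snorm (Y n * X n) \<le> K * snorm (X n)" for n
    by (rule order_trans[OF snorm_mult mult_right_mono[OF assms(2) snorm_nonneg]])
qed (use assms(1) in \<open>simp add: snull_def tendsto_mult_right_zero\<close>)

lemma scauchy_const: "scauchy (\<lambda>n. a)"
  by (simp add: scauchy_def snorm_zero)

lemma scauchy_comp:
  assumes "scauchy X" and "scauchy Y"
    and "K \<ge> 0" and "\<And>m n. snorm (Z m - Z n) \<le> K * (snorm (X m - X n) + snorm (Y m - Y n))"
  shows "scauchy Z"
  unfolding scauchy_def
proof (intro allI impI)
  fix e :: real assume "0 < e"
  then have d: "e / (K + 1) / 2 > 0" using \<open>K \<ge> 0\<close> by simp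
  obtain M N where M: "\<forall>m\<ge>M. \<forall>n\<ge>M. snorm (X m - X n) < e / (K + 1) / 2"
    and N: "\<forall>m\<ge>N. \<forall>n\<ge>N. snorm (Y m - Y n) < e / (K + 1) / 2"
    using assms(1,2) d unfolding scauchy_def by meson
  have "snorm (Z m - Z n) < e" if "m \<ge> max M N" "n \<ge> max M N" for m n
  proof -
    have "snorm (X m - X n) + snorm (Y m - Y n) \<le> e / (K + 1) / 2 + e / (K + 1) / 2"
      using M N that by (intro add_mono less_imp_le) auto
    also have "\<dots> = e / (K + 1)" by (rule field_sum_of_halves)
    finally have "K * (snorm (X m - X n) + snorm (Y m - Y n)) \<le> K * (e / (K + 1))"
      using \<open>K \<ge> 0\<close> by (rule mult_left_mono)
    also have "\<dots> < e" using \<open>K \<ge> 0\<close> \<open>0 < e\<close> by (simp add: field_simps)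
    finally show ?thesis using assms(4)[of m n] by linarith
  qed
  then show "\<exists>N. \<forall>m\<ge>N. \<forall>n\<ge>N. snorm (Z m - Z n) < e" by blast
qed

lemma scauchy_bounded:
  assumes "scauchy X"
  shows "\<exists>K\<ge>0. \<forall>n. snorm (X n) \<le> K"
proof -
  obtain N where N: "\<forall>m\<ge>N. \<forall>n\<ge>N. snorm (X m - X n) < 1"
    using assms unfolding scauchy_def by (meson zero_less_one)
  define K where "K = Max ((\<lambda>n. snorm (X n)) ` {..N}) + 1"
  have le: "snorm (X n) \<le> K - 1" if "n \<le> N" for n
    unfolding K_def using that by simp
  have "snorm (X n) \<le> K" for n
  proof (cases "n \<le> N")
    case True
    then show ?thesis using le[of n] by simp
  next
    case False
    then have "snorm (X n - X N) < 1" using N by simp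
    then show ?thesis using snorm_triangle[of "X n - X N" "X N"] le[of N] by simp
  qed
  then show ?thesis by (metis order_trans snorm_nonneg)
qed

lemma scauchy_add: "scauchy X \<Longrightarrow> scauchy Y \<Longrightarrow> scauchy (\<lambda>n. X n + Y n)"
proof (erule (1) scauchy_comp[where K = 1])
  show "snorm (X m + Y m - (X n + Y n)) \<le> 1 * (snorm (X m - X n) + snorm (Y m - Y n))" for m n
    using snorm_triangle[of "X m - X n" "Y m - Y n"] by (simp add: algebra_simps)
qed simp

lemma scauchy_scaleC: "scauchy X \<Longrightarrow> scauchy (\<lambda>n. c *\<^sub>C X n)"
  by (rule scauchy_comp[where X = X and Y = "\<lambda>n. 0" and K = "cmod c"])
    (simp_all add: scauchy_const snorm_scaleC snorm_zero flip: scaleC_diff_right)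

lemma scauchy_minus: "scauchy X \<Longrightarrow> scauchy (\<lambda>n. - X n)"
  by (rule scauchy_comp[where X = X and Y = "\<lambda>n. 0" and K = 1])
    (simp_all add: scauchy_const snorm_zero snorm_minus_commute)

lemma scauchy_diff: "scauchy X \<Longrightarrow> scauchy Y \<Longrightarrow> scauchy (\<lambda>n. X n - Y n)"
  using scauchy_add[of X "\<lambda>n. - Y n"] scauchy_minus[of Y] by simp

lemma scauchy_star: "scauchy X \<Longrightarrow> scauchy (\<lambda>n. star (X n))"
  by (rule scauchy_comp[where X = X and Y = "\<lambda>n. 0" and K = 1])
    (simp_all add: scauchy_const snorm_zero snorm_star flip: star_diff)

lemma scauchy_mult:
  assumes X: "scauchy X" and Y: "scauchy Y"
  shows "scauchy (\<lambda>n. X n * Y n)"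
proof -
  obtain K L where K: "K \<ge> 0" "\<And>n. snorm (X n) \<le> K" and L: "L \<ge> 0" "\<And>n. snorm (Y n) \<le> L"
    using scauchy_bounded[OF X] scauchy_bounded[OF Y] by blast
  show ?thesis
  proof (rule scauchy_comp[OF X Y, where K = "K + L"])
    fix m n
    have "snorm (X m * Y m - X n * Y n) \<le> snorm ((X m - X n) * Y m) + snorm (X n * (Y m - Y n))"
      using snorm_triangle[of "(X m - X n) * Y m" "X n * (Y m - Y n)"] by (simp add: algebra_simps)
    also have "\<dots> \<le> snorm (X m - X n) * L + K * snorm (Y m - Y n)"
      by (intro add_mono order_trans[OF snorm_mult] mult_left_mono mult_right_mono K L snorm_nonneg)
    also have "\<dots> \<le> (K + L) * (snorm (X m - X n) + snorm (Y m - Y n))"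
      using K L by (simp add: algebra_simps snorm_nonneg)
    finally show "snorm (X m * Y m - X n * Y n) \<le> (K + L) * (snorm (X m - X n) + snorm (Y m - Y n))" .
  qed (use K L in simp)
qed

lemma scauchy_snorm_LIMSEQ:
  assumes "scauchy X"
  shows "(\<lambda>n. snorm (X n)) \<longlonglongrightarrow> lim (\<lambda>n. snorm (X n))"
proof -
  have "Cauchy (\<lambda>n. snorm (X n))"
    unfolding Cauchy_def dist_real_def
    using assms unfolding scauchy_def by (meson order.strict_trans1 snorm_diff_le)
  then show ?thesis by (simp add: Cauchy_convergent_iff convergent_LIMSEQ_iff)
qed

definition completion_rel :: "(nat \<Rightarrow> 'a) \<Rightarrow> (nat \<Rightarrow> 'a) \<Rightarrow> bool" where
  "completion_rel X Y \<longleftrightarrow> scauchy X \<and> scauchy Y \<and> snull (\<lambda>n. X n - Y n)"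

lemma completion_rel_refl: "completion_rel X X \<longleftrightarrow> scauchy X"
  by (simp add: completion_rel_def snull_zero)

lemma part_equivp_completion_rel: "part_equivp completion_rel"
proof (rule part_equivpI)
  show "\<exists>X. completion_rel X X" using completion_rel_refl scauchy_const by blast
  show "symp completion_rel"
    by (rule sympI) (auto simp: completion_rel_def snull_def snorm_minus_commute)
  show "transp completion_rel"
  proof (rule transpI)
    fix X Y Z assume "completion_rel X Y" "completion_rel Y Z"
    then show "completion_rel X Z"
      using snull_add[of "\<lambda>n. X n - Y n" "\<lambda>n. Y n - Z n"]
      by (auto simp: completion_rel_def algebra_simps)
  qed
qed

lemma completion_rel_add:
  assumes "completion_rel X X'" "completion_rel Y Y'"
  shows "completion_rel (\<lambda>n. X n + Y n) (\<lambda>n. X' n + Y' n)"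
  using assms snull_add[of "\<lambda>n. X n - X' n" "\<lambda>n. Y n - Y' n"]
  by (auto simp: completion_rel_def scauchy_add algebra_simps)

lemma completion_rel_minus:
  "completion_rel X X' \<Longrightarrow> completion_rel (\<lambda>n. - X n) (\<lambda>n. - X' n)"
  using snull_minus[of "\<lambda>n. X n - X' n"]
  by (auto simp: completion_rel_def scauchy_minus)

lemma completion_rel_diff:
  assumes "completion_rel X X'" "completion_rel Y Y'"
  shows "completion_rel (\<lambda>n. X n - Y n) (\<lambda>n. X' n - Y' n)"
  using completion_rel_add[OF assms(1) completion_rel_minus[OF assms(2)]] by simp

lemma completion_rel_scaleC:
  "completion_rel X X' \<Longrightarrow> completion_rel (\<lambda>n. c *\<^sub>C X n) (\<lambda>n. c *\<^sub>C X' n)"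
  using snull_scaleC[of "\<lambda>n. X n - X' n"]
  by (auto simp: completion_rel_def scauchy_scaleC scaleC_diff_right)

lemma completion_rel_star:
  "completion_rel X X' \<Longrightarrow> completion_rel (\<lambda>n. star (X n)) (\<lambda>n. star (X' n))"
  using snull_star[of "\<lambda>n. X n - X' n"]
  by (auto simp: completion_rel_def scauchy_star star_diff)

lemma completion_rel_mult:
  assumes X: "completion_rel X X'" and Y: "completion_rel Y Y'"
  shows "completion_rel (\<lambda>n. X n * Y n) (\<lambda>n. X' n * Y' n)"
proof -
  obtain K L where K: "\<And>n. snorm (X' n) \<le> K" and L: "\<And>n. snorm (Y n) \<le> L"
    using X Y scauchy_bounded unfolding completion_rel_def by meson
  have "snull (\<lambda>n. (X n - X' n) * Y n + X' n * (Y n - Y' n))"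
    using X Y K L by (intro snull_add snull_mult_left snull_mult_right) (auto simp: completion_rel_def)
  then show ?thesis using X Y by (simp add: completion_rel_def scauchy_mult algebra_simps)
qed

lemma completion_rel_lim:
  assumes "completion_rel X Y"
  shows "lim (\<lambda>n. snorm (X n)) = lim (\<lambda>n. snorm (Y n))"
proof -
  have X: "scauchy X" and Y: "scauchy Y" and d: "(\<lambda>n. snorm (X n - Y n)) \<longlonglongrightarrow> 0"
    using assms by (auto simp: completion_rel_def snull_def)
  have "(\<lambda>n. snorm (X n) - snorm (Y n)) \<longlonglongrightarrow> 0"
    by (rule Lim_null_comparison[OF _ d]) (simp add: snorm_diff_le)
  moreover have "(\<lambda>n. snorm (X n) - snorm (Y n)) \<longlonglongrightarrow> lim (\<lambda>n. snorm (X n)) - lim (\<lambda>n. snorm (Y n))"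
    by (intro tendsto_diff scauchy_snorm_LIMSEQ X Y)
  ultimately show ?thesis using LIMSEQ_unique by fastforce
qed

end

text \<open>
  Cauchy sequences modulo null sequences; in particular, the kernel of the seminorm is
  divided out.
\<close>

quotient_type (overloaded) 'a cstar_completion =
    "nat \<Rightarrow> 'a::pre_cstar_algebra" / partial: "completion_rel :: (nat \<Rightarrow> 'a) \<Rightarrow> (nat \<Rightarrow> 'a) \<Rightarrow> bool"
  by (rule part_equivp_completion_rel)

instantiation cstar_completion :: (pre_cstar_algebra) complex_star_algebra
begin

lift_definition zero_cstar_completion :: "'a cstar_completion" is "\<lambda>n. 0"
  by (simp add: completion_rel_refl scauchy_const)
lift_definition one_cstar_completion :: "'a cstar_completion" is "\<lambda>n. 1"
  by (simp add: completion_rel_refl scauchy_const)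
lift_definition plus_cstar_completion ::
  "'a cstar_completion \<Rightarrow> 'a cstar_completion \<Rightarrow> 'a cstar_completion" is "\<lambda>X Y n. X n + Y n"
  by (rule completion_rel_add)
lift_definition minus_cstar_completion ::
  "'a cstar_completion \<Rightarrow> 'a cstar_completion \<Rightarrow> 'a cstar_completion" is "\<lambda>X Y n. X n - Y n"
  by (rule completion_rel_diff)
lift_definition uminus_cstar_completion ::
  "'a cstar_completion \<Rightarrow> 'a cstar_completion" is "\<lambda>X n. - X n"
  by (rule completion_rel_minus)
lift_definition times_cstar_completion ::
  "'a cstar_completion \<Rightarrow> 'a cstar_completion \<Rightarrow> 'a cstar_completion" is "\<lambda>X Y n. X n * Y n"
  by (rule completion_rel_mult)
lift_definition scaleC_cstar_completion ::
  "complex \<Rightarrow> 'a cstar_completion \<Rightarrow> 'a cstar_completion" is "\<lambda>c X n. c *\<^sub>C X n"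
  by (rule completion_rel_scaleC)
lift_definition star_cstar_completion ::
  "'a cstar_completion \<Rightarrow> 'a cstar_completion" is "\<lambda>X n. star (X n)"
  by (rule completion_rel_star)
instance
proof
  show "(0::'a cstar_completion) \<noteq> 1"
  proof transfer
    show "\<not> completion_rel (\<lambda>n. 0 :: 'a) (\<lambda>n. 1)"
      by (simp add: completion_rel_def snull_def snorm_minus snorm_one LIMSEQ_const_iff)
  qed
qed (transfer; simp add: completion_rel_refl algebra_simps scauchy_const scauchy_add scauchy_minus
      scauchy_diff scauchy_mult scauchy_scaleC scauchy_star scaleC_add_right scaleC_add_left
      scaleC_scaleC scaleC_one mult_scaleC_left mult_scaleC_right star_add star_mult star_star
      star_scaleC)+

end

lemma ex_completion_rep: "\<exists>X. scauchy X \<and> a = abs_cstar_completion X"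
  by (metis Quotient_abs_rep Quotient_cstar_completion Quotient_rep_reflp completion_rel_refl)

instantiation cstar_completion :: (pre_cstar_algebra) real_normed_algebra_1
begin

lift_definition norm_cstar_completion :: "'a cstar_completion \<Rightarrow> real"
  is "\<lambda>X. lim (\<lambda>n. snorm (X n))"
  by (rule completion_rel_lim)

definition scaleR_cstar_completion :: "real \<Rightarrow> 'a cstar_completion \<Rightarrow> 'a cstar_completion" where
  "scaleR_cstar_completion r a = complex_of_real r *\<^sub>C a"
definition dist_cstar_completion :: "'a cstar_completion \<Rightarrow> 'a cstar_completion \<Rightarrow> real" where
  "dist_cstar_completion a b = norm (a - b)"
definition sgn_cstar_completion :: "'a cstar_completion \<Rightarrow> 'a cstar_completion" where
  "sgn_cstar_completion a = complex_of_real (inverse (norm a)) *\<^sub>C a"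
definition uniformity_cstar_completion :: "('a cstar_completion \<times> 'a cstar_completion) filter" where
  "uniformity_cstar_completion = (INF e\<in>{0<..}. principal {(a, b). dist a b < e})"
definition open_cstar_completion :: "'a cstar_completion set \<Rightarrow> bool" where
  "open_cstar_completion U \<longleftrightarrow> (\<forall>a\<in>U. \<forall>\<^sub>F (a', b) in uniformity. a' = a \<longrightarrow> b \<in> U)"

lemma norm_abs_completion:
  "scauchy X \<Longrightarrow> (\<lambda>n. snorm (X n)) \<longlonglongrightarrow> norm (abs_cstar_completion X)"
  by (simp add: norm_cstar_completion.abs_eq completion_rel_refl scauchy_snorm_LIMSEQ)

lemma norm_completion:
  fixes a b :: "'a cstar_completion"
  shows "norm (a + b) \<le> norm a + norm b" "norm (a * b) \<le> norm a * norm b"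
    "norm (c *\<^sub>C a) = cmod c * norm a" "norm (star a * a) = (norm a)\<^sup>2"
    "norm (1::'a cstar_completion) = 1" "norm a = 0 \<longleftrightarrow> a = 0"
proof -
  obtain X Y where X: "scauchy X" "a = abs_cstar_completion X"
    and Y: "scauchy Y" "b = abs_cstar_completion Y"
    using ex_completion_rep by meson
  note lims = norm_abs_completion[OF X(1), folded X(2)] norm_abs_completion[OF Y(1), folded Y(2)]
  note refls = X(1)[folded completion_rel_refl] Y(1)[folded completion_rel_refl]
  have "(\<lambda>n. snorm (X n + Y n)) \<longlonglongrightarrow> norm (a + b)"
    using norm_abs_completion[OF scauchy_add[OF X(1) Y(1)]] refls by (simp add: X(2) Y(2) plus_cstar_completion.abs_eq)
  then show "norm (a + b) \<le> norm a + norm b"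
    by (rule LIMSEQ_le[OF _ tendsto_add[OF lims]]) (simp add: snorm_triangle)
  have "(\<lambda>n. snorm (X n * Y n)) \<longlonglongrightarrow> norm (a * b)"
    using norm_abs_completion[OF scauchy_mult[OF X(1) Y(1)]] refls by (simp add: X(2) Y(2) times_cstar_completion.abs_eq)
  then show "norm (a * b) \<le> norm a * norm b"
    by (rule LIMSEQ_le[OF _ tendsto_mult[OF lims]]) (simp add: snorm_mult)
  have "(\<lambda>n. snorm (c *\<^sub>C X n)) \<longlonglongrightarrow> norm (c *\<^sub>C a)"
    using norm_abs_completion[OF scauchy_scaleC[OF X(1)]] refls by (simp add: X(2) scaleC_cstar_completion.abs_eq)
  then have "(\<lambda>n. cmod c * snorm (X n)) \<longlonglongrightarrow> norm (c *\<^sub>C a)" by (simp add: snorm_scaleC)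
  then show "norm (c *\<^sub>C a) = cmod c * norm a"
    by (rule LIMSEQ_unique[OF _ tendsto_mult[OF tendsto_const lims(1)]])
  have "(\<lambda>n. snorm (star (X n) * X n)) \<longlonglongrightarrow> norm (star a * a)"
    using norm_abs_completion[OF scauchy_mult[OF scauchy_star[OF X(1)] X(1)]] refls
    by (simp add: X(2) times_cstar_completion.abs_eq star_cstar_completion.abs_eq completion_rel_refl scauchy_star)
  then have "(\<lambda>n. (snorm (X n))\<^sup>2) \<longlonglongrightarrow> norm (star a * a)" by (simp add: snorm_star_mult_self)
  then show "norm (star a * a) = (norm a)\<^sup>2"
    by (rule LIMSEQ_unique[OF _ tendsto_power[OF lims(1)]])
  show "norm (1::'a cstar_completion) = 1"
    by transfer (simp add: snorm_one)
  have "norm a = 0 \<longleftrightarrow> snull X"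
    unfolding snull_def using lims(1) LIMSEQ_unique by auto
  also have "\<dots> \<longleftrightarrow> completion_rel X (\<lambda>n. 0)"
    by (simp add: completion_rel_def X(1) scauchy_const)
  also have "\<dots> \<longleftrightarrow> a = 0"
    unfolding X(2) zero_cstar_completion_def
    using Quotient_rel_abs2[OF Quotient_cstar_completion] Quotient_rel[OF Quotient_cstar_completion] X(1)
    by (metis completion_rel_refl scauchy_const map_fun_apply id_apply)
  finally show "norm a = 0 \<longleftrightarrow> a = 0" .
qed

instance
proof
  fix a b d :: "'a cstar_completion" and c c' :: complex and r r' :: real
    and U :: "'a cstar_completion set"
  show "dist a b = norm (a - b)" by (rule dist_cstar_completion_def)
  show "uniformity = (INF e\<in>{0<..}. principal {(x, y :: 'a cstar_completion). dist x y < e})"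
    by (rule uniformity_cstar_completion_def)
  show "open U \<longleftrightarrow> (\<forall>x\<in>U. \<forall>\<^sub>F (x', y) in uniformity. x' = x \<longrightarrow> y \<in> U)"
    by (rule open_cstar_completion_def)
  show "sgn a = inverse (norm a) *\<^sub>R a"
    by (simp add: sgn_cstar_completion_def scaleR_cstar_completion_def)
  show "norm (r *\<^sub>R a) = \<bar>r\<bar> * norm a"
    by (simp add: scaleR_cstar_completion_def norm_completion)
qed (simp_all add: norm_completion scaleR_cstar_completion_def scaleC_add_right scaleC_add_left
       scaleC_scaleC scaleC_one mult_scaleC_left mult_scaleC_right)

end

lift_definition to_completion :: "'a::pre_cstar_algebra \<Rightarrow> 'a cstar_completion" is "\<lambda>a n. a"
  by (simp add: completion_rel_refl scauchy_const)

lemma to_completion_hom: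
  "to_completion 0 = 0" "to_completion 1 = 1"
  "to_completion (a + b) = to_completion a + to_completion b"
  "to_completion (a * b) = to_completion a * to_completion b"
  "to_completion (c *\<^sub>C a) = c *\<^sub>C to_completion a"
  "to_completion (star a) = star (to_completion a)"
  "to_completion (a - b) = to_completion a - to_completion b"
  by (transfer; simp add: completion_rel_refl scauchy_const)+

lemma norm_to_completion: "norm (to_completion a) = snorm a"
  by transfer simp

lemma to_completion_LIMSEQ:
  assumes "scauchy X"
  shows "(\<lambda>n. to_completion (X n)) \<longlonglongrightarrow> abs_cstar_completion X"
proof (rule metric_LIMSEQ_I)
  fix e :: real assume "0 < e"
  then obtain N where N: "\<forall>m\<ge>N. \<forall>n\<ge>N. snorm (X m - X n) < e / 2"
    using assms unfolding scauchy_def by (meson half_gt_zero)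
  have "dist (to_completion (X n)) (abs_cstar_completion X) < e" if "n \<ge> N" for n
  proof -
    have c: "scauchy (\<lambda>m. X n - X m)" by (intro scauchy_diff scauchy_const assms)
    have "to_completion (X n) - abs_cstar_completion X = abs_cstar_completion (\<lambda>m. X n - X m)"
      using assms by (simp add: to_completion.abs_eq minus_cstar_completion.abs_eq
          completion_rel_refl scauchy_const)
    then have "(\<lambda>m. snorm (X n - X m)) \<longlonglongrightarrow> dist (to_completion (X n)) (abs_cstar_completion X)"
      using norm_abs_completion[OF c] by (simp add: dist_norm)
    then have "dist (to_completion (X n)) (abs_cstar_completion X) \<le> e / 2"
      by (rule LIMSEQ_le_const2) (use N that in \<open>auto intro!: exI[of _ N] less_imp_le\<close>)
    then show ?thesis using \<open>0 < e\<close> by linarith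
  qed
  then show "\<exists>N. \<forall>n\<ge>N. dist (to_completion (X n)) (abs_cstar_completion X) < e" by blast
qed

lemma to_completion_dense: "closure (range to_completion) = UNIV"
proof -
  have "a \<in> closure (range to_completion)" for a :: "'a cstar_completion"
  proof -
    obtain X where "scauchy X" "a = abs_cstar_completion X" using ex_completion_rep by blast
    then show ?thesis unfolding closure_sequential
      by (intro exI[of _ "\<lambda>n. to_completion (X n)"]) (simp add: to_completion_LIMSEQ)
  qed
  then show ?thesis by blast
qed

instance cstar_completion :: (pre_cstar_algebra) cstar_algebra
proof
  fix X :: "nat \<Rightarrow> 'a cstar_completion"
  assume X: "Cauchy X"
  have "\<exists>a. dist (to_completion a) (X n) < inverse (real (Suc n))" for n
    using closure_approachable[of "X n" "range to_completion"] by (auto simp: to_completion_dense)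
  then obtain a where a: "\<And>n. dist (to_completion (a n)) (X n) < inverse (real (Suc n))"
    by metis
  have "(\<lambda>n. dist (to_completion (a n)) (X n)) \<longlonglongrightarrow> 0"
    by (rule tendsto_sandwich[OF _ _ tendsto_const LIMSEQ_inverse_real_of_nat])
      (intro always_eventually allI zero_le_dist less_imp_le a)+
  then have d: "(\<lambda>n. to_completion (a n) - X n) \<longlonglongrightarrow> 0"
    by (simp add: dist_norm tendsto_norm_zero_iff)
  have "scauchy a"
    unfolding scauchy_def
  proof (intro allI impI)
    fix e :: real assume "0 < e"
    then have e: "0 < e / 3" by simp
    obtain M where M: "\<And>m n. m \<ge> M \<Longrightarrow> n \<ge> M \<Longrightarrow> dist (X m) (X n) < e / 3"
      using metric_CauchyD[OF X e] by blast
    obtain N where N: "\<And>n. n \<ge> N \<Longrightarrow> dist (to_completion (a n)) (X n) < e / 3"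
      using metric_LIMSEQ_D[OF d e] by (auto simp: dist_norm)
    have "snorm (a m - a n) < e" if "m \<ge> max M N" "n \<ge> max M N" for m n
    proof -
      have "dist (to_completion (a m)) (to_completion (a n)) \<le>
          dist (to_completion (a m)) (X m) + dist (X m) (X n) + dist (to_completion (a n)) (X n)"
        using dist_triangle[of "to_completion (a m)" "to_completion (a n)" "X m"]
          dist_triangle[of "X m" "to_completion (a n)" "X n"]
        by (simp add: dist_commute)
      also have "\<dots> < e / 3 + e / 3 + e / 3"
        by (intro add_strict_mono M N) (use that in auto)
      finally show ?thesis by (simp add: dist_norm to_completion_hom(7)[symmetric] norm_to_completion)
    qed
    then show "\<exists>N. \<forall>m\<ge>N. \<forall>n\<ge>N. snorm (a m - a n) < e" by blast
  qed
  then have "(\<lambda>n. to_completion (a n) - (to_completion (a n) - X n)) \<longlonglongrightarrow> abs_cstar_completion a - 0"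
    by (intro tendsto_diff to_completion_LIMSEQ d)
  then have "X \<longlonglongrightarrow> abs_cstar_completion a" by simp
  then show "convergent X" by (rule convergentI)
qed (simp_all add: norm_completion scaleR_cstar_completion_def)

section \<open>States\<close>

text \<open>
  A functional on a *-subalgebra \<open>B\<close> containing \<open>1\<close> is represented by a total function,
  of which only the values on \<open>B\<close> are significant.
\<close>

definition state_on :: "'a::complex_star_algebra set \<Rightarrow> ('a \<Rightarrow> complex) \<Rightarrow> bool" where
  "state_on B \<omega> \<longleftrightarrow>
     (\<forall>a\<in>B. \<forall>b\<in>B. \<omega> (a + b) = \<omega> a + \<omega> b) \<and>
     (\<forall>c. \<forall>a\<in>B. \<omega> (c *\<^sub>C a) = c * \<omega> a) \<and>
     (\<forall>a\<in>B. \<omega> (star a * a) \<in> \<real>\<^sub>\<ge>\<^sub>0) \<and>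
     \<omega> 1 = 1"

definition pure_state_on :: "'a::complex_star_algebra set \<Rightarrow> ('a \<Rightarrow> complex) \<Rightarrow> bool" where
  "pure_state_on B chi \<longleftrightarrow> state_on B chi \<and>
     (\<forall>\<phi> \<psi> t. state_on B \<phi> \<and> state_on B \<psi> \<and> 0 < t \<and> t < 1 \<and>
        (\<forall>a\<in>B. chi a = complex_of_real t * \<phi> a + complex_of_real (1 - t) * \<psi> a) \<longrightarrow>
        (\<forall>a\<in>B. \<phi> a = chi a \<and> \<psi> a = chi a))"

abbreviation state :: "('a::complex_star_algebra \<Rightarrow> complex) \<Rightarrow> bool" where
  "state \<equiv> state_on UNIV"

text \<open>
  The GNS space of \<open>\<omega>\<close> is the completion of the algebra modulo the null vectors of
  \<open>\<langle>a, b\<rangle> = \<omega> (star a * b)\<close>, and \<open>\<pi>\<^sub>\<omega>(a)\<close> acts on it by left multiplication.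
  Hence \<open>gns_vec \<omega> b\<close> is the norm of the vector of \<open>b\<close>, and \<open>gns_norm \<omega> a\<close>, the
  supremum being over the dense subspace of these vectors, is \<open>\<parallel>\<pi>\<^sub>\<omega>(a)\<parallel>\<close> whenever
  \<open>\<pi>\<^sub>\<omega>(a)\<close> is bounded.
\<close>

definition gns_vec :: "('a::complex_star_algebra \<Rightarrow> complex) \<Rightarrow> 'a \<Rightarrow> real" where
  "gns_vec \<omega> b = sqrt (Re (\<omega> (star b * b)))"

definition gns_norm :: "('a::complex_star_algebra \<Rightarrow> complex) \<Rightarrow> 'a \<Rightarrow> real" where
  "gns_norm \<omega> a = (SUP b\<in>{b. gns_vec \<omega> b \<le> 1}. gns_vec \<omega> (a * b))"


lemma state_simps:
  assumes "state \<omega>"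
  shows "\<omega> (a + b) = \<omega> a + \<omega> b" "\<omega> (c *\<^sub>C a) = c * \<omega> a" "\<omega> 1 = 1"
    "0 \<le> Re (\<omega> (star a * a))" "Im (\<omega> (star a * a)) = 0"
  using assms by (auto simp: state_on_def complex_nonneg_Reals_iff)

lemma state_hermitian:
  assumes "state \<omega>"
  shows "\<omega> (star b * a) = cnj (\<omega> (star a * b))"
proof -
  note \<omega> = state_simps[OF assms]
  have "Im (\<omega> (star (a + b) * (a + b))) = 0" by (rule \<omega>(5))
  then have 1: "Im (\<omega> (star a * b)) + Im (\<omega> (star b * a)) = 0"
    by (simp add: star_add distrib_left distrib_right \<omega>)
  have "Im (\<omega> (star (a + \<i> *\<^sub>C b) * (a + \<i> *\<^sub>C b))) = 0" by (rule \<omega>(5))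
  then have "Re (\<omega> (star a * b)) - Re (\<omega> (star b * a)) = 0"
    by (simp add: star_add star_scaleC distrib_left distrib_right mult_scaleC_left mult_scaleC_right \<omega>)
  with 1 show ?thesis by (simp add: complex_eq_iff)
qed

lemma gns_vec_nonneg: "state \<omega> \<Longrightarrow> 0 \<le> gns_vec \<omega> a"
  by (simp add: gns_vec_def state_simps)

lemma gns_vec_power2: "state \<omega> \<Longrightarrow> (gns_vec \<omega> a)\<^sup>2 = Re (\<omega> (star a * a))"
  by (simp add: gns_vec_def state_simps)

lemma gns_vec_add_scaleC:
  assumes "state \<omega>"
  shows "(gns_vec \<omega> (a + c *\<^sub>C b))\<^sup>2 =
    (gns_vec \<omega> a)\<^sup>2 + 2 * Re (c * \<omega> (star a * b)) + (cmod c)\<^sup>2 * (gns_vec \<omega> b)\<^sup>2"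
proof -
  note \<omega> = state_simps[OF assms]
  have "\<omega> (star (a + c *\<^sub>C b) * (a + c *\<^sub>C b)) = \<omega> (star a * a) + c * \<omega> (star a * b)
      + cnj (c * \<omega> (star a * b)) + (c * cnj c) * \<omega> (star b * b)"
    by (simp add: star_add star_scaleC distrib_left distrib_right mult_scaleC_left mult_scaleC_right \<omega>
        state_hermitian[OF assms, of b a])
  then show ?thesis
    by (simp add: gns_vec_power2 assms \<omega> complex_mult_cnj cmod_power2 flip: of_real_power of_real_add)
qed

lemma gns_Cauchy_Schwarz:
  assumes "state \<omega>"
  shows "cmod (\<omega> (star a * b)) \<le> gns_vec \<omega> a * gns_vec \<omega> b"
proof -
  define z A B where "z = \<omega> (star a * b)" and "A = (gns_vec \<omega> a)\<^sup>2" and "B = (gns_vec \<omega> b)\<^sup>2"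
  have *: "0 \<le> A - 2 * t * (cmod z)\<^sup>2 + t\<^sup>2 * (cmod z)\<^sup>2 * B" for t :: real
  proof -
    have "0 \<le> (gns_vec \<omega> (a + (- complex_of_real t * cnj z) *\<^sub>C b))\<^sup>2" by simp
    also have "\<dots> = A + 2 * Re ((- complex_of_real t * cnj z) * z)
        + (cmod (- complex_of_real t * cnj z))\<^sup>2 * B"
      unfolding gns_vec_add_scaleC[OF assms] z_def A_def B_def ..
    also have "(- complex_of_real t * cnj z) * z = - complex_of_real (t * (cmod z)\<^sup>2)"
      by (simp add: complex_norm_square mult.commute del: of_real_power)
    finally show ?thesis by (simp add: norm_mult power_mult_distrib)
  qed
  have "(cmod z)\<^sup>2 \<le> A * B"
  proof (cases "B = 0")
    case True
    have "z = 0"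
    proof (rule ccontr)
      assume "z \<noteq> 0"
      then show False using *[of "(A + 1) / (2 * (cmod z)\<^sup>2)"] True by (simp add: field_simps A_def)
    qed
    then show ?thesis using True by simp
  next
    case False
    then have "B > 0" by (simp add: B_def)
    then show ?thesis using *[of "1 / B"] by (simp add: field_simps power2_eq_square)
  qed
  then have "(cmod z)\<^sup>2 \<le> (gns_vec \<omega> a * gns_vec \<omega> b)\<^sup>2"
    by (simp add: A_def B_def power_mult_distrib)
  then show ?thesis unfolding z_def
    by (rule power2_le_imp_le) (simp add: gns_vec_nonneg assms)
qed

lemma gns_vec_scaleC: "state \<omega> \<Longrightarrow> gns_vec \<omega> (c *\<^sub>C a) = cmod c * gns_vec \<omega> a"
  using gns_vec_add_scaleC[of \<omega> 0 c a]
  by (simp add: star_zero gns_vec_def state_simps star_scaleC mult_scaleC_left mult_scaleC_right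
      real_sqrt_mult complex_mult_cnj cmod_def power2_eq_square flip: mult.assoc)

lemma gns_vec_triangle:
  assumes "state \<omega>"
  shows "gns_vec \<omega> (a + b) \<le> gns_vec \<omega> a + gns_vec \<omega> b"
proof (rule power2_le_imp_le)
  have "(gns_vec \<omega> (a + b))\<^sup>2 = (gns_vec \<omega> a)\<^sup>2 + 2 * Re (\<omega> (star a * b)) + (gns_vec \<omega> b)\<^sup>2"
    using gns_vec_add_scaleC[OF assms, of a 1 b] by (simp add: scaleC_one)
  also have "Re (\<omega> (star a * b)) \<le> gns_vec \<omega> a * gns_vec \<omega> b"
    using gns_Cauchy_Schwarz[OF assms] complex_Re_le_cmod order_trans by blast
  finally show "(gns_vec \<omega> (a + b))\<^sup>2 \<le> (gns_vec \<omega> a + gns_vec \<omega> b)\<^sup>2"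
    by (simp add: power2_sum)
qed (simp add: gns_vec_nonneg assms)

definition gns_bound :: "'a::complex_star_algebra \<Rightarrow> real \<Rightarrow> bool" where
  "gns_bound a C \<longleftrightarrow>
     0 \<le> C \<and> (\<forall>\<omega> b. state \<omega> \<longrightarrow> gns_vec \<omega> (a * b) \<le> C * gns_vec \<omega> b)"

lemma gns_bound_add: "gns_bound a C \<Longrightarrow> gns_bound b D \<Longrightarrow> gns_bound (a + b) (C + D)"
  unfolding gns_bound_def
  by (auto simp: distrib_right intro!: order_trans[OF gns_vec_triangle] add_mono)

lemma gns_bound_mult:
  assumes "gns_bound a C" "gns_bound b D"
  shows "gns_bound (a * b) (C * D)"
  unfolding gns_bound_def
proof (intro conjI allI impI)
  fix \<omega> :: "'a \<Rightarrow> complex" and d assume "state \<omega>"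
  then have "gns_vec \<omega> (a * (b * d)) \<le> C * gns_vec \<omega> (b * d)"
    using assms(1) by (simp add: gns_bound_def)
  also have "\<dots> \<le> C * (D * gns_vec \<omega> d)"
    using assms \<open>state \<omega>\<close> by (intro mult_left_mono) (auto simp: gns_bound_def)
  finally show "gns_vec \<omega> (a * b * d) \<le> C * D * gns_vec \<omega> d" by (simp add: mult.assoc)
qed (use assms in \<open>simp add: gns_bound_def\<close>)

lemma gns_bound_scaleC: "gns_bound a C \<Longrightarrow> gns_bound (c *\<^sub>C a) (cmod c * C)"
  unfolding gns_bound_def
  by (auto simp: mult_scaleC_left gns_vec_scaleC mult.assoc intro!: mult_left_mono)

lemma gns_bound_one: "gns_bound 1 1"
  by (simp add: gns_bound_def)

lemma gns_bound_star_mult_self: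
  assumes "gns_bound (star a * a) (C\<^sup>2)" "0 \<le> C"
  shows "gns_bound a C"
  unfolding gns_bound_def
proof (intro conjI allI impI assms)
  fix \<omega> :: "'a \<Rightarrow> complex" and b assume \<omega>: "state \<omega>"
  have "(gns_vec \<omega> (a * b))\<^sup>2 = Re (\<omega> (star b * (star a * a * b)))"
    by (simp add: gns_vec_power2 \<omega> star_mult mult.assoc)
  also have "\<dots> \<le> gns_vec \<omega> b * gns_vec \<omega> (star a * a * b)"
    using gns_Cauchy_Schwarz[OF \<omega>] complex_Re_le_cmod order_trans by blast
  also have "\<dots> \<le> gns_vec \<omega> b * (C\<^sup>2 * gns_vec \<omega> b)"
    using assms(1) \<omega> by (intro mult_left_mono) (auto simp: gns_bound_def gns_vec_nonneg)
  also have "\<dots> = (C * gns_vec \<omega> b)\<^sup>2" by (simp add: power2_eq_square)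
  finally show "gns_vec \<omega> (a * b) \<le> C * gns_vec \<omega> b"
    by (rule power2_le_imp_le) (simp add: assms gns_vec_nonneg \<omega>)
qed

lemma mult_le_cancel_nonneg:
  fixes k v w :: real
  assumes "k * v * v \<le> w * v" "0 \<le> v" "0 \<le> w"
  shows "k * v \<le> w"
proof (cases "v = 0")
  case False
  then show ?thesis using assms mult_right_le_imp_le[of "k * v" v w] by simp
qed (use assms in simp)

lemma gns_bound_star:
  assumes "gns_bound a C"
  shows "gns_bound (star a) C"
  unfolding gns_bound_def
proof (intro conjI allI impI)
  show "0 \<le> C" using assms by (simp add: gns_bound_def)
  fix \<omega> :: "'a \<Rightarrow> complex" and b assume \<omega>: "state \<omega>"
  have "(gns_vec \<omega> (star a * b))\<^sup>2 = Re (\<omega> (star b * (a * (star a * b))))"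
    by (simp add: gns_vec_power2 \<omega> star_mult star_star mult.assoc)
  also have "\<dots> \<le> gns_vec \<omega> b * gns_vec \<omega> (a * (star a * b))"
    using gns_Cauchy_Schwarz[OF \<omega>] complex_Re_le_cmod order_trans by blast
  also have "\<dots> \<le> gns_vec \<omega> b * (C * gns_vec \<omega> (star a * b))"
    using assms \<omega> by (intro mult_left_mono) (auto simp: gns_bound_def gns_vec_nonneg)
  finally have "1 * gns_vec \<omega> (star a * b) * gns_vec \<omega> (star a * b) \<le>
      (C * gns_vec \<omega> b) * gns_vec \<omega> (star a * b)"
    by (simp add: power2_eq_square mult_ac)
  then have "1 * gns_vec \<omega> (star a * b) \<le> C * gns_vec \<omega> b"
    by (rule mult_le_cancel_nonneg) (simp_all add: gns_vec_nonneg \<omega> \<open>0 \<le> C\<close>)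
  then show "gns_vec \<omega> (star a * b) \<le> C * gns_vec \<omega> b" by simp
qed

lemma gns_norm_le:
  assumes "gns_bound a C" "state \<omega>"
  shows "gns_norm \<omega> a \<le> C" "gns_vec \<omega> (a * b) \<le> gns_norm \<omega> a * gns_vec \<omega> b"
proof -
  have le: "gns_vec \<omega> (a * b) \<le> C" if "gns_vec \<omega> b \<le> 1" for b
  proof -
    have "gns_vec \<omega> (a * b) \<le> C * gns_vec \<omega> b" using assms by (simp add: gns_bound_def)
    also have "\<dots> \<le> C * 1" using assms(1) that by (intro mult_left_mono) (auto simp: gns_bound_def)
    finally show ?thesis by simp
  qed
  have "\<omega> 0 = 0"
    using state_simps(2)[OF assms(2), of 0 0] by (simp add: scaleC_zero_left)
  then have "gns_vec \<omega> 0 \<le> 1" by (simp add: gns_vec_def star_zero)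
  then show "gns_norm \<omega> a \<le> C" unfolding gns_norm_def by (intro cSUP_least) (auto intro: le)
  have bdd: "bdd_above ((\<lambda>b. gns_vec \<omega> (a * b)) ` {b. gns_vec \<omega> b \<le> 1})"
    by (rule bdd_aboveI2[of _ _ C]) (auto intro: le)
  show "gns_vec \<omega> (a * b) \<le> gns_norm \<omega> a * gns_vec \<omega> b"
  proof (cases "gns_vec \<omega> b = 0")
    case True
    then have "gns_vec \<omega> (a * b) \<le> 0" using assms by (metis gns_bound_def mult_zero_right)
    with True show ?thesis by simp
  next
    case False
    then have pos: "gns_vec \<omega> b > 0" using gns_vec_nonneg[OF assms(2), of b] by simp
    define d where "d = complex_of_real (1 / gns_vec \<omega> b) *\<^sub>C b"
    have "gns_vec \<omega> d \<le> 1" using pos by (simp add: d_def gns_vec_scaleC assms(2) norm_divide)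
    then have "gns_vec \<omega> (a * d) \<le> gns_norm \<omega> a" unfolding gns_norm_def
      by (intro cSUP_upper bdd) simp
    moreover have "gns_vec \<omega> (a * d) = gns_vec \<omega> (a * b) / gns_vec \<omega> b"
      using pos by (simp add: d_def mult_scaleC_right gns_vec_scaleC assms(2) norm_divide)
    ultimately show ?thesis using pos by (simp add: field_simps)
  qed
qed

section \<open>The *-algebra generated by the resolvents\<close>

text \<open>
  The universal *-algebra on the symbols \<open>R(l,f)\<close> is built as terms modulo the
  least congruence that contains the axioms of unital complex *-algebras and the relations.
  There are also symbols with \<open>l = 0\<close>; they are not among the generators of the
  resolvent algebra and the rule \<open>R_zero\<close> identifies them with \<open>0\<close>.
\<close>

datatype 'x resolvent_term =
    R real 'x
  | Zero  (\<open>\<^bold>0\<close>)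
  | One  (\<open>\<^bold>1\<close>)
  | Add "'x resolvent_term" "'x resolvent_term"  (infixl \<open>\<^bold>+\<close> 65)
  | Mult "'x resolvent_term" "'x resolvent_term"  (infixl \<open>\<^bold>*\<close> 70)
  | Scale complex "'x resolvent_term"  (infixr \<open>\<^bold>\<cdot>\<close> 75)
  | Star "'x resolvent_term"

abbreviation Sub :: "'x resolvent_term \<Rightarrow> 'x resolvent_term \<Rightarrow> 'x resolvent_term"
    (infixl \<open>\<^bold>-\<close> 65) where
  "s \<^bold>- t \<equiv> s \<^bold>+ (-1) \<^bold>\<cdot> t"

inductive resolvent_cong ::
    "'x::symplectic_space resolvent_term \<Rightarrow> 'x resolvent_term \<Rightarrow> bool"  (infix \<open>\<^bold>\<sim>\<close> 50) where
  cong_refl: "s \<^bold>\<sim> s"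
| cong_sym: "s \<^bold>\<sim> t \<Longrightarrow> t \<^bold>\<sim> s"
| cong_trans: "s \<^bold>\<sim> t \<Longrightarrow> t \<^bold>\<sim> u \<Longrightarrow> s \<^bold>\<sim> u"
| cong_add: "s \<^bold>\<sim> s' \<Longrightarrow> t \<^bold>\<sim> t' \<Longrightarrow> s \<^bold>+ t \<^bold>\<sim> s' \<^bold>+ t'"
| cong_mult: "s \<^bold>\<sim> s' \<Longrightarrow> t \<^bold>\<sim> t' \<Longrightarrow> s \<^bold>* t \<^bold>\<sim> s' \<^bold>* t'"
| cong_scale: "s \<^bold>\<sim> t \<Longrightarrow> c \<^bold>\<cdot> s \<^bold>\<sim> c \<^bold>\<cdot> t"
| cong_star: "s \<^bold>\<sim> t \<Longrightarrow> Star s \<^bold>\<sim> Star t"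

| ax_add_assoc: "s \<^bold>+ t \<^bold>+ u \<^bold>\<sim> s \<^bold>+ (t \<^bold>+ u)"
| ax_add_commute: "s \<^bold>+ t \<^bold>\<sim> t \<^bold>+ s"
| ax_add_zero: "\<^bold>0 \<^bold>+ s \<^bold>\<sim> s"
| ax_add_minus: "s \<^bold>- s \<^bold>\<sim> \<^bold>0"
| ax_mult_assoc: "s \<^bold>* t \<^bold>* u \<^bold>\<sim> s \<^bold>* (t \<^bold>* u)"
| ax_one_mult: "\<^bold>1 \<^bold>* s \<^bold>\<sim> s"
| ax_mult_one: "s \<^bold>* \<^bold>1 \<^bold>\<sim> s"
| ax_distrib_right: "(s \<^bold>+ t) \<^bold>* u \<^bold>\<sim> s \<^bold>* u \<^bold>+ t \<^bold>* u"
| ax_distrib_left: "s \<^bold>* (t \<^bold>+ u) \<^bold>\<sim> s \<^bold>* t \<^bold>+ s \<^bold>* u"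
| ax_scale_add_right: "c \<^bold>\<cdot> (s \<^bold>+ t) \<^bold>\<sim> c \<^bold>\<cdot> s \<^bold>+ c \<^bold>\<cdot> t"
| ax_scale_add_left: "(c + d) \<^bold>\<cdot> s \<^bold>\<sim> c \<^bold>\<cdot> s \<^bold>+ d \<^bold>\<cdot> s"
| ax_scale_scale: "c \<^bold>\<cdot> d \<^bold>\<cdot> s \<^bold>\<sim> (c * d) \<^bold>\<cdot> s"
| ax_scale_one: "1 \<^bold>\<cdot> s \<^bold>\<sim> s"
| ax_scale_mult_left: "(c \<^bold>\<cdot> s) \<^bold>* t \<^bold>\<sim> c \<^bold>\<cdot> (s \<^bold>* t)"
| ax_scale_mult_right: "s \<^bold>* (c \<^bold>\<cdot> t) \<^bold>\<sim> c \<^bold>\<cdot> (s \<^bold>* t)"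
| ax_star_add: "Star (s \<^bold>+ t) \<^bold>\<sim> Star s \<^bold>+ Star t"
| ax_star_scale: "Star (c \<^bold>\<cdot> s) \<^bold>\<sim> cnj c \<^bold>\<cdot> Star s"
| ax_star_mult: "Star (s \<^bold>* t) \<^bold>\<sim> Star t \<^bold>* Star s"
| ax_star_star: "Star (Star s) \<^bold>\<sim> s"

| R_resolvent: "l \<noteq> 0 \<Longrightarrow> m \<noteq> 0 \<Longrightarrow>
    R l f \<^bold>- R m f \<^bold>\<sim> (\<i> * complex_of_real (m - l)) \<^bold>\<cdot> (R l f \<^bold>* R m f)"
| R_star: "l \<noteq> 0 \<Longrightarrow> Star (R l f) \<^bold>\<sim> R (- l) f"
| R_commutator: "l \<noteq> 0 \<Longrightarrow> m \<noteq> 0 \<Longrightarrow>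
    R l f \<^bold>* R m g \<^bold>- R m g \<^bold>* R l f \<^bold>\<sim>
    (\<i> * complex_of_real (sympl f g)) \<^bold>\<cdot> (R l f \<^bold>* (R m g \<^bold>* R m g) \<^bold>* R l f)"
| R_homogeneous: "l \<noteq> 0 \<Longrightarrow> n \<noteq> 0 \<Longrightarrow>
    complex_of_real n \<^bold>\<cdot> R (n * l) (n *\<^sub>R f) \<^bold>\<sim> R l f"
| R_product: "l \<noteq> 0 \<Longrightarrow> m \<noteq> 0 \<Longrightarrow> l + m \<noteq> 0 \<Longrightarrow>
    R l f \<^bold>* R m g \<^bold>\<sim>
    R (l + m) (f + g) \<^bold>* (R l f \<^bold>+ R m g \<^bold>+
      (\<i> * complex_of_real (sympl f g)) \<^bold>\<cdot> (R l f \<^bold>* R l f \<^bold>* R m g))"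
| R_unit: "l \<noteq> 0 \<Longrightarrow> R l 0 \<^bold>\<sim> (- \<i> / complex_of_real l) \<^bold>\<cdot> \<^bold>1"
| R_zero: "R 0 f \<^bold>\<sim> \<^bold>0"

quotient_type (overloaded) 'x resolvent_star_algebra = "'x::symplectic_space resolvent_term" / resolvent_cong
  by (intro equivpI reflpI sympI transpI) (blast intro: resolvent_cong.intros)+

primrec term_value :: "(real \<Rightarrow> 'x \<Rightarrow> 'b::complex_star_algebra) \<Rightarrow> 'x resolvent_term \<Rightarrow> 'b" where
  "term_value k (R l f) = (if l = 0 then 0 else k l f)"
| "term_value k \<^bold>0 = 0"
| "term_value k \<^bold>1 = 1"
| "term_value k (s \<^bold>+ t) = term_value k s + term_value k t"
| "term_value k (s \<^bold>* t) = term_value k s * term_value k t"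
| "term_value k (c \<^bold>\<cdot> s) = c *\<^sub>C term_value k s"
| "term_value k (Star s) = star (term_value k s)"

definition resolvent_relations :: "(real \<Rightarrow> 'x::symplectic_space \<Rightarrow> 'b::complex_star_algebra) \<Rightarrow> bool" where
  "resolvent_relations k \<longleftrightarrow> (\<forall>l m n f g. l \<noteq> 0 \<longrightarrow> m \<noteq> 0 \<longrightarrow> n \<noteq> 0 \<longrightarrow>
     k l f - k m f = (\<i> * complex_of_real (m - l)) *\<^sub>C (k l f * k m f) \<and>
     star (k l f) = k (- l) f \<and>
     k l f * k m g - k m g * k l f =
       (\<i> * complex_of_real (sympl f g)) *\<^sub>C (k l f * (k m g)\<^sup>2 * k l f) \<and>
     complex_of_real n *\<^sub>C k (n * l) (n *\<^sub>R f) = k l f \<and>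
     (l + m \<noteq> 0 \<longrightarrow> k l f * k m g =
       k (l + m) (f + g) *
         (k l f + k m g + (\<i> * complex_of_real (sympl f g)) *\<^sub>C ((k l f)\<^sup>2 * k m g))) \<and>
     k l 0 = (- \<i> / complex_of_real l) *\<^sub>C 1)"

lemma term_value_cong:
  assumes k: "resolvent_relations k"
  shows "s \<^bold>\<sim> t \<Longrightarrow> term_value k s = term_value k t"
proof (induction rule: resolvent_cong.induct)
  case (R_resolvent l m f)
  then show ?case using k[unfolded resolvent_relations_def, rule_format, of l m 1]
    by (simp add: scaleC_minus1)
next
  case (R_star l f)
  then show ?case using k[unfolded resolvent_relations_def, rule_format, of l 1 1] by simp
next
  case (R_commutator l m f g)
  then show ?case using k[unfolded resolvent_relations_def, rule_format, of l m 1]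
    by (simp add: scaleC_minus1 power2_eq_square)
next
  case (R_homogeneous l n f)
  then show ?case using k[unfolded resolvent_relations_def, rule_format, of l 1 n] by simp
next
  case (R_product l m f g)
  then show ?case using k[unfolded resolvent_relations_def, rule_format, of l m 1]
    by (simp add: power2_eq_square)
next
  case (R_unit l)
  then show ?case using k[unfolded resolvent_relations_def, rule_format, of l 1 1] by simp
qed (simp_all add: scaleC_minus1 algebra_simps scaleC_add_right scaleC_add_left scaleC_scaleC
       scaleC_one mult_scaleC_left mult_scaleC_right star_add star_mult star_star
       star_scaleC)

lemma resolvent_relations_trivial:
  "resolvent_relations (\<lambda>l (f::'x::symplectic_space).
     if f = 0 then - \<i> / complex_of_real l else 0 :: complex)"
proof -
  have s: "sympl 0 g = 0" "sympl g 0 = 0" for g :: 'x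
    using bilinear_lzero[OF sympl_bilinear] bilinear_rzero[OF sympl_bilinear] by auto
  have ne: "l + m \<noteq> 0 \<Longrightarrow> complex_of_real l + complex_of_real m \<noteq> 0" for l m
    by (metis of_real_add of_real_eq_0_iff)
  have e: "complex_of_real m / (complex_of_real l + complex_of_real m) +
      complex_of_real l * complex_of_real m /
        (complex_of_real l * complex_of_real m + complex_of_real m * complex_of_real m) = 1"
    if "l + m \<noteq> 0" "m \<noteq> 0" for l m
    using ne[OF that(1)] that(2) by (simp add: divide_simps flip: distrib_right)
  show ?thesis unfolding resolvent_relations_def
    by (auto simp: s e scaleC_complex_def star_complex_def field_simps power2_eq_square)
qed

instantiation resolvent_star_algebra :: (symplectic_space) complex_star_algebra
begin

lift_definition zero_resolvent_star_algebra :: "'a resolvent_star_algebra" is Zero .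
lift_definition one_resolvent_star_algebra :: "'a resolvent_star_algebra" is One .
lift_definition plus_resolvent_star_algebra ::
  "'a resolvent_star_algebra \<Rightarrow> 'a resolvent_star_algebra \<Rightarrow> 'a resolvent_star_algebra" is Add
  by (rule cong_add)
lift_definition minus_resolvent_star_algebra ::
  "'a resolvent_star_algebra \<Rightarrow> 'a resolvent_star_algebra \<Rightarrow> 'a resolvent_star_algebra" is Sub
  by (intro cong_add cong_scale)
lift_definition uminus_resolvent_star_algebra ::
  "'a resolvent_star_algebra \<Rightarrow> 'a resolvent_star_algebra" is "Scale (-1)"
  by (rule cong_scale)
lift_definition times_resolvent_star_algebra ::
  "'a resolvent_star_algebra \<Rightarrow> 'a resolvent_star_algebra \<Rightarrow> 'a resolvent_star_algebra" is Mult
  by (rule cong_mult)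
lift_definition scaleC_resolvent_star_algebra ::
  "complex \<Rightarrow> 'a resolvent_star_algebra \<Rightarrow> 'a resolvent_star_algebra" is Scale
  by (rule cong_scale)
lift_definition star_resolvent_star_algebra ::
  "'a resolvent_star_algebra \<Rightarrow> 'a resolvent_star_algebra" is Star
  by (rule cong_star)

instance
proof
  have "\<not> Zero \<^bold>\<sim> (One :: 'a resolvent_term)"
    using term_value_cong[OF resolvent_relations_trivial, of Zero One] by auto
  then show "(0::'a resolvent_star_algebra) \<noteq> 1" by transfer
  show "- a + a = 0" for a :: "'a resolvent_star_algebra"
    by transfer (rule cong_trans[OF ax_add_commute ax_add_minus])
  show "a - b = a + - b" for a b :: "'a resolvent_star_algebra"
    by transfer (rule cong_refl)
qed (transfer; rule ax_add_assoc ax_add_commute ax_add_zero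
       ax_mult_assoc ax_one_mult ax_mult_one ax_distrib_right
       ax_distrib_left ax_scale_add_right ax_scale_add_left ax_scale_scale ax_scale_one
       ax_scale_mult_left ax_scale_mult_right ax_star_add ax_star_scale
       ax_star_mult ax_star_star)+

end

lift_definition gen :: "real \<Rightarrow> 'x::symplectic_space \<Rightarrow> 'x resolvent_star_algebra" is R .

lemma resolvent_relations_gen: "resolvent_relations (gen :: real \<Rightarrow> 'x::symplectic_space \<Rightarrow> _)"
  unfolding resolvent_relations_def power2_eq_square
proof (intro allI impI conjI)
  fix l m n :: real and f g :: 'x
  assume l: "l \<noteq> 0" and m: "m \<noteq> 0" and n: "n \<noteq> 0"
  show "gen l f - gen m f = (\<i> * complex_of_real (m - l)) *\<^sub>C (gen l f * gen m f)"
    using l m by transfer (rule R_resolvent)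
  show "star (gen l f) = gen (- l) f"
    using l by transfer (rule R_star)
  show "gen l f * gen m g - gen m g * gen l f =
      (\<i> * complex_of_real (sympl f g)) *\<^sub>C (gen l f * (gen m g * gen m g) * gen l f)"
    using l m by transfer (rule R_commutator)
  show "complex_of_real n *\<^sub>C gen (n * l) (n *\<^sub>R f) = gen l f"
    using l n by transfer (rule R_homogeneous)
  show "gen l f * gen m g = gen (l + m) (f + g) *
      (gen l f + gen m g + (\<i> * complex_of_real (sympl f g)) *\<^sub>C (gen l f * gen l f * gen m g))"
    if "l + m \<noteq> 0"
    using l m that by transfer (rule R_product)
  show "gen l (0::'x) = (- \<i> / complex_of_real l) *\<^sub>C 1"
    using l by transfer (rule R_unit)
qed

lemma resolvent_star_algebra_induct [case_names gen zero one add mult scaleC star]: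
  fixes P :: "'x::symplectic_space resolvent_star_algebra \<Rightarrow> bool"
  assumes "\<And>l f. l \<noteq> 0 \<Longrightarrow> P (gen l f)" and "P 0" and "P 1"
    and "\<And>a b. P a \<Longrightarrow> P b \<Longrightarrow> P (a + b)" and "\<And>a b. P a \<Longrightarrow> P b \<Longrightarrow> P (a * b)"
    and "\<And>c a. P a \<Longrightarrow> P (c *\<^sub>C a)" and "\<And>a. P a \<Longrightarrow> P (star a)"
  shows "P a"
proof -
  have gen0: "gen 0 f = 0" for f :: 'x by transfer (rule R_zero)
  have "P (abs_resolvent_star_algebra s)" for s
  proof (induction s)
    case (R l f)
    then show ?case using assms(1,2) gen0 by (cases "l = 0") (simp_all flip: gen.abs_eq)
  qed (use assms in \<open>simp_all flip: zero_resolvent_star_algebra.abs_eq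
        one_resolvent_star_algebra.abs_eq plus_resolvent_star_algebra.abs_eq
        times_resolvent_star_algebra.abs_eq scaleC_resolvent_star_algebra.abs_eq
        star_resolvent_star_algebra.abs_eq\<close>)
  then show ?thesis by (induction a rule: resolvent_star_algebra.abs_induct)
qed

lemma resolvent_star_algebra_universal:
  fixes k :: "real \<Rightarrow> 'x::symplectic_space \<Rightarrow> 'b::complex_star_algebra"
  assumes "resolvent_relations k"
  shows "\<exists>!h. (\<forall>l f. l \<noteq> 0 \<longrightarrow> h (gen l f) = k l f) \<and> h 1 = 1 \<and>
    (\<forall>a b. h (a + b) = h a + h b) \<and> (\<forall>a b. h (a * b) = h a * h b) \<and>
    (\<forall>c a. h (c *\<^sub>C a) = c *\<^sub>C h a) \<and> (\<forall>a. h (star a) = star (h a))"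
    (is "\<exists>!h. ?hom h")
proof (rule ex_ex1I)
  define h where "h a = term_value k (rep_resolvent_star_algebra a)" for a
  have abs: "h (abs_resolvent_star_algebra s) = term_value k s" for s
    unfolding h_def
    by (intro term_value_cong assms)
      (rule cong_sym, metis Quotient_rep_abs Quotient_resolvent_star_algebra cong_refl
        cong_sym)
  have "?hom h"
  proof (intro conjI allI impI)
    show "h (gen l f) = k l f" if "l \<noteq> 0" for l f using that by (simp add: gen.abs_eq abs)
    show "h 1 = 1" by (simp add: one_resolvent_star_algebra.abs_eq abs)
    fix a b :: "'x resolvent_star_algebra" and c
    obtain s t where "a = abs_resolvent_star_algebra s" "b = abs_resolvent_star_algebra t"
      by (metis Quotient_abs_rep Quotient_resolvent_star_algebra)
    then show "h (a + b) = h a + h b" "h (a * b) = h a * h b" "h (c *\<^sub>C a) = c *\<^sub>C h a"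
        "h (star a) = star (h a)"
      by (simp_all add: abs plus_resolvent_star_algebra.abs_eq times_resolvent_star_algebra.abs_eq
          scaleC_resolvent_star_algebra.abs_eq star_resolvent_star_algebra.abs_eq)
  qed
  then show "\<exists>h. ?hom h" by blast
next
  fix h h' assume h: "?hom h" and h': "?hom h'"
  have z: "h 0 = 0" "h' 0 = 0" using h h' by (metis add_cancel_right_right)+
  show "h = h'"
  proof
    show "h a = h' a" for a
      by (induction a rule: resolvent_star_algebra_induct) (use h h' z in auto)
  qed
qed

no_notation
  Zero  (\<open>\<^bold>0\<close>) and
  One  (\<open>\<^bold>1\<close>) and
  Add  (infixl \<open>\<^bold>+\<close> 65) and
  Mult  (infixl \<open>\<^bold>*\<close> 70) and
  Scale  (infixr \<open>\<^bold>\<cdot>\<close> 75) and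
  Sub  (infixl \<open>\<^bold>-\<close> 65) and
  resolvent_cong  (infix \<open>\<^bold>\<sim>\<close> 50)

hide_const (open) R Zero One Add Mult Scale Star Sub


section \<open>The seminorm of the resolvent algebra\<close>

lemma gen_star: "l \<noteq> 0 \<Longrightarrow> star (gen l f) = gen (- l) f"
  by transfer (rule R_star)

lemma gen_resolvent:
  "l \<noteq> 0 \<Longrightarrow> m \<noteq> 0 \<Longrightarrow>
     gen l f - gen m f = (\<i> * complex_of_real (m - l)) *\<^sub>C (gen l f * gen m f)"
  by transfer (rule R_resolvent)

lemma gns_bound_gen:
  assumes l: "l \<noteq> 0"
  shows "gns_bound (gen l f) (1 / \<bar>l\<bar>)"
  unfolding gns_bound_def
proof (intro conjI allI impI)
  fix \<omega> :: "'a resolvent_star_algebra \<Rightarrow> complex" and b assume \<omega>: "state \<omega>"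
  define r where "r = gen l f"
  have star_r: "star r = gen (- l) f" using l by (simp add: r_def gen_star)
  have "star r - r = (2 * \<i> * complex_of_real l) *\<^sub>C (star r * r)"
    unfolding star_r unfolding r_def using gen_resolvent[of "- l" l f] l by (simp add: mult_ac)
  then have e: "star b * ((star r - r) * b) = (2 * \<i> * complex_of_real l) *\<^sub>C (star b * (star r * r * b))"
    by (simp add: mult_scaleC_left mult_scaleC_right)
  have "\<omega> (star b * ((star r - r) * b)) = \<omega> (star (r * b) * b + (-1) *\<^sub>C (star b * (r * b)))"
    by (simp add: algebra_simps star_mult scaleC_minus1)
  also have "\<dots> = \<omega> (star (r * b) * b) - \<omega> (star b * (r * b))"
    by (simp add: state_simps[OF \<omega>])
  finally have "cmod (\<omega> (star b * ((star r - r) * b))) \<le>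
      cmod (\<omega> (star (r * b) * b)) + cmod (\<omega> (star b * (r * b)))"
    by (simp add: norm_triangle_ineq4)
  also have "\<dots> \<le> gns_vec \<omega> (r * b) * gns_vec \<omega> b + gns_vec \<omega> b * gns_vec \<omega> (r * b)"
    by (intro add_mono gns_Cauchy_Schwarz \<omega>)
  finally have "2 * \<bar>l\<bar> * cmod (\<omega> (star b * (star r * r * b))) \<le> 2 * (gns_vec \<omega> (r * b) * gns_vec \<omega> b)"
    by (simp add: e state_simps[OF \<omega>] norm_mult mult_ac)
  moreover have "(gns_vec \<omega> (r * b))\<^sup>2 \<le> cmod (\<omega> (star b * (star r * r * b)))"
    by (simp add: gns_vec_power2 \<omega> star_mult mult.assoc complex_Re_le_cmod)
  then have "2 * \<bar>l\<bar> * (gns_vec \<omega> (r * b))\<^sup>2 \<le> 2 * \<bar>l\<bar> * cmod (\<omega> (star b * (star r * r * b)))"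
    by (rule mult_left_mono) simp
  ultimately have "\<bar>l\<bar> * gns_vec \<omega> (r * b) * gns_vec \<omega> (r * b) \<le> gns_vec \<omega> b * gns_vec \<omega> (r * b)"
    by (simp add: power2_eq_square mult_ac)
  then have "\<bar>l\<bar> * gns_vec \<omega> (r * b) \<le> gns_vec \<omega> b"
    by (rule mult_le_cancel_nonneg) (simp_all add: gns_vec_nonneg \<omega>)
  then show "gns_vec \<omega> (gen l f * b) \<le> 1 / \<bar>l\<bar> * gns_vec \<omega> b"
    using l by (simp add: r_def field_simps)
qed simp

lemma ex_gns_bound: "\<exists>C. gns_bound a C" for a :: "'x::symplectic_space resolvent_star_algebra"
proof (induction a rule: resolvent_star_algebra_induct)
  case zero
  show ?case using gns_bound_scaleC[OF gns_bound_one, of 0] by (auto simp: scaleC_zero_left)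
next
  case (gen l f)
  then show ?case using gns_bound_gen by blast
next
  case one
  show ?case using gns_bound_one by blast
next
  case (add a b)
  then show ?case using gns_bound_add by blast
next
  case (mult a b)
  then show ?case using gns_bound_mult by blast
next
  case (scaleC c a)
  then show ?case using gns_bound_scaleC by blast
next
  case (star a)
  then show ?case using gns_bound_star by blast
qed

lemma ex_state: "\<exists>\<omega> :: 'x::symplectic_space resolvent_star_algebra \<Rightarrow> complex. state \<omega>"
proof -
  obtain h :: "'x resolvent_star_algebra \<Rightarrow> complex" where h: "h 1 = 1"
    "\<And>a b. h (a + b) = h a + h b" "\<And>a b. h (a * b) = h a * h b"
    "\<And>c a. h (c *\<^sub>C a) = c *\<^sub>C h a" "\<And>a. h (star a) = star (h a)"
    using resolvent_star_algebra_universal[OF resolvent_relations_trivial[where 'x = 'x]] by blast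
  have "state h"
    by (simp add: state_on_def h scaleC_complex_def star_complex_def complex_nonneg_Reals_iff)
  then show ?thesis by (rule exI[of _ h])
qed

instantiation resolvent_star_algebra :: (symplectic_space) pre_cstar_algebra
begin

definition snorm_resolvent_star_algebra :: "'a resolvent_star_algebra \<Rightarrow> real" where
  "snorm_resolvent_star_algebra a = (SUP \<omega>\<in>{\<omega>. state \<omega>}. gns_norm \<omega> a)"

lemma gns_bound_iff: "gns_bound a C \<longleftrightarrow> snorm a \<le> C" for a :: "'a resolvent_star_algebra"
proof -
  obtain D where D: "gns_bound a D" using ex_gns_bound by blast
  obtain \<omega>0 :: "'a resolvent_star_algebra \<Rightarrow> complex" where \<omega>0: "state \<omega>0" using ex_state by blast
  have bdd: "bdd_above ((\<lambda>\<omega>. gns_norm \<omega> a) ` {\<omega>. state \<omega>})"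
    by (rule bdd_aboveI2[of _ _ D]) (auto intro: gns_norm_le(1)[OF D])
  have upper: "gns_norm \<omega> a \<le> snorm a" if "state \<omega>" for \<omega>
    unfolding snorm_resolvent_star_algebra_def using that by (intro cSUP_upper bdd) simp
  have one: "gns_vec \<omega>0 1 = 1" by (simp add: gns_vec_def star_one state_simps[OF \<omega>0])
  have "0 \<le> gns_norm \<omega>0 a"
    using gns_norm_le(2)[OF D \<omega>0, of 1] gns_vec_nonneg[OF \<omega>0, of a] one by simp
  then have nonneg: "0 \<le> snorm a" using upper[OF \<omega>0] by simp
  show ?thesis
  proof
    assume "gns_bound a C"
    then show "snorm a \<le> C" unfolding snorm_resolvent_star_algebra_def
      using \<omega>0 by (intro cSUP_least) (auto intro: gns_norm_le(1))
  next
    assume le: "snorm a \<le> C"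
    have "gns_vec \<omega> (a * b) \<le> C * gns_vec \<omega> b" if "state \<omega>" for \<omega> b
      using gns_norm_le(2)[OF D that, of b] upper[OF that] le gns_vec_nonneg[OF that, of b]
      by (meson mult_right_mono order_trans)
    then show "gns_bound a C" using nonneg le by (simp add: gns_bound_def)
  qed
qed

instance
proof
  fix a b :: "'a resolvent_star_algebra" and c :: complex
  have bound: "gns_bound a (snorm a)" for a :: "'a resolvent_star_algebra"
    by (simp add: gns_bound_iff)
  have nonneg: "0 \<le> snorm a" for a :: "'a resolvent_star_algebra"
    using bound[of a] by (simp add: gns_bound_def)
  show "snorm (a + b) \<le> snorm a + snorm b"
    using gns_bound_add[OF bound bound] by (simp add: gns_bound_iff)
  show mult: "snorm (a * b) \<le> snorm a * snorm b" for a b :: "'a resolvent_star_algebra"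
    using gns_bound_mult[OF bound bound] by (simp add: gns_bound_iff)
  have scale: "snorm (c *\<^sub>C a) \<le> cmod c * snorm a" for c and a :: "'a resolvent_star_algebra"
    using gns_bound_scaleC[OF bound] by (simp add: gns_bound_iff)
  show "snorm (c *\<^sub>C a) = cmod c * snorm a"
  proof (cases "c = 0")
    case True
    then show ?thesis using scale[of c a] nonneg[of "c *\<^sub>C a"] by simp
  next
    case False
    have "snorm a \<le> cmod (inverse c) * snorm (c *\<^sub>C a)"
      using scale[of "inverse c" "c *\<^sub>C a"] False by (simp add: scaleC_scaleC scaleC_one)
    then have "cmod c * snorm a \<le> snorm (c *\<^sub>C a)"
      using False by (simp add: norm_divide field_simps)
    then show ?thesis using scale[of c a] by simp
  qed
  have star: "snorm (star a) \<le> snorm a" for a :: "'a resolvent_star_algebra"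
    using gns_bound_star[OF bound] by (simp add: gns_bound_iff)
  then show star_eq: "snorm (star a) = snorm a" for a :: "'a resolvent_star_algebra"
    by (metis antisym star_star)
  show "snorm (star a * a) = (snorm a)\<^sup>2"
  proof (rule antisym)
    show "snorm (star a * a) \<le> (snorm a)\<^sup>2"
      using mult[of "star a" a] by (simp add: star_eq power2_eq_square)
    have "gns_bound a (sqrt (snorm (star a * a)))"
      by (rule gns_bound_star_mult_self) (simp_all add: bound nonneg)
    then have "snorm a \<le> sqrt (snorm (star a * a))" by (simp add: gns_bound_iff)
    then have "(snorm a)\<^sup>2 \<le> (sqrt (snorm (star a * a)))\<^sup>2"
      by (rule power_mono) (rule nonneg)
    then show "(snorm a)\<^sup>2 \<le> snorm (star a * a)" by (simp add: nonneg)
  qed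
  show "snorm (1 :: 'a resolvent_star_algebra) = 1"
  proof (rule antisym)
    show "snorm (1 :: 'a resolvent_star_algebra) \<le> 1" by (simp add: gns_bound_one flip: gns_bound_iff)
    obtain \<omega> :: "'a resolvent_star_algebra \<Rightarrow> complex" where \<omega>: "state \<omega>" using ex_state by blast
    have "gns_vec \<omega> 1 = 1" by (simp add: gns_vec_def star_one state_simps[OF \<omega>])
    then show "1 \<le> snorm (1 :: 'a resolvent_star_algebra)"
      using bound[of 1] \<omega> unfolding gns_bound_def by (metis mult_1_right)
  qed
qed

end

section \<open>The resolvent algebra\<close>

type_synonym 'x resolvent_algebra = "'x resolvent_star_algebra cstar_completion"

definition Res :: "real \<Rightarrow> 'x::symplectic_space \<Rightarrow> 'x resolvent_algebra" where
  "Res l f = to_completion (gen l f)"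

lemma resolvent_relations_Res: "resolvent_relations (Res :: real \<Rightarrow> 'x::symplectic_space \<Rightarrow> _)"
  unfolding resolvent_relations_def power2_eq_square
proof (intro allI impI conjI)
  fix l m n :: real and f g :: 'x
  assume l: "l \<noteq> 0" and m: "m \<noteq> 0" and n: "n \<noteq> 0"
  note rel = resolvent_relations_gen[unfolded resolvent_relations_def power2_eq_square,
      rule_format, OF l m n]
  show "Res l f - Res m f = (\<i> * complex_of_real (m - l)) *\<^sub>C (Res l f * Res m f)"
    using rel[of f] by (simp only: Res_def to_completion_hom(4,5,7)[symmetric])
  show "star (Res l f) = Res (- l) f"
    using rel[of f] by (simp only: Res_def to_completion_hom(6)[symmetric])
  show "Res l f * Res m g - Res m g * Res l f =
      (\<i> * complex_of_real (sympl f g)) *\<^sub>C (Res l f * (Res m g * Res m g) * Res l f)"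
    using rel[of f g] by (simp only: Res_def to_completion_hom(4,5,7)[symmetric])
  show "complex_of_real n *\<^sub>C Res (n * l) (n *\<^sub>R f) = Res l f"
    using rel[of f] by (simp only: Res_def to_completion_hom(5)[symmetric])
  show "Res l f * Res m g = Res (l + m) (f + g) *
      (Res l f + Res m g + (\<i> * complex_of_real (sympl f g)) *\<^sub>C (Res l f * Res l f * Res m g))"
    if "l + m \<noteq> 0"
    using rel[of f g] that by (simp only: simp_thms Res_def to_completion_hom(3-5)[symmetric])
  show "Res l (0::'x) = (- \<i> / complex_of_real l) *\<^sub>C 1"
    using rel[of "0::'x"] by (simp only: Res_def to_completion_hom(2,5)[symmetric])
qed

text \<open>
  For a subspace \<open>Z\<close> this contains \<open>1\<close>, a multiple of \<open>Res l 0\<close>, although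
  \<^const>\<open>cstar_subalgebra\<close> does not ask for it; so \<^const>\<open>state_on\<close> applies.
\<close>

definition resolvent_subalgebra :: "'x::symplectic_space set \<Rightarrow> 'x resolvent_algebra set" where
  "resolvent_subalgebra Z = cstar_subalgebra hull {Res l f | l f. l \<noteq> 0 \<and> f \<in> Z}"

definition character_ideal ::
    "'x::symplectic_space set \<Rightarrow> ('x resolvent_algebra \<Rightarrow> complex) \<Rightarrow> 'x resolvent_algebra set" where
  "character_ideal Z chi = closed_ideal hull
     ({Res l f - chi (Res l f) *\<^sub>C 1 | l f. l \<noteq> 0 \<and> f \<in> Z} \<union>
      {Res m g | m g. m \<noteq> 0 \<and> g \<notin> Z})"

end

theory Submission
  imports Defs
begin

text \<open>
  A closed ideal \<open>J\<close> whose quotient consists of the scalars only is maximal. The theorem says that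
  every maximal ideal of the resolvent algebra is of this kind.

  \<^emph>\<open>From a pure state to a maximal ideal.\<close> A pure state of the commutative algebra \<open>A(Z)\<close> is
  multiplicative on the resolvents (lemma \<open>pure_state_on_unitary\<close>, applied to Cayley transforms).
  Extended by \<open>0\<close> to the resolvents of elements outside \<open>Z\<close>, it satisfies all defining relations, so
  it is a character of the universal *-algebra. The character is bounded by the C*-seminorm, being
  a state; the closure of its kernel is a closed ideal that contains the generators of
  \<open>character_ideal Z chi\<close> and omits \<open>1\<close>. Conversely every resolvent is a scalar modulo this
  character ideal, hence so is every element.

  \<^emph>\<open>From a maximal ideal to a pure state.\<close> By the commutator relation, a product of \<open>Res l f\<close> with
  another resolvent on one side is a product with some element on the other side; so the closure of
  the right ideal generated by \<open>Res l f\<close> is two-sided. It follows that for maximal \<open>J\<close> a resolvent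
  either lies in \<open>J\<close> or is invertible modulo \<open>J\<close> (\<open>normal_invertible\<close>). If \<open>Res l f\<close> and \<open>Res m g\<close> are
  both invertible modulo \<open>J\<close>, their inverses satisfy a canonical commutation relation with constant
  \<open>\<i> * sympl f g\<close>; as elements of a normed algebra cannot do so unless the constant vanishes
  (Wielandt), the set \<open>Z\<close> of all \<open>f\<close> with \<open>Res 1 f \<notin> J\<close> is isotropic. The product relation makes it a
  subspace. Thus the quotient by \<open>J\<close> is commutative, \<open>Res l f - c *\<^sub>C 1\<close> is invertible in it unless it
  vanishes, and the Gelfand--Mazur theorem (\<open>ex_not_invertible\<close>) shows that the resolvents are scalars
  modulo \<open>J\<close>. The resulting character restricts to a pure state of \<open>A(Z)\<close>, and its character ideal,
  contained in \<open>J\<close> and maximal by the first part, equals \<open>J\<close>.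
\<close>

section \<open>Scalar multiplication and star\<close>

lemma scaleC_left_diff_distrib: "(c - d) *\<^sub>C a = c *\<^sub>C a - d *\<^sub>C (a::'a::complex_star_algebra)"
  using scaleC_add_left[of "c - d" d a] by (simp add: algebra_simps)

lemma scaleC_minus_left: "(- c) *\<^sub>C a = - (c *\<^sub>C (a::'a::complex_star_algebra))"
  using scaleC_left_diff_distrib[of 0 c a] by (simp add: scaleC_zero_left)

lemma scaleC_two: "2 *\<^sub>C a = a + (a::'a::complex_star_algebra)"
  using scaleC_add_left[of 1 1 a] by (simp add: scaleC_one)

lemmas scaleC_simps = scaleC_add_right scaleC_add_left scaleC_diff_right scaleC_left_diff_distrib
  scaleC_minus_right scaleC_minus_left scaleC_scaleC scaleC_one scaleC_zero_left scaleC_zero_right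
  mult_scaleC_left mult_scaleC_right

lemmas star_simps = star_add star_diff star_minus star_zero star_one star_scaleC star_mult star_star

lemma scaleC_sum_left: "(\<Sum>i\<in>A. f i) *\<^sub>C a = (\<Sum>i\<in>A. f i *\<^sub>C (a :: 'a::complex_star_algebra))"
  by (induction A rule: infinite_finite_induct) (simp_all add: scaleC_simps)

lemma scaleC_power: "(c *\<^sub>C a) ^ n = c ^ n *\<^sub>C (a ^ n :: 'a::complex_star_algebra)"
  by (induction n) (simp_all add: scaleC_simps mult.commute)

lemma tendsto_scaleC_left:
  assumes "c \<longlonglongrightarrow> d" shows "(\<lambda>n. c n *\<^sub>C (a::'a::cstar_algebra)) \<longlonglongrightarrow> d *\<^sub>C a"
proof -
  have "(\<lambda>n. norm (c n *\<^sub>C a - d *\<^sub>C a)) = (\<lambda>n. cmod (c n - d) * norm a)"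
    by (simp add: norm_scaleC flip: scaleC_left_diff_distrib)
  moreover have "(\<lambda>n. cmod (c n - d) * norm a) \<longlonglongrightarrow> 0"
    using assms by (intro tendsto_mult_left_zero) (simp add: LIM_zero_iff tendsto_norm_zero)
  ultimately show ?thesis using tendsto_norm_zero_iff LIM_zero_iff by metis
qed

lemma tendsto_scaleC:
  assumes "x \<longlonglongrightarrow> a" shows "(\<lambda>n. c *\<^sub>C (x n::'a::cstar_algebra)) \<longlonglongrightarrow> c *\<^sub>C a"
proof -
  have "(\<lambda>n. norm (c *\<^sub>C x n - c *\<^sub>C a)) = (\<lambda>n. cmod c * norm (x n - a))"
    by (simp add: norm_scaleC flip: scaleC_diff_right)
  moreover have "(\<lambda>n. cmod c * norm (x n - a)) \<longlonglongrightarrow> 0"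
    using assms by (intro tendsto_mult_right_zero) (simp add: LIM_zero_iff tendsto_norm_zero)
  ultimately show ?thesis using tendsto_norm_zero_iff LIM_zero_iff by metis
qed

lemma norm_star: "norm (star a) = norm (a::'a::cstar_algebra)"
proof -
  have le: "norm a \<le> norm (star a)" for a :: 'a
  proof (cases "a = 0")
    case False
    have "norm a * norm a = norm (star a * a)" by (simp add: norm_star_mult_self power2_eq_square)
    also have "\<dots> \<le> norm (star a) * norm a" by (rule norm_mult_ineq)
    finally show ?thesis using False by simp
  qed simp
  show ?thesis using le[of a] le[of "star a"] by (simp add: star_star)
qed

lemma tendsto_star:
  assumes "x \<longlonglongrightarrow> a" shows "(\<lambda>n. star (x n::'a::cstar_algebra)) \<longlonglongrightarrow> star a"
proof -
  have "(\<lambda>n. norm (star (x n) - star a)) = (\<lambda>n. norm (x n - a))"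
    by (simp add: norm_star flip: star_diff)
  then show ?thesis using assms tendsto_norm_zero_iff LIM_zero_iff by metis
qed

section \<open>Quotients by closed ideals\<close>

lemma closed_ideal_UNIV: "1 \<in> J \<Longrightarrow> closed_ideal J \<Longrightarrow> J = UNIV"
  unfolding closed_ideal_def by (metis UNIV_eq_I mult_1_right)

text \<open>
  Passing to the quotient by a closed ideal \<open>J\<close> is expressed inside the algebra: by congruence
  modulo \<open>J\<close>, and by the quotient seminorm, the distance to \<open>J\<close>.
\<close>

locale proper_ideal =
  fixes J :: "'a::cstar_algebra set"
  assumes ideal: "closed_ideal J" and proper: "J \<noteq> UNIV"
begin

text \<open>Congruence modulo \<open>J\<close>.\<close>

definition eqv :: "'a \<Rightarrow> 'a \<Rightarrow> bool"  (infix \<open>\<doteq>\<close> 50) where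
  "a \<doteq> b \<longleftrightarrow> a - b \<in> J"

text \<open>The norm of the class of \<open>a\<close> in the quotient by \<open>J\<close>.\<close>

definition qnorm :: "'a \<Rightarrow> real" where
  "qnorm a = infdist a J"

lemma ideal_mem:
  shows zero_mem: "0 \<in> J" and add_mem: "a \<in> J \<Longrightarrow> b \<in> J \<Longrightarrow> a + b \<in> J"
    and scaleC_mem: "a \<in> J \<Longrightarrow> c *\<^sub>C a \<in> J"
    and mult_mem_right: "a \<in> J \<Longrightarrow> a * x \<in> J" and mult_mem_left: "a \<in> J \<Longrightarrow> x * a \<in> J"
  using ideal by (auto simp: closed_ideal_def complex_subspace_def)

lemma minus_mem: "a \<in> J \<Longrightarrow> - a \<in> J"
  using scaleC_mem[of a "-1"] by (simp add: scaleC_simps)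

lemma diff_mem: "a \<in> J \<Longrightarrow> b \<in> J \<Longrightarrow> a - b \<in> J"
  using add_mem[OF _ minus_mem[of b]] by simp

lemma closed_mem: "closed J"
  using ideal by (simp add: closed_ideal_def)

lemma one_not_mem: "1 \<notin> J"
  using closed_ideal_UNIV ideal proper by blast

lemma eqv_refl: "a \<doteq> a" by (simp add: eqv_def zero_mem)
lemma eqv_sym: "a \<doteq> b \<Longrightarrow> b \<doteq> a" using minus_mem[of "a - b"] by (simp add: eqv_def)
lemma eqv_trans [trans]: "a \<doteq> b \<Longrightarrow> b \<doteq> c \<Longrightarrow> a \<doteq> c"
  using add_mem[of "a - b" "b - c"] by (simp add: eqv_def)
lemma eqv_add: "a \<doteq> a' \<Longrightarrow> b \<doteq> b' \<Longrightarrow> a + b \<doteq> a' + b'"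
  using add_mem[of "a - a'" "b - b'"] by (simp add: eqv_def algebra_simps)
lemma eqv_diff: "a \<doteq> a' \<Longrightarrow> b \<doteq> b' \<Longrightarrow> a - b \<doteq> a' - b'"
  using diff_mem[of "a - a'" "b - b'"] by (simp add: eqv_def algebra_simps)
lemma eqv_mult: "a \<doteq> a' \<Longrightarrow> b \<doteq> b' \<Longrightarrow> a * b \<doteq> a' * b'"
  using add_mem[OF mult_mem_right[of "a - a'" b] mult_mem_left[of "b - b'" a']]
  by (simp add: eqv_def algebra_simps)
lemma eqv_scaleC: "a \<doteq> a' \<Longrightarrow> c *\<^sub>C a \<doteq> c *\<^sub>C a'"
  using scaleC_mem[of "a - a'" c] by (simp add: eqv_def scaleC_simps)
lemma eqv_sum: "(\<And>i. i \<in> A \<Longrightarrow> f i \<doteq> g i) \<Longrightarrow> (\<Sum>i\<in>A. f i) \<doteq> (\<Sum>i\<in>A. g i)"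
  by (induction A rule: infinite_finite_induct) (simp_all add: eqv_refl eqv_add)
lemma eqv_zero_iff: "a \<doteq> 0 \<longleftrightarrow> a \<in> J" by (simp add: eqv_def)

lemma qnorm_nonneg: "0 \<le> qnorm a"
  by (simp add: qnorm_def infdist_nonneg)

lemma qnorm_le_norm: "qnorm a \<le> norm a"
  using infdist_le[OF zero_mem, of a] by (simp add: qnorm_def)

lemma qnorm_zero_iff: "qnorm a = 0 \<longleftrightarrow> a \<in> J"
  unfolding qnorm_def using in_closed_iff_infdist_zero[OF closed_mem, of a] zero_mem by blast

lemma qnorm_zero [simp]: "qnorm 0 = 0"
  by (simp add: qnorm_zero_iff zero_mem)

lemma qnorm_approx:
  assumes "0 < e" obtains b where "b \<doteq> a" "norm b < qnorm a + e"
proof -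
  have "\<exists>j\<in>J. dist a j < qnorm a + e"
    using cINF_less_iff[of J "dist a" "qnorm a + e"] assms zero_mem
    by (auto simp: qnorm_def infdist_def intro!: bdd_belowI2[of _ 0])
  then obtain j where "j \<in> J" "norm (a - j) < qnorm a + e" by (auto simp: dist_norm)
  then show thesis using that[of "a - j"] minus_mem[of j] by (simp add: eqv_def)
qed

lemma qnorm_le:
  assumes "b \<doteq> a" shows "qnorm a \<le> norm b"
  using infdist_le[of "a - b" J a] eqv_sym[OF assms] by (simp add: qnorm_def eqv_def dist_norm)

lemma qnorm_add: "qnorm (a + b) \<le> qnorm a + qnorm b"
proof (rule field_le_epsilon)
  fix e :: real assume "0 < e"
  then have "0 < e / 2" by simp
  obtain x where x: "x \<doteq> a" "norm x < qnorm a + e / 2" using qnorm_approx[OF \<open>0 < e / 2\<close>] .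
  obtain y where y: "y \<doteq> b" "norm y < qnorm b + e / 2" using qnorm_approx[OF \<open>0 < e / 2\<close>] .
  have "qnorm (a + b) \<le> norm (x + y)" by (rule qnorm_le[OF eqv_add[OF x(1) y(1)]])
  also have "\<dots> \<le> norm x + norm y" by (rule norm_triangle_ineq)
  finally show "qnorm (a + b) \<le> qnorm a + qnorm b + e" using x(2) y(2) by simp
qed

lemma qnorm_eqv:
  assumes "a \<doteq> b" shows "qnorm a = qnorm b"
proof -
  have le: "qnorm a \<le> qnorm b" if "a \<doteq> b" for a b
    using qnorm_add[of "a - b" b] that qnorm_zero_iff[of "a - b"] by (simp add: eqv_def)
  show ?thesis using le[OF assms] le[OF eqv_sym[OF assms]] by simp
qed

lemma qnorm_mult: "qnorm (a * b) \<le> qnorm a * qnorm b"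
proof -
  have "qnorm (a * b) \<le> (qnorm a + inverse (Suc n)) * (qnorm b + inverse (Suc n))" for n
  proof -
    have p: "0 < inverse (real (Suc n))" by simp
    obtain x where x: "x \<doteq> a" "norm x < qnorm a + inverse (Suc n)"
      using qnorm_approx[OF p] .
    obtain y where y: "y \<doteq> b" "norm y < qnorm b + inverse (Suc n)"
      using qnorm_approx[OF p] .
    have "qnorm (a * b) \<le> norm (x * y)" by (rule qnorm_le[OF eqv_mult[OF x(1) y(1)]])
    also have "\<dots> \<le> norm x * norm y" by (rule norm_mult_ineq)
    also have "\<dots> \<le> (qnorm a + inverse (Suc n)) * (qnorm b + inverse (Suc n))"
      using x(2) y(2) by (intro mult_mono) (auto intro: add_nonneg_nonneg qnorm_nonneg)
    finally show ?thesis .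
  qed
  moreover have "(\<lambda>n. (qnorm a + inverse (Suc n)) * (qnorm b + inverse (Suc n)))
      \<longlonglongrightarrow> (qnorm a + 0) * (qnorm b + 0)"
    by (intro tendsto_intros LIMSEQ_inverse_real_of_nat)
  ultimately have "qnorm (a * b) \<le> (qnorm a + 0) * (qnorm b + 0)"
    by (intro LIMSEQ_le_const[of _ "(qnorm a + 0) * (qnorm b + 0)"]) blast+
  then show ?thesis by simp
qed

lemma qnorm_scaleC_le: "qnorm (c *\<^sub>C a) \<le> cmod c * qnorm a"
proof (rule order_trans[OF _ mult_right_mono[OF _ qnorm_nonneg]])
  show "qnorm (c *\<^sub>C a) \<le> qnorm (c *\<^sub>C 1) * qnorm a"
    using qnorm_mult[of "c *\<^sub>C 1" a] by (simp add: mult_scaleC_left)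
  show "qnorm (c *\<^sub>C 1) \<le> cmod c" using qnorm_le_norm[of "c *\<^sub>C 1"] by (simp add: norm_scaleC)
qed

lemma qnorm_scaleC: "qnorm (c *\<^sub>C a) = cmod c * qnorm a"
proof (cases "c = 0")
  case False
  have "qnorm a \<le> cmod (inverse c) * qnorm (c *\<^sub>C a)"
    using qnorm_scaleC_le[of "inverse c" "c *\<^sub>C a"] False by (simp add: scaleC_simps)
  then show ?thesis
    using qnorm_scaleC_le[of c a] False by (simp add: norm_divide field_simps)
qed (simp add: scaleC_simps)

lemma qnorm_minus: "qnorm (- a) = qnorm a"
  using qnorm_scaleC[of "-1" a] by (simp add: scaleC_simps)

lemma qnorm_diff: "qnorm (a - b) \<le> qnorm a + qnorm b"
  using qnorm_add[of a "- b"] by (simp add: qnorm_minus)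

lemma qnorm_sum: "qnorm (\<Sum>i\<in>A. f i) \<le> (\<Sum>i\<in>A. qnorm (f i))"
proof (induction A rule: infinite_finite_induct)
  case (insert x A)
  then show ?case using qnorm_add[of "f x" "\<Sum>i\<in>A. f i"] by simp
qed simp_all

text \<open>An ideal whose distance to \<open>1\<close> is less than \<open>1\<close> contains elements \<open>1 - e ^ n\<close> that
  converge to \<open>1\<close>.\<close>

lemma qnorm_one: "qnorm 1 = 1"
proof (rule antisym)
  show "qnorm 1 \<le> 1" using qnorm_le_norm[of 1] by simp
  show "1 \<le> qnorm 1"
  proof (rule ccontr)
    assume "\<not> 1 \<le> qnorm 1"
    then obtain e where e: "e \<doteq> 1" "norm e < 1" using qnorm_approx[of "1 - qnorm 1" 1] by auto
    have "1 - e ^ n \<in> J" for n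
    proof (induction n)
      case (Suc n)
      have "(1 - e) + e * (1 - e ^ n) \<in> J"
        using Suc eqv_sym[OF e(1)] by (intro add_mem mult_mem_left) (simp_all add: eqv_def)
      then show ?case by (simp add: algebra_simps)
    qed (simp add: zero_mem)
    moreover have "(\<lambda>n. 1 - e ^ n) \<longlonglongrightarrow> 1 - 0"
      by (intro tendsto_diff tendsto_const LIMSEQ_power_zero e)
    ultimately have "1 \<in> J" using closed_sequentially[OF closed_mem] by force
    then show False using one_not_mem by simp
  qed
qed

end

lemma ex_inverse_one_minus:
  fixes e :: "'a::cstar_algebra" assumes "norm e < 1"
  shows "\<exists>u. (1 - e) * u = 1"
proof -
  have "summable (\<lambda>n. norm (e ^ n))"
    by (rule summable_comparison_test[of _ "\<lambda>n. norm e ^ n"])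
      (use assms in \<open>auto simp: norm_power_ineq intro: summable_geometric\<close>)
  then have s: "summable (\<lambda>n. e ^ n)" by (rule summable_norm_cancel)
  have "(\<Sum>n. e ^ n) = 1 + (\<Sum>n. e ^ Suc n)" using suminf_split_head[OF s] by simp
  also have "(\<Sum>n. e ^ Suc n) = e * (\<Sum>n. e ^ n)" by (simp add: suminf_mult[OF s])
  finally show ?thesis by (intro exI[of _ "\<Sum>n. e ^ n"]) (simp add: algebra_simps)
qed

section \<open>The Gelfand--Mazur theorem for quotients\<close>

lemma sum_root_of_unity_powers:
  fixes n j :: nat
  assumes "0 < j" "j < n"
  shows "(\<Sum>k<n. exp (2 * of_real pi * \<i> * of_nat k / of_nat n) ^ j) = (0::complex)"
proof -
  define w where "w = exp (2 * of_real pi * \<i> * of_nat j / of_nat n)"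
  have "exp (2 * of_real pi * \<i> * of_nat k / of_nat n) ^ j = w ^ k" for k
    unfolding w_def exp_of_nat_mult[symmetric] by (simp add: mult_ac)
  moreover have "w ^ n = 1" using assms by (simp add: w_def complex_root_unity)
  moreover have "w \<noteq> 1"
    using assms complex_root_unity_eq_1[of n j] by (auto simp: w_def dest: dvd_imp_le)
  ultimately show ?thesis using one_diff_power_eq[of w n] by simp
qed

lemma sum_powers_mult_one_minus:
  "(\<Sum>j<n. x ^ j) * (1 - x) = 1 - x ^ n" for x :: "'a::ring_1"
proof (induction n)
  case (Suc n)
  have "(\<Sum>j<Suc n. x ^ j) * (1 - x) = (1 - x ^ n) + x ^ n * (1 - x)"
    by (simp only: sum.lessThan_Suc distrib_right Suc.IH)
  then show ?case by (simp add: right_diff_distrib power_commutes)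
qed simp

context proper_ideal
begin

lemma qnorm_average:
  assumes "0 < n" "\<And>k. k < n \<Longrightarrow> qnorm (f k) \<le> K"
  shows "qnorm ((1 / of_nat n) *\<^sub>C (\<Sum>k<n. f k)) \<le> K"
proof -
  have "qnorm (\<Sum>k<n. f k) \<le> real n * K"
    using order_trans[OF qnorm_sum sum_mono[of "{..<n}" "\<lambda>k. qnorm (f k)" "\<lambda>_. K"]] assms(2)
    by simp
  then show ?thesis using assms(1) by (simp add: qnorm_scaleC norm_divide field_simps)
qed

text \<open>
  The average of the inverses of \<open>1 - z *\<^sub>C a\<close>, with \<open>z\<close> running through the \<open>n\<close>-th roots of unity
  multiplied by \<open>s\<close>, is a right inverse of \<open>1 - s ^ n *\<^sub>C a ^ n\<close> modulo \<open>J\<close>.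
\<close>

lemma average_inverses:
  assumes n: "0 < n" and G: "\<And>z. (1 - z *\<^sub>C a) * G z \<doteq> 1"
  shows "(1 - s ^ n *\<^sub>C a ^ n) *
    ((1 / of_nat n) *\<^sub>C (\<Sum>k<n. G (exp (2 * of_real pi * \<i> * of_nat k / of_nat n) * s))) \<doteq> 1"
proof -
  define w where "w k = exp (2 * of_real pi * \<i> * of_nat k / of_nat n)" for k
  have wn: "w k ^ n = 1" for k using n by (simp add: w_def complex_root_unity)
  have "(1 - s ^ n *\<^sub>C a ^ n) * G (w k * s) \<doteq> (\<Sum>j<n. (w k ^ j * s ^ j) *\<^sub>C a ^ j)" for k
  proof -
    let ?x = "(w k * s) *\<^sub>C a"
    have "(\<Sum>j<n. ?x ^ j) * (1 - ?x) = 1 - s ^ n *\<^sub>C a ^ n"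
      unfolding sum_powers_mult_one_minus by (simp add: scaleC_power power_mult_distrib wn)
    then have "(1 - s ^ n *\<^sub>C a ^ n) * G (w k * s) = (\<Sum>j<n. ?x ^ j) * ((1 - ?x) * G (w k * s))"
      by (metis mult.assoc)
    also have "\<dots> \<doteq> (\<Sum>j<n. ?x ^ j) * 1" by (intro eqv_mult eqv_refl G)
    finally show ?thesis by (simp add: scaleC_power power_mult_distrib)
  qed
  then have "(1 / of_nat n) *\<^sub>C (\<Sum>k<n. (1 - s ^ n *\<^sub>C a ^ n) * G (w k * s)) \<doteq>
      (1 / of_nat n) *\<^sub>C (\<Sum>k<n. \<Sum>j<n. (w k ^ j * s ^ j) *\<^sub>C a ^ j)"
    by (intro eqv_scaleC eqv_sum)
  also have "(\<Sum>k<n. \<Sum>j<n. (w k ^ j * s ^ j) *\<^sub>C a ^ j) =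
      (\<Sum>j<n. ((\<Sum>k<n. w k ^ j) * s ^ j) *\<^sub>C a ^ j)"
    by (subst sum.swap) (simp add: scaleC_sum_left sum_distrib_right)
  also have "\<dots> = (\<Sum>j<n. if j = 0 then of_nat n *\<^sub>C 1 else 0)"
    by (intro sum.cong refl) (auto simp: w_def sum_root_of_unity_powers scaleC_zero_left)
  also have "\<dots> = of_nat n *\<^sub>C 1" using n by (simp add: sum.delta)
  finally show ?thesis using n
    by (simp add: w_def scaleC_simps flip: sum_distrib_left)
qed

lemma eqv_inverse_diff:
  assumes "g * (1 - z *\<^sub>C a) \<doteq> 1" "(1 - w *\<^sub>C a) * h \<doteq> 1"
  shows "g - h \<doteq> (z - w) *\<^sub>C (g * a * h)"
proof -
  have "g * (1 - (1 - w *\<^sub>C a) * h) + (g * (1 - z *\<^sub>C a) - 1) * h \<in> J"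
    using assms eqv_sym[OF assms(2)] by (intro add_mem mult_mem_left mult_mem_right) (simp_all add: eqv_def)
  then show ?thesis by (simp add: eqv_def scaleC_simps algebra_simps)
qed

lemma inverse_bounded:
  fixes G :: "complex \<Rightarrow> 'a"
  assumes G: "\<And>z. (1 - z *\<^sub>C a) * G z \<doteq> 1" "\<And>z. G z * (1 - z *\<^sub>C a) \<doteq> 1"
  obtains M where "\<And>z. cmod z \<le> r \<Longrightarrow> qnorm (G z) \<le> M"
proof -
  have diff: "qnorm (G z - G w) \<le> cmod (z - w) * (qnorm (G z) * qnorm a * qnorm (G w))" for z w
  proof -
    have "qnorm (G z - G w) = cmod (z - w) * qnorm (G z * a * G w)"
      by (simp add: qnorm_eqv[OF eqv_inverse_diff[OF G(2) G(1)]] qnorm_scaleC)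
    also have "\<dots> \<le> cmod (z - w) * (qnorm (G z) * qnorm a * qnorm (G w))"
      by (intro mult_left_mono order_trans[OF qnorm_mult] mult_right_mono qnorm_mult qnorm_nonneg)
        simp
    finally show ?thesis .
  qed
  have "\<exists>M. \<forall>z. cmod z \<le> r \<longrightarrow> qnorm (G z) \<le> M"
  proof (rule ccontr)
    assume "\<nexists>M. \<forall>z. cmod z \<le> r \<longrightarrow> qnorm (G z) \<le> M"
    then have "\<exists>z. cmod z \<le> r \<and> real n < qnorm (G z)" for n by (meson not_le)
    then obtain z where z: "\<And>n. z n \<in> cball 0 r" "\<And>n. real n < qnorm (G (z n))"
      by (auto simp: dist_norm) metis
    obtain w q where wq: "strict_mono (q :: nat \<Rightarrow> nat)" "(z \<circ> q) \<longlonglongrightarrow> w"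
      using compact_cball[of "0::complex" r] z(1) unfolding compact_def by blast
    have "(\<lambda>n. cmod ((z \<circ> q) n - w) * (qnorm a * qnorm (G w))) \<longlonglongrightarrow> 0"
      by (intro tendsto_mult_left_zero tendsto_norm_zero LIM_zero wq(2))
    then have "\<forall>\<^sub>F n in sequentially. cmod ((z \<circ> q) n - w) * (qnorm a * qnorm (G w)) < 1 / 2"
      by (rule order_tendstoD) simp
    moreover have "\<forall>\<^sub>F n in sequentially. 2 * qnorm (G w) < real n" by real_asymp
    ultimately have "\<forall>\<^sub>F n in sequentially. False"
    proof eventually_elim
      case (elim n)
      let ?x = "z (q n)"
      have "qnorm (G ?x) \<le> qnorm (G ?x - G w) + qnorm (G w)"
        using qnorm_add[of "G ?x - G w" "G w"] by simp
      also have "qnorm (G ?x - G w) \<le> (cmod (?x - w) * (qnorm a * qnorm (G w))) * qnorm (G ?x)"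
        using diff[of ?x w] by (simp add: mult_ac)
      also have "\<dots> \<le> 1 / 2 * qnorm (G ?x)"
        using elim by (intro mult_right_mono qnorm_nonneg) auto
      finally have "qnorm (G ?x) \<le> 2 * qnorm (G w)" by simp
      moreover have "real n \<le> real (q n)" using wq(1) by (simp add: strict_mono_imp_increasing)
      ultimately show False using z(2)[of "q n"] elim by linarith
    qed
    then show False by simp
  qed
  then show thesis using that by blast
qed

text \<open>
  Rickart's proof, which replaces Liouville's theorem by averages over roots of unity. If all
  \<open>a - c *\<^sub>C 1\<close> were invertible modulo \<open>J\<close>, then the inverses \<open>G z\<close> of \<open>1 - z *\<^sub>C a\<close> would be locally bounded
  and small for large \<open>z\<close>. The averages \<open>H n s\<close> invert \<open>1 - s ^ n *\<^sub>C a ^ n\<close> and are Lipschitz in \<open>s\<close>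
  uniformly in \<open>n > 0\<close>. Hence the set of \<open>s\<close> for which \<open>s ^ n *\<^sub>C a ^ n\<close> tends to \<open>0\<close>, that is, for which
  \<open>H n s\<close> tends to \<open>1\<close>, can be enlarged by steps of fixed length, until it contains some \<open>s\<close> with
  \<open>qnorm (H n s) \<le> 1 / 2\<close> for all \<open>n > 0\<close>.
\<close>

theorem ex_not_invertible:
  "\<exists>c. \<not> (\<exists>b. (a - c *\<^sub>C 1) * b \<doteq> 1 \<and> b * (a - c *\<^sub>C 1) \<doteq> 1)"
proof (rule ccontr)
  assume "\<not> ?thesis"
  then have inv: "\<And>c. \<exists>b. (a - c *\<^sub>C 1) * b \<doteq> 1 \<and> b * (a - c *\<^sub>C 1) \<doteq> 1" by blast
  have "\<exists>g. (1 - z *\<^sub>C a) * g \<doteq> 1 \<and> g * (1 - z *\<^sub>C a) \<doteq> 1" for z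
  proof (cases "z = 0")
    case True
    then show ?thesis by (intro exI[of _ 1]) (simp add: scaleC_simps eqv_refl)
  next
    case False
    obtain b where b: "(a - (1 / z) *\<^sub>C 1) * b \<doteq> 1" "b * (a - (1 / z) *\<^sub>C 1) \<doteq> 1"
      using inv by blast
    have "(1 - z *\<^sub>C a) * ((- 1 / z) *\<^sub>C b) = (a - (1 / z) *\<^sub>C 1) * b"
      "((- 1 / z) *\<^sub>C b) * (1 - z *\<^sub>C a) = b * (a - (1 / z) *\<^sub>C 1)"
      using False by (simp_all add: scaleC_simps algebra_simps)
    then show ?thesis using b by metis
  qed
  then obtain G where G: "\<And>z. (1 - z *\<^sub>C a) * G z \<doteq> 1" "\<And>z. G z * (1 - z *\<^sub>C a) \<doteq> 1"
    by metis
  obtain b where b: "a * b \<doteq> 1" using inv[of 0] by (auto simp: scaleC_simps)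
  \<comment> \<open>\<open>b\<close> is a right inverse of \<open>a\<close> modulo \<open>J\<close>, and \<open>z *\<^sub>C G z\<close> is close to \<open>- b\<close> for large \<open>z\<close>.\<close>
  define S where "S = 3 * qnorm b + 1"
  have S: "0 < S" using qnorm_nonneg[of b] by (simp add: S_def)
  have far: "qnorm (G z) \<le> 1 / 2" if "cmod z = S" for z
  proof -
    have "z *\<^sub>C G z - (G z * b - b) = (G z * (1 - z *\<^sub>C a) - 1) * (- b) + (z *\<^sub>C G z) * (1 - a * b)"
      by (simp add: scaleC_simps algebra_simps)
    moreover have "\<dots> \<in> J"
      using G(2)[of z] eqv_sym[OF b]
      by (intro add_mem mult_mem_left mult_mem_right) (simp_all add: eqv_def)
    ultimately have "z *\<^sub>C G z \<doteq> G z * b - b" by (simp add: eqv_def)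
    then have "S * qnorm (G z) = qnorm (G z * b - b)" using that by (metis qnorm_eqv qnorm_scaleC)
    also have "\<dots> \<le> qnorm (G z) * qnorm b + qnorm b"
      using qnorm_diff[of "G z * b" b] qnorm_mult[of "G z" b] by simp
    finally have "(2 * qnorm b + 1) * qnorm (G z) \<le> qnorm b" by (simp add: S_def algebra_simps)
    also have "\<dots> \<le> (2 * qnorm b + 1) * (1 / 2)" by simp
    finally show ?thesis
      by (rule mult_left_le_imp_le) (use qnorm_nonneg[of b] in simp)
  qed
  obtain M where M: "\<And>z. cmod z \<le> 3 * S \<Longrightarrow> qnorm (G z) \<le> M"
    using inverse_bounded[OF G, of "3 * S"] by blast
  have M0: "0 \<le> M" using M[of 0] S qnorm_nonneg[of "G 0"] by simp
  define H where "H n s =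
    (1 / of_nat n) *\<^sub>C (\<Sum>k<n. G (exp (2 * of_real pi * \<i> * of_nat k / of_nat n) * of_real s))"
    for n and s :: real
  have absw: "cmod (exp (2 * of_real pi * \<i> * of_nat k / of_nat n) * of_real s) = \<bar>s\<bar>"
    for k n :: nat and s :: real
    by (simp add: norm_mult)
  have H: "(1 - of_real (s ^ n) *\<^sub>C a ^ n) * H n s \<doteq> 1" if "0 < n" for n s
    using average_inverses[where s = "of_real s", OF that G(1)] by (simp add: H_def)
  have HM: "qnorm (H n s) \<le> M" if "0 < n" "0 \<le> s" "s \<le> 3 * S" for n s
    unfolding H_def using that by (intro qnorm_average M) (simp_all add: absw)
  have Hfar: "qnorm (H n S) \<le> 1 / 2" if "0 < n" for n
    unfolding H_def using that S by (intro qnorm_average far) (simp_all add: absw)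
  have Hdiff: "qnorm (H n s - H n t) \<le> \<bar>s - t\<bar> * (M * qnorm a * M)"
    if "0 < n" "0 \<le> s" "s \<le> 3 * S" "0 \<le> t" "t \<le> 3 * S" for n s t
  proof -
    let ?w = "\<lambda>k. exp (2 * of_real pi * \<i> * of_nat k / of_nat n)"
    have "qnorm (G (?w k * of_real s) - G (?w k * of_real t)) \<le> \<bar>s - t\<bar> * (M * qnorm a * M)" for k
    proof -
      have "qnorm (G (?w k * of_real s) - G (?w k * of_real t)) =
          cmod (?w k * of_real (s - t)) *
            qnorm (G (?w k * of_real s) * a * G (?w k * of_real t))"
        by (simp only: qnorm_eqv[OF eqv_inverse_diff[OF G(2) G(1)]] qnorm_scaleC
            of_real_diff right_diff_distrib)
      also have "\<dots> \<le> \<bar>s - t\<bar> * (M * qnorm a * M)"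
        unfolding absw using that M0
        by (intro mult_left_mono order_trans[OF qnorm_mult] mult_mono M qnorm_nonneg
            mult_nonneg_nonneg order_refl) (simp_all add: absw)
      finally show ?thesis .
    qed
    moreover have "H n s - H n t =
        (1 / of_nat n) *\<^sub>C (\<Sum>k<n. G (?w k * of_real s) - G (?w k * of_real t))"
      by (simp add: H_def sum_subtractf scaleC_diff_right)
    ultimately show ?thesis using qnorm_average[OF that(1)] by simp
  qed
  have Hlim: "(\<lambda>n. qnorm (H n s - 1)) \<longlonglongrightarrow> 0"
    if s: "0 \<le> s" "s \<le> 3 * S" and lim: "(\<lambda>n. s ^ n * qnorm (a ^ n)) \<longlonglongrightarrow> 0" for s
  proof (rule Lim_null_comparison)
    show "(\<lambda>n. s ^ n * qnorm (a ^ n) * M) \<longlonglongrightarrow> 0"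
      using lim by (rule tendsto_mult_left_zero)
    show "\<forall>\<^sub>F n in sequentially. norm (qnorm (H n s - 1)) \<le> s ^ n * qnorm (a ^ n) * M"
      using eventually_gt_at_top[of "0::nat"]
    proof eventually_elim
      case (elim n)
      have "H n s - 1 \<doteq> of_real (s ^ n) *\<^sub>C a ^ n * H n s"
        using H[OF elim, of s] by (simp add: eqv_def scaleC_simps algebra_simps)
      then have "qnorm (H n s - 1) = qnorm (of_real (s ^ n) *\<^sub>C a ^ n * H n s)" by (rule qnorm_eqv)
      also have "\<dots> \<le> qnorm (of_real (s ^ n) *\<^sub>C a ^ n) * M"
        by (intro order_trans[OF qnorm_mult] mult_left_mono HM elim s qnorm_nonneg)
      finally show ?case using s by (simp add: qnorm_scaleC qnorm_nonneg norm_power)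
    qed
  qed
  \<comment> \<open>The step is \<open>S / m\<close>; over two steps \<open>H n\<close> varies by less than \<open>1 / 4\<close>,
    for every \<open>n > 0\<close>.\<close>
  obtain m where m: "0 < m" and mS: "2 * S / real m * (M * qnorm a * M) < 1 / 4" "2 * S / real m \<le> S"
  proof -
    have "\<forall>\<^sub>F m in sequentially. 0 < m \<and> 2 * S / real m * (M * qnorm a * M) < 1 / 4 \<and> 2 * S / real m \<le> S"
    proof (intro eventually_conj)
      show "\<forall>\<^sub>F m in sequentially. 0 < m" by (rule eventually_gt_at_top)
      show "\<forall>\<^sub>F m in sequentially. 2 * S / real m * (M * qnorm a * M) < 1 / 4"
      proof (rule order_tendstoD)
        show "(\<lambda>m. 2 * S / real m * (M * qnorm a * M)) \<longlonglongrightarrow> 0"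
          by (intro tendsto_mult_left_zero lim_const_over_n)
      qed simp
      show "\<forall>\<^sub>F m in sequentially. 2 * S / real m \<le> S"
        using eventually_ge_at_top[of "2::nat"] by eventually_elim (use S in \<open>simp add: field_simps\<close>)
    qed
    then show thesis using that eventually_happens'[OF sequentially_bot] by blast
  qed
  have "(\<lambda>n. (real k * (S / real m)) ^ n * qnorm (a ^ n)) \<longlonglongrightarrow> 0" if "k \<le> m" for k
    using that
  proof (induction k)
    case 0
    have "\<forall>\<^sub>F n in sequentially. (0::real) ^ n * qnorm (a ^ n) = 0"
      using eventually_gt_at_top[of "0::nat"] by eventually_elim (simp add: power_0_left)
    then show ?case unfolding of_nat_0 mult_zero_left by (rule tendsto_eventually)
  next
    case (Suc k)
    \<comment> \<open>Two steps ahead of \<open>s\<close>, at \<open>u\<close>, the sequence is still bounded by \<open>1\<close>; so it tends to \<open>0\<close>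
      at \<open>t < u\<close>.\<close>
    define s t u where "s = real k * (S / real m)" and "t = real (Suc k) * (S / real m)"
      and "u = real (Suc (Suc k)) * (S / real m)"
    have su: "u - s = 2 * S / real m" using m by (simp add: s_def u_def field_simps)
    have "s \<le> 1 * S" unfolding s_def using Suc.prems S m by (simp add: field_simps)
    then have s: "0 \<le> s" "s \<le> 3 * S" and u: "u \<le> 3 * S"
      using S su mS(2) by (simp_all add: s_def)
    have "0 < t" unfolding t_def using S m by (intro mult_pos_pos divide_pos_pos) simp_all
    moreover have "t < u" using S m by (simp add: t_def u_def field_simps)
    ultimately have t: "0 < t" "t < u" .
    have "(\<lambda>n. qnorm (H n s - 1)) \<longlonglongrightarrow> 0" using Suc s by (intro Hlim) (simp_all add: s_def)
    then have "\<forall>\<^sub>F n in sequentially. qnorm (H n s - 1) < 1 / 4" by (rule order_tendstoD) simp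
    then have bounded: "\<forall>\<^sub>F n in sequentially. u ^ n * qnorm (a ^ n) \<le> 1"
      using eventually_gt_at_top[of "0::nat"]
    proof eventually_elim
      case (elim n)
      have "qnorm (H n u - 1) \<le> qnorm (H n u - H n s) + qnorm (H n s - 1)"
        using qnorm_add[of "H n u - H n s" "H n s - 1"] by simp
      moreover have "qnorm (H n u - H n s) \<le> 1 / 4"
        using Hdiff[of n u s] elim s u t su mS(1) S by simp
      ultimately have d: "qnorm (1 - H n u) \<le> 1 / 2" using elim qnorm_minus[of "H n u - 1"] by simp
      define p where "p = of_real (u ^ n) *\<^sub>C a ^ n"
      have "p - ((H n u - 1) + p * (1 - H n u)) = - (H n u - 1 - p * H n u)"
        by (simp add: algebra_simps)
      moreover have "H n u - 1 - p * H n u \<in> J"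
        using H[of n u] elim by (simp add: p_def eqv_def algebra_simps)
      ultimately have "p \<doteq> (H n u - 1) + p * (1 - H n u)" unfolding eqv_def by (metis minus_mem)
      then have "qnorm p = qnorm ((H n u - 1) + p * (1 - H n u))" by (rule qnorm_eqv)
      also have "\<dots> \<le> qnorm (H n u - 1) + qnorm p * qnorm (1 - H n u)"
        by (rule order_trans[OF qnorm_add add_left_mono[OF qnorm_mult]])
      also have "\<dots> \<le> 1 / 2 + qnorm p * (1 / 2)"
        using d qnorm_minus[of "H n u - 1"] by (intro add_mono mult_left_mono qnorm_nonneg) simp_all
      finally show ?case using t by (simp add: p_def qnorm_scaleC norm_power)
    qed
    have "(\<lambda>n. (t / u) ^ n) \<longlonglongrightarrow> 0" using t by (intro LIMSEQ_power_zero) simp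
    moreover have "\<forall>\<^sub>F n in sequentially. norm (t ^ n * qnorm (a ^ n)) \<le> (t / u) ^ n"
      using bounded
    proof eventually_elim
      case (elim n)
      have "t ^ n * qnorm (a ^ n) = (t / u) ^ n * (u ^ n * qnorm (a ^ n))"
        using t by (simp add: power_divide)
      also have "\<dots> \<le> (t / u) ^ n" using elim t by (intro mult_left_le) simp_all
      finally show ?case using t by (simp add: qnorm_nonneg)
    qed
    ultimately show ?case unfolding t_def[symmetric] by (rule Lim_null_comparison[rotated])
  qed
  from this[of m] m S have "(\<lambda>n. qnorm (H n S - 1)) \<longlonglongrightarrow> 0" by (intro Hlim) simp_all
  then have "\<forall>\<^sub>F n in sequentially. qnorm (H n S - 1) < 1 / 2" by (rule order_tendstoD) simp
  then have "\<forall>\<^sub>F n in sequentially. False"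
    using eventually_gt_at_top[of "0::nat"]
  proof eventually_elim
    case (elim n)
    then show ?case
      using qnorm_diff[of "H n S" "H n S - 1"] Hfar[of n] by (simp add: qnorm_one)
  qed
  then show False by simp
qed

end

section \<open>States on *-subalgebras\<close>

lemma cstar_subalgebraD:
  assumes "cstar_subalgebra B"
  shows "0 \<in> B" "a \<in> B \<Longrightarrow> b \<in> B \<Longrightarrow> a + b \<in> B" "a \<in> B \<Longrightarrow> c *\<^sub>C a \<in> B"
    "a \<in> B \<Longrightarrow> b \<in> B \<Longrightarrow> a * b \<in> B" "a \<in> B \<Longrightarrow> star a \<in> B"
    "a \<in> B \<Longrightarrow> - a \<in> B" "a \<in> B \<Longrightarrow> b \<in> B \<Longrightarrow> a - b \<in> B"
proof -
  show "0 \<in> B" "a \<in> B \<Longrightarrow> star a \<in> B" "a \<in> B \<Longrightarrow> b \<in> B \<Longrightarrow> a * b \<in> B"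
    and add: "\<And>a b. a \<in> B \<Longrightarrow> b \<in> B \<Longrightarrow> a + b \<in> B"
    and scale: "\<And>c a. a \<in> B \<Longrightarrow> c *\<^sub>C a \<in> B"
    using assms by (auto simp: cstar_subalgebra_def complex_subspace_def)
  show minus: "- a \<in> B" if "a \<in> B" for a using scale[OF that, of "-1"] by (simp add: scaleC_simps)
  show "a \<in> B \<Longrightarrow> b \<in> B \<Longrightarrow> a - b \<in> B" using add[of a "- b"] minus[of b] by simp
qed

lemma state_onD:
  assumes "state_on B \<omega>" "cstar_subalgebra B" "1 \<in> B"
  shows "a \<in> B \<Longrightarrow> b \<in> B \<Longrightarrow> \<omega> (a + b) = \<omega> a + \<omega> b"
    "a \<in> B \<Longrightarrow> \<omega> (c *\<^sub>C a) = c * \<omega> a" "\<omega> 1 = 1"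
    "a \<in> B \<Longrightarrow> \<omega> (star a * a) \<in> \<real>\<^sub>\<ge>\<^sub>0"
    "a \<in> B \<Longrightarrow> b \<in> B \<Longrightarrow> \<omega> (a - b) = \<omega> a - \<omega> b"
    "a \<in> B \<Longrightarrow> \<omega> (star a) = cnj (\<omega> a)"
proof -
  note B = cstar_subalgebraD[OF assms(2)]
  show add: "\<And>a b. a \<in> B \<Longrightarrow> b \<in> B \<Longrightarrow> \<omega> (a + b) = \<omega> a + \<omega> b"
    and scale: "\<And>c a. a \<in> B \<Longrightarrow> \<omega> (c *\<^sub>C a) = c * \<omega> a" and one: "\<omega> 1 = 1"
    and pos: "\<And>a. a \<in> B \<Longrightarrow> \<omega> (star a * a) \<in> \<real>\<^sub>\<ge>\<^sub>0"
    using assms(1) by (auto simp: state_on_def)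
  show "a \<in> B \<Longrightarrow> b \<in> B \<Longrightarrow> \<omega> (a - b) = \<omega> a - \<omega> b"
    using add[of a "(-1) *\<^sub>C b"] scale[of b "-1"] B(3)[of b "-1"] by (simp add: scaleC_simps)
  show "\<omega> (star a) = cnj (\<omega> a)" if a: "a \<in> B"
  proof -
    have "\<omega> (star (a + c *\<^sub>C 1) * (a + c *\<^sub>C 1)) =
        \<omega> (star a * a) + (c * \<omega> (star a) + cnj c * \<omega> a + cnj c * c)" for c
    proof -
      have "star (a + c *\<^sub>C 1) * (a + c *\<^sub>C 1) =
          star a * a + (c *\<^sub>C star a + (cnj c *\<^sub>C a + (cnj c * c) *\<^sub>C 1))"
        by (simp add: star_simps scaleC_simps algebra_simps)
      then show ?thesis using a assms(3) B by (simp add: add scale one)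
    qed
    then have "Im (c * \<omega> (star a) + cnj c * \<omega> a + cnj c * c) = 0" for c
      using pos[of "a + c *\<^sub>C 1"] pos[of a] a assms(3) B(2,3)
      by (auto simp: complex_nonneg_Reals_iff simp del: times_complex.sel)
    from this[of 1] this[of \<i>] show ?thesis by (simp add: complex_eq_iff)
  qed
qed

lemma state_on_null:
  assumes "state_on B \<omega>" "cstar_subalgebra B" "1 \<in> B" "a \<in> B" "\<omega> (star a * a) = 0"
  shows "\<omega> a = 0"
proof -
  note B = cstar_subalgebraD[OF assms(2)] and \<omega> = state_onD[OF assms(1-3)]
  define c where "c = - \<omega> a"
  have "star (a + c *\<^sub>C 1) * (a + c *\<^sub>C 1) =
      star a * a + (c *\<^sub>C star a + (cnj c *\<^sub>C a + (cnj c * c) *\<^sub>C 1))"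
    by (simp add: star_simps scaleC_simps algebra_simps)
  then have "\<omega> (star (a + c *\<^sub>C 1) * (a + c *\<^sub>C 1)) = - (cnj c * c)"
    using assms B by (simp add: \<omega> c_def)
  then have "- (cnj c * c) \<in> \<real>\<^sub>\<ge>\<^sub>0" using \<omega>(4)[of "a + c *\<^sub>C 1"] assms(3,4) B by simp
  moreover have "cnj c * c = complex_of_real ((cmod c)\<^sup>2)"
    by (metis complex_norm_square mult.commute)
  ultimately have "(cmod c)\<^sup>2 \<le> 0" by (simp add: complex_nonneg_Reals_iff)
  then show ?thesis by (simp add: c_def)
qed

text \<open>
  If \<open>V\<close> is a unitary central in \<open>B\<close>, then \<open>2 + r *\<^sub>C (V + star V) = star (1 + r *\<^sub>C V) * (1 + r *\<^sub>C V)\<close>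
  for \<open>r = 1\<close> and \<open>r = -1\<close>. Hence the functionals that send \<open>b\<close> to
  \<open>chi ((4 + r *\<^sub>C (V + star V)) * b)\<close> are positive, and a multiple of \<open>chi\<close> is their sum. Purity
  makes both proportional to \<open>chi\<close>. The constant \<open>4\<close>, instead of \<open>2\<close>, keeps them from vanishing.
\<close>

lemma pure_state_on_unitary:
  assumes pure: "pure_state_on B chi" and B: "cstar_subalgebra B" "1 \<in> B"
    and V: "V \<in> B" "star V * V = 1"
    and comm: "\<And>b. b \<in> B \<Longrightarrow> V * b = b * V" "\<And>b. b \<in> B \<Longrightarrow> star V * b = b * star V"
    and b: "b \<in> B"
  shows "chi ((V + star V) * b) = chi (V + star V) * chi b"
proof -
  note B' = cstar_subalgebraD[OF B(1)]
  have state: "state_on B chi" using pure by (simp add: pure_state_on_def)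
  note chi = state_onD[OF state B]
  define T where "T = V + star V"
  have T: "T \<in> B" using V(1) B' by (simp add: T_def)
  have Tcomm: "T * b = b * T" if "b \<in> B" for b
    using comm that by (simp add: T_def algebra_simps)
  have pos2: "2 * chi (star b * b) + r * chi (T * (star b * b)) \<in> \<real>\<^sub>\<ge>\<^sub>0"
    if b: "b \<in> B" and r: "r = 1 \<or> r = -1" for b r
  proof -
    have "star (b + r *\<^sub>C (V * b)) * (b + r *\<^sub>C (V * b)) =
        star b * b + (cnj r * r) *\<^sub>C (star b * (star V * V) * b) +
        (r *\<^sub>C (star b * V * b) + cnj r *\<^sub>C (star b * star V * b))"
      by (simp add: star_simps scaleC_simps algebra_simps)
    also have "\<dots> = 2 *\<^sub>C (star b * b) + r *\<^sub>C (T * (star b * b))"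
      using r comm(1)[OF B'(5)[OF b]] comm(2)[OF B'(5)[OF b]]
      by (auto simp: V(2) T_def scaleC_simps scaleC_two algebra_simps simp flip: mult.assoc)
    finally have "2 * chi (star b * b) + r * chi (T * (star b * b)) =
        chi (star (b + r *\<^sub>C (V * b)) * (b + r *\<^sub>C (V * b)))"
      using b T B' by (simp add: chi)
    also have "\<dots> \<in> \<real>\<^sub>\<ge>\<^sub>0" using b V B' by (intro chi) auto
    finally show ?thesis .
  qed
  define p where "p = Re (chi T)"
  have p: "chi T = of_real p" "- 2 \<le> p" "p \<le> 2"
    using pos2[of 1 1] pos2[of 1 "-1"] B(2)
    by (auto simp: p_def complex_eq_iff complex_nonneg_Reals_iff star_one chi)
  define P where "P r b = 4 * chi b + r * chi (T * b)" for r b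
  have pos: "P r (star b * b) \<in> \<real>\<^sub>\<ge>\<^sub>0" if b: "b \<in> B" and r: "r = 1 \<or> r = -1" for b r
  proof -
    have "2 * chi (star b * b) + (2 * chi (star b * b) + r * chi (T * (star b * b))) \<in> \<real>\<^sub>\<ge>\<^sub>0"
      using b r by (intro nonneg_Reals_add_I nonneg_Reals_mult_I chi pos2) auto
    then show ?thesis by (simp add: P_def)
  qed
  have st: "state_on B (\<lambda>b. P (of_real r) b / of_real (4 + r * p))" if r: "r = 1 \<or> r = -1" for r :: real
    unfolding state_on_def
  proof (intro conjI ballI allI)
    have r4: "0 < 4 + r * p" using p(2,3) r by auto
    fix x y c assume x: "x \<in> B"
    show "P (of_real r) (x + y) / of_real (4 + r * p) =
        P (of_real r) x / of_real (4 + r * p) + P (of_real r) y / of_real (4 + r * p)" if "y \<in> B"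
      using x that T B' by (simp add: P_def chi algebra_simps add_divide_distrib)
    show "P (of_real r) (c *\<^sub>C x) / of_real (4 + r * p) = c * (P (of_real r) x / of_real (4 + r * p))"
      using x T B' by (simp add: P_def chi mult_scaleC_right algebra_simps add_divide_distrib)
    show "P (of_real r) (star x * x) / of_real (4 + r * p) \<in> \<real>\<^sub>\<ge>\<^sub>0"
    proof (intro nonneg_Reals_divide_I pos x)
      show "complex_of_real (4 + r * p) \<in> \<real>\<^sub>\<ge>\<^sub>0"
        using r4 unfolding nonneg_Reals_of_real_iff by simp
    qed (use r in auto)
  next
    have "0 < 4 + r * p" using p(2,3) r by auto
    then have "complex_of_real (4 + r * p) \<noteq> 0" unfolding of_real_eq_0_iff by simp
    moreover have "P (of_real r) 1 = of_real (4 + r * p)" by (simp add: P_def chi p(1))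
    ultimately show "P (of_real r) 1 / of_real (4 + r * p) = 1" by simp
  qed
  define t where "t = (4 + p) / 8"
  have t: "0 < t" "t < 1" using p by (simp_all add: t_def)
  have n: "complex_of_real (4 + 1 * p) \<noteq> 0" "complex_of_real (4 + (- 1) * p) \<noteq> 0"
    unfolding of_real_eq_0_iff using p(2,3) by auto
  have tn: "of_real t = complex_of_real (4 + 1 * p) / 8"
    "of_real (1 - t) = complex_of_real (4 + (- 1) * p) / 8"
    by (simp_all add: t_def field_simps)
  have conv: "chi b = of_real t * (P 1 b / of_real (4 + 1 * p)) +
      of_real (1 - t) * (P (- 1) b / of_real (4 + (- 1) * p))" for b
  proof -
    have cancel: "x \<noteq> 0 \<Longrightarrow> x / 8 * (y / x) = y / 8" for x y :: complex by simp
    have e: "of_real t * (P 1 b / of_real (4 + 1 * p)) = P 1 b / 8"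
      "of_real (1 - t) * (P (- 1) b / of_real (4 + (- 1) * p)) = P (- 1) b / 8"
      unfolding tn by (rule cancel[OF n(1)], rule cancel[OF n(2)])
    show ?thesis unfolding e by (simp add: P_def field_simps)
  qed
  have "state_on B (\<lambda>b. P 1 b / of_real (4 + 1 * p))"
    "state_on B (\<lambda>b. P (- 1) b / of_real (4 + (- 1) * p))"
    using st[of 1] st[of "-1"] by simp_all
  then have "P 1 b / of_real (4 + 1 * p) = chi b"
    using pure t conv b unfolding pure_state_on_def by blast
  then have "P 1 b = chi b * of_real (4 + 1 * p)" by (rule nonzero_divide_eq_eq[OF n(1), THEN iffD1])
  then show ?thesis using p(1) by (simp add: P_def T_def algebra_simps)
qed

text \<open>Unital *-homomorphisms to the complex numbers.\<close>

definition star_character :: "('a::complex_star_algebra \<Rightarrow> complex) \<Rightarrow> bool" where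
  "star_character h \<longleftrightarrow> h 1 = 1 \<and> (\<forall>a b. h (a + b) = h a + h b) \<and> (\<forall>a b. h (a * b) = h a * h b) \<and>
    (\<forall>c a. h (c *\<^sub>C a) = c * h a) \<and> (\<forall>a. h (star a) = cnj (h a))"

lemma star_character_state:
  assumes "star_character h" shows "state_on B h"
  using assms by (auto simp: star_character_def state_on_def complex_nonneg_Reals_iff)

lemma star_character_pure:
  assumes h: "star_character h" and B: "cstar_subalgebra B" "1 \<in> B"
  shows "pure_state_on B h"
proof -
  note B' = cstar_subalgebraD[OF B(1)]
  have *: "\<phi> a = h a"
    if "state_on B \<phi>" "state_on B \<psi>" "0 < t" "t < 1"
      "\<forall>a\<in>B. h a = complex_of_real t * \<phi> a + complex_of_real (1 - t) * \<psi> a" "a \<in> B" for \<phi> \<psi> t a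
  proof -
    define x where "x = a - h a *\<^sub>C 1"
    have x: "x \<in> B" using that(6) B B' by (simp add: x_def)
    have "h x = 0"
      using h state_onD(5)[OF star_character_state[OF h] B] that(6) B B'
      by (simp add: x_def star_character_def)
    then have "h (star x * x) = 0" using h by (simp add: star_character_def)
    then have e: "0 = complex_of_real t * \<phi> (star x * x) + complex_of_real (1 - t) * \<psi> (star x * x)"
      using that(5) x B' by metis
    have "\<phi> (star x * x) \<in> \<real>\<^sub>\<ge>\<^sub>0" "\<psi> (star x * x) \<in> \<real>\<^sub>\<ge>\<^sub>0"
      using state_onD(4)[OF that(1) B x] state_onD(4)[OF that(2) B x] by simp_all
    then obtain u v where uv: "\<phi> (star x * x) = of_real u" "\<psi> (star x * x) = of_real v" "0 \<le> u" "0 \<le> v"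
      by (metis nonneg_Reals_cases)
    have "t * u + (1 - t) * v = 0" using e unfolding uv by (metis of_real_add of_real_eq_0_iff of_real_mult)
    moreover have "0 \<le> (1 - t) * v" "0 \<le> t * u" using uv that(3,4) by simp_all
    ultimately have "t * u = 0" by linarith
    then have "\<phi> (star x * x) = 0" using uv(1) that(3) by simp
    then have "\<phi> x = 0" using state_on_null[OF that(1) B x] by simp
    then show ?thesis using state_onD[OF that(1) B] that(6) B B' by (simp add: x_def)
  qed
  show ?thesis unfolding pure_state_on_def
  proof (intro conjI allI impI ballI star_character_state[OF h])
    fix \<phi> \<psi> t a
    assume H: "state_on B \<phi> \<and> state_on B \<psi> \<and> 0 < t \<and> t < 1 \<and>
      (\<forall>a\<in>B. h a = complex_of_real t * \<phi> a + complex_of_real (1 - t) * \<psi> a)" and a: "a \<in> B"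
    show "\<phi> a = h a" using *[of \<phi> \<psi> t a] H a by blast
    show "\<psi> a = h a" using *[of \<psi> \<phi> "1 - t" a] H a by (simp add: add.commute)
  qed
qed

section \<open>Resolvents\<close>

lemma
  assumes "l \<noteq> 0"
  shows Res_resolvent: "m \<noteq> 0 \<Longrightarrow> Res l f - Res m f = (\<i> * of_real (m - l)) *\<^sub>C (Res l f * Res m f)"
    and Res_star: "star (Res l f) = Res (- l) f"
    and Res_commutator: "m \<noteq> 0 \<Longrightarrow> Res l f * Res m g - Res m g * Res l f =
      (\<i> * of_real (sympl f g)) *\<^sub>C (Res l f * (Res m g)\<^sup>2 * Res l f)"
    and Res_homogeneous: "r \<noteq> 0 \<Longrightarrow> of_real r *\<^sub>C Res (r * l) (r *\<^sub>R f) = Res l f"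
    and Res_product: "m \<noteq> 0 \<Longrightarrow> l + m \<noteq> 0 \<Longrightarrow> Res l f * Res m g =
      Res (l + m) (f + g) *
        (Res l f + Res m g + (\<i> * of_real (sympl f g)) *\<^sub>C ((Res l f)\<^sup>2 * Res m g))"
    and Res_zero: "Res l 0 = (- \<i> / of_real l) *\<^sub>C 1"
  using resolvent_relations_Res[unfolded resolvent_relations_def, rule_format, OF assms] assms
  by blast+

lemma Res_commute:
  assumes "l \<noteq> 0" "m \<noteq> 0" "sympl f g = 0"
  shows "Res l f * Res m g = Res m g * Res l f"
  using Res_commutator[OF assms(1,2), of f g] assms(3) by (simp add: scaleC_simps)

text \<open>
  The Cayley transform. If \<open>Res l f\<close> is thought of as \<open>1 / (\<i> l - \<phi>(f))\<close> with selfadjoint \<open>\<phi>(f)\<close>,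
  then this is the unitary \<open>(\<phi>(f) + \<i> l) / (\<phi>(f) - \<i> l)\<close>.
\<close>

definition cayley :: "real \<Rightarrow> 'x::symplectic_space \<Rightarrow> 'x resolvent_algebra" where
  "cayley l f = 1 - (2 * \<i> * of_real l) *\<^sub>C Res l f"

lemma star_cayley: "l \<noteq> 0 \<Longrightarrow> star (cayley l f) = cayley (- l) f"
  by (simp add: cayley_def star_simps Res_star)

lemma cayley_mult: "l \<noteq> 0 \<Longrightarrow> cayley l f * cayley (- l) f = 1"
proof -
  assume l: "l \<noteq> 0"
  have "cayley l f * cayley (- l) f = 1 -
      (2 * \<i> * of_real l) *\<^sub>C (Res l f - Res (- l) f - (\<i> * of_real (- l - l)) *\<^sub>C (Res l f * Res (- l) f))"
    by (simp add: cayley_def scaleC_simps algebra_simps)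
  then show ?thesis using Res_resolvent[OF l, of "- l" f] l by (simp add: scaleC_simps)
qed

lemma cayley_unitary:
  assumes "l \<noteq> 0"
  shows "star (cayley l f) * cayley l f = 1" "cayley l f * star (cayley l f) = 1"
  using cayley_mult[OF assms] cayley_mult[of "- l" f] assms by (simp_all add: star_cayley)

lemma norm_cayley: "l \<noteq> 0 \<Longrightarrow> norm (cayley l f) = 1"
  using norm_star_mult_self[of "cayley l f"] power2_eq_1_iff[of "norm (cayley l f)"]
    norm_ge_zero[of "cayley l f"]
  by (auto simp: cayley_unitary simp del: norm_ge_zero)

lemma Res_cayley: "l \<noteq> 0 \<Longrightarrow> Res l f = (1 / (2 * \<i> * of_real l)) *\<^sub>C (1 - cayley l f)"
  by (simp add: cayley_def scaleC_simps)

text \<open>No case for \<open>star\<close> is needed, as the set of resolvents is closed under it.\<close>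

lemma resolvent_algebra_induct [case_names closed Res add mult scaleC]:
  fixes P :: "'x::symplectic_space resolvent_algebra \<Rightarrow> bool"
  assumes closed: "closed {a. P a}" and Res: "\<And>l f. l \<noteq> 0 \<Longrightarrow> P (Res l f)"
    and add: "\<And>a b. P a \<Longrightarrow> P b \<Longrightarrow> P (a + b)" and mult: "\<And>a b. P a \<Longrightarrow> P b \<Longrightarrow> P (a * b)"
    and scaleC: "\<And>c a. P a \<Longrightarrow> P (c *\<^sub>C a)"
  shows "P a"
proof -
  have one: "P 1"
    using scaleC[OF Res[of 1 0], of \<i>] by (simp add: Res_zero scaleC_simps)
  have zero: "P 0" using scaleC[OF one, of 0] by (simp add: scaleC_simps)
  have "P (to_completion x) \<and> P (to_completion (star x))" for x :: "'x resolvent_star_algebra"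
  proof (induction x rule: resolvent_star_algebra_induct)
    case (gen l f)
    then show ?case using Res[of l f] Res[of "- l" f] by (simp add: gen_star flip: Res_def)
  qed (simp_all add: to_completion_hom star_simps zero one add mult scaleC)
  then have "range to_completion \<subseteq> {a. P a}" by auto
  then have "closure (range to_completion) \<subseteq> {a. P a}" using closed by (rule closure_minimal)
  then show ?thesis by (auto simp: to_completion_dense)
qed

lemma closed_ideal_closure:
  fixes S :: "'x::symplectic_space resolvent_algebra set"
  assumes S: "complex_subspace S"
    and Res: "\<And>l f s. l \<noteq> 0 \<Longrightarrow> s \<in> S \<Longrightarrow> Res l f * s \<in> S \<and> s * Res l f \<in> S"
  shows "closed_ideal (closure S)"
proof -
  have limit: "a \<in> closure S" if "\<And>n. x n \<in> S" "x \<longlonglongrightarrow> a" for x a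
    unfolding closure_sequential using that by blast
  have closure_add: "a + b \<in> closure S" if a: "a \<in> closure S" and b: "b \<in> closure S" for a b
  proof -
    obtain x where x: "\<And>n. x n \<in> S" "x \<longlonglongrightarrow> a"
      using a unfolding closure_sequential by blast
    obtain y where y: "\<And>n. y n \<in> S" "y \<longlonglongrightarrow> b"
      using b unfolding closure_sequential by blast
    show ?thesis using S x y
      by (intro limit[of "\<lambda>n. x n + y n"] tendsto_add) (simp_all add: complex_subspace_def)
  qed
  have scale: "c *\<^sub>C a \<in> closure S" if a: "a \<in> closure S" for c a
  proof -
    obtain x where "\<And>n. x n \<in> S" "x \<longlonglongrightarrow> a" using a unfolding closure_sequential by blast
    then show ?thesis using S
      by (intro limit[of "\<lambda>n. c *\<^sub>C x n"] tendsto_scaleC) (simp_all add: complex_subspace_def)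
  qed
  have "a * s \<in> closure S \<and> s * a \<in> closure S" if "s \<in> closure S" for a s
    using that
  proof (induction a arbitrary: s rule: resolvent_algebra_induct)
    case closed
    have "{a. \<forall>s. s \<in> closure S \<longrightarrow> a * s \<in> closure S \<and> s * a \<in> closure S} =
      (\<Inter>s\<in>closure S. (\<lambda>a. a * s) -` closure S \<inter> (\<lambda>a. s * a) -` closure S)" by auto
    also have "closed \<dots>"
      by (intro closed_INT ballI closed_Int closed_vimage closed_closure continuous_intros)
    finally show ?case by simp
  next
    case (Res l f s)
    then obtain x where x: "\<And>n. x n \<in> S" "x \<longlonglongrightarrow> s" unfolding closure_sequential by blast
    show ?case
      using limit[OF _ tendsto_mult_left[OF x(2), of "Res l f"]]
        limit[OF _ tendsto_mult_right[OF x(2), of "Res l f"]] assms(2)[OF Res(1) x(1)] by blast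
  next
    case (add a b s)
    then show ?case by (simp add: distrib_left distrib_right closure_add)
  next
    case (mult a b s)
    then show ?case by (metis mult.assoc)
  next
    case (scaleC c a s)
    then show ?case using scale by (simp add: scaleC_simps)
  qed
  then show ?thesis
    using closure_add scale S closure_subset[of S] by (auto simp: closed_ideal_def complex_subspace_def)
qed

lemma closed_ideal_hull: "closed_ideal (closed_ideal hull A)"
  by (rule hull_in) (auto simp: closed_ideal_def complex_subspace_def intro!: closed_Inter)

lemma cstar_subalgebra_resolvent_subalgebra: "cstar_subalgebra (resolvent_subalgebra Z)"
  unfolding resolvent_subalgebra_def
  by (rule hull_in) (auto simp: cstar_subalgebra_def complex_subspace_def intro!: closed_Inter)

lemma Res_in_resolvent_subalgebra: "l \<noteq> 0 \<Longrightarrow> f \<in> Z \<Longrightarrow> Res l f \<in> resolvent_subalgebra Z"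
  unfolding resolvent_subalgebra_def by (rule hull_inc) blast

lemma one_in_resolvent_subalgebra:
  assumes "subspace Z" shows "1 \<in> resolvent_subalgebra Z"
proof -
  have "\<i> *\<^sub>C Res 1 0 \<in> resolvent_subalgebra Z"
    using assms by (intro cstar_subalgebraD cstar_subalgebra_resolvent_subalgebra
        Res_in_resolvent_subalgebra) (simp_all add: subspace_0)
  then show ?thesis by (simp add: Res_zero scaleC_simps)
qed

lemma Res_commute_resolvent_subalgebra:
  assumes "isotropic Z" "l \<noteq> 0" "f \<in> Z" "b \<in> resolvent_subalgebra Z"
  shows "Res l f * b = b * Res l f"
proof -
  define C where "C = {b. \<forall>m. m \<noteq> 0 \<longrightarrow> Res m f * b = b * Res m f}"
  have "resolvent_subalgebra Z \<subseteq> C"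
    unfolding resolvent_subalgebra_def
  proof (rule hull_minimal)
    show "{Res l f |l f. l \<noteq> 0 \<and> f \<in> Z} \<subseteq> C"
      using assms by (auto simp: C_def isotropic_def intro!: Res_commute)
    have "star b \<in> C" if b: "b \<in> C" for b
    proof -
      have "star (b * Res (- m) f) = star (Res (- m) f * b)" if "m \<noteq> 0" for m
        using b that by (simp add: C_def)
      then show ?thesis by (simp add: C_def star_mult Res_star)
    qed
    moreover have "closed C"
    proof -
      have "C = (\<Inter>m\<in>-{0}. {b. Res m f * b = b * Res m f})" by (auto simp: C_def)
      then show ?thesis by (auto intro!: closed_INT closed_Collect_eq continuous_intros)
    qed
    moreover have "a * b \<in> C" if a: "a \<in> C" and b: "b \<in> C" for a b
    proof -
      have "Res m f * (a * b) = (a * b) * Res m f" if "m \<noteq> 0" for m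
      proof -
        have "Res m f * (a * b) = (Res m f * a) * b" by (simp only: mult.assoc)
        also have "\<dots> = a * (Res m f * b)" using a that by (simp add: C_def mult.assoc)
        also have "\<dots> = (a * b) * Res m f" using b that by (simp add: C_def mult.assoc)
        finally show ?thesis .
      qed
      then show ?thesis by (simp add: C_def)
    qed
    moreover have "complex_subspace C"
      by (simp add: complex_subspace_def C_def scaleC_simps distrib_left distrib_right)
    ultimately show "cstar_subalgebra C"
      unfolding cstar_subalgebra_def by blast
  qed
  then show ?thesis using assms by (auto simp: C_def)
qed

section \<open>Characters give maximal ideals\<close>

lemma pure_state_on_Res_mult:
  assumes Z: "subspace Z" "isotropic Z" and pure: "pure_state_on (resolvent_subalgebra Z) chi"
    and l: "l \<noteq> 0" "f \<in> Z" and b: "b \<in> resolvent_subalgebra Z"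
  shows "chi (Res l f * b) = chi (Res l f) * chi b"
proof -
  let ?B = "resolvent_subalgebra Z"
  have B: "cstar_subalgebra ?B" "1 \<in> ?B"
    using cstar_subalgebra_resolvent_subalgebra one_in_resolvent_subalgebra[OF Z(1)] by auto
  note B' = cstar_subalgebraD[OF B(1)]
  have "state_on ?B chi" using pure by (simp add: pure_state_on_def)
  note chi = state_onD[OF this B]
  define U where "U = cayley l f"
  have U: "U \<in> ?B"
    using l B B' by (simp add: U_def cayley_def Res_in_resolvent_subalgebra)
  have comm: "U * b = b * U" "star U * b = b * star U" if "b \<in> ?B" for b
    using l Res_commute_resolvent_subalgebra[OF Z(2) _ l(2) that]
    by (simp_all add: U_def cayley_def star_simps Res_star scaleC_simps algebra_simps)
  have unitary: "star U * U = 1" unfolding U_def by (rule cayley_unitary[OF l(1)])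
  have "chi ((U + star U) * b) = chi (U + star U) * chi b"
    using pure B U unitary comm b by (rule pure_state_on_unitary)
  then have 1: "chi (U * b) + chi (star U * b) = (chi U + chi (star U)) * chi b"
    using U b B' by (simp add: distrib_right chi)
  have "chi ((\<i> *\<^sub>C U + star (\<i> *\<^sub>C U)) * b) = chi (\<i> *\<^sub>C U + star (\<i> *\<^sub>C U)) * chi b"
    by (rule pure_state_on_unitary[OF pure B]) (simp_all add: U B' unitary comm b star_simps scaleC_simps)
  then have "\<i> * chi (U * b) - \<i> * chi (star U * b) = (\<i> * chi U - \<i> * chi (star U)) * chi b"
    using U b B' by (simp add: left_diff_distrib[of _ _ b] chi star_simps scaleC_simps)
  then have "\<i> * (chi (U * b) - chi (star U * b)) = \<i> * ((chi U - chi (star U)) * chi b)"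
    by (simp only: right_diff_distrib left_diff_distrib mult.assoc)
  then have 2: "chi (U * b) - chi (star U * b) = (chi U - chi (star U)) * chi b" by simp
  have "2 * chi (U * b) = (chi (U * b) + chi (star U * b)) + (chi (U * b) - chi (star U * b))" by simp
  also have "\<dots> = 2 * (chi U * chi b)" unfolding 1 2 by (simp add: algebra_simps)
  finally have "2 * chi (U * b) = 2 * (chi U * chi b)" .
  then have "chi (U * b) = chi U * chi b" by simp
  moreover have "Res l f = (1 / (2 * \<i> * of_real l)) *\<^sub>C (1 - U)"
    unfolding U_def by (rule Res_cayley[OF l(1)])
  ultimately show ?thesis
    using U b B B' by (simp add: chi mult_scaleC_left left_diff_distrib)
qed

text \<open>
  The extension by \<open>0\<close> is compatible with the product relation because \<open>f + g \<notin> Z\<close> whenever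
  exactly one of \<open>f\<close> and \<open>g\<close> lies in \<open>Z\<close>.
\<close>

lemma resolvent_relations_pure_state:
  fixes Z :: "'x::symplectic_space set"
  assumes Z: "subspace Z" "isotropic Z" and pure: "pure_state_on (resolvent_subalgebra Z) chi"
  shows "resolvent_relations (\<lambda>l f. if f \<in> Z then chi (Res l f) else 0)"
  unfolding resolvent_relations_def
proof (intro allI impI conjI)
  let ?B = "resolvent_subalgebra Z"
  have B: "cstar_subalgebra ?B" "1 \<in> ?B"
    using cstar_subalgebra_resolvent_subalgebra one_in_resolvent_subalgebra[OF Z(1)] by auto
  note B' = cstar_subalgebraD[OF B(1)]
  have "state_on ?B chi" using pure by (simp add: pure_state_on_def)
  note chi = state_onD[OF this B]
  note mult = pure_state_on_Res_mult[OF Z pure]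
  note mem = Res_in_resolvent_subalgebra[where Z = Z]
  fix l m r :: real and f g :: 'x
  assume l: "l \<noteq> 0" and m: "m \<noteq> 0" and r: "r \<noteq> 0"
  let ?k = "\<lambda>l f. if f \<in> Z then chi (Res l f) else 0"
  show "?k l f - ?k m f = (\<i> * complex_of_real (m - l)) *\<^sub>C (?k l f * ?k m f)"
  proof (cases "f \<in> Z")
    case True
    have "chi (Res l f - Res m f) = chi ((\<i> * of_real (m - l)) *\<^sub>C (Res l f * Res m f))"
      by (simp only: Res_resolvent[OF l m])
    then show ?thesis using True l m mem B'
      by (simp add: chi mult scaleC_complex_def)
  qed (simp add: scaleC_complex_def)
  show "star (?k l f) = ?k (- l) f"
    using chi(6)[of "Res l f"] mem l by (simp add: star_complex_def Res_star)
  show "?k l f * ?k m g - ?k m g * ?k l f =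
      (\<i> * complex_of_real (sympl f g)) *\<^sub>C (?k l f * (?k m g)\<^sup>2 * ?k l f)"
    using Z(2) by (simp add: isotropic_def scaleC_complex_def)
  show "complex_of_real r *\<^sub>C ?k (r * l) (r *\<^sub>R f) = ?k l f"
  proof (cases "f \<in> Z")
    case True
    then have rf: "r *\<^sub>R f \<in> Z" by (rule subspace_scale[OF Z(1)])
    have "chi (of_real r *\<^sub>C Res (r * l) (r *\<^sub>R f)) = chi (Res l f)"
      by (simp only: Res_homogeneous[OF l r])
    then show ?thesis using True rf l r mem by (simp add: chi scaleC_complex_def)
  next
    case False
    then have "r *\<^sub>R f \<notin> Z" using subspace_scale[OF Z(1), of "r *\<^sub>R f" "inverse r"] r by auto
    then show ?thesis using False by (simp add: scaleC_complex_def)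
  qed
  show "?k l (0::'x) = (- \<i> / complex_of_real l) *\<^sub>C 1"
    using subspace_0[OF Z(1)] B l by (simp add: Res_zero chi scaleC_complex_def)
  show "?k l f * ?k m g = ?k (l + m) (f + g) *
      (?k l f + ?k m g + (\<i> * complex_of_real (sympl f g)) *\<^sub>C ((?k l f)\<^sup>2 * ?k m g))"
    if lm: "l + m \<noteq> 0"
  proof (cases "f \<in> Z \<and> g \<in> Z")
    case True
    then have fg: "f + g \<in> Z" by (simp add: subspace_add[OF Z(1)])
    have 0: "sympl f g = 0" using True Z(2) by (simp add: isotropic_def)
    have "chi (Res l f * Res m g) = chi (Res (l + m) (f + g) * (Res l f + Res m g))"
      using Res_product[OF l m lm, of f g] by (simp add: 0 scaleC_simps)
    then show ?thesis using True fg l m lm mem B' 0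
      by (simp add: chi mult scaleC_complex_def)
  next
    case False
    have "f + g \<notin> Z" if "f \<in> Z \<and> g \<notin> Z \<or> f \<notin> Z \<and> g \<in> Z"
      using that subspace_diff[OF Z(1), of "f + g" f] subspace_diff[OF Z(1), of "f + g" g] by auto
    then show ?thesis using False by (auto simp: scaleC_complex_def)
  qed
qed

text \<open>
  The relations make \<open>k\<close> extend to a character of the universal *-algebra. The closure of its
  kernel is proper, since the character is a state and thus bounded by the seminorm.
\<close>

lemma ex_ideal_of_relations:
  fixes k :: "real \<Rightarrow> 'x::symplectic_space \<Rightarrow> complex"
  assumes k: "resolvent_relations k"
  shows "\<exists>K. closed_ideal K \<and> 1 \<notin> K \<and> (\<forall>l f. l \<noteq> 0 \<longrightarrow> Res l f - k l f *\<^sub>C 1 \<in> K)"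
proof -
  obtain h :: "'x resolvent_star_algebra \<Rightarrow> complex" where
    hk: "\<forall>l f. l \<noteq> 0 \<longrightarrow> h (gen l f) = k l f" and h: "star_character h"
    using ex1_implies_ex[OF resolvent_star_algebra_universal[OF k]]
    unfolding star_character_def scaleC_complex_def star_complex_def by blast
  note h' = h[unfolded star_character_def]
  have hdiff: "h (a - b) = h a - h b" for a b
    using h' by (metis add_diff_cancel_right' diff_add_cancel)
  have h_le: "cmod (h x) \<le> snorm x" for x
  proof -
    have vec: "gns_vec h x = cmod (h x)" for x
      using h' by (simp add: gns_vec_def cmod_def power2_eq_square)
    have "gns_bound x (snorm x)" by (simp add: gns_bound_iff)
    then have "gns_vec h (x * 1) \<le> snorm x * gns_vec h 1"
      using star_character_state[OF h] unfolding gns_bound_def by blast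
    then show ?thesis using h' by (simp add: vec)
  qed
  define S where "S = to_completion ` {x. h x = 0}"
  have h0: "h 0 = 0" using hdiff[of 0 0] by simp
  have "closed_ideal (closure S)"
  proof (rule closed_ideal_closure)
    show "complex_subspace S"
      unfolding complex_subspace_def
    proof (intro conjI ballI allI)
      show "0 \<in> S" by (simp add: S_def image_iff) (metis h0 to_completion_hom(1))
      fix a assume "a \<in> S"
      then obtain x where x: "h x = 0" "a = to_completion x" by (auto simp: S_def)
      show "c *\<^sub>C a \<in> S" for c
        unfolding S_def x(2) using x(1) h'
        by (intro image_eqI[of _ _ "c *\<^sub>C x"]) (simp_all add: to_completion_hom)
      fix b assume "b \<in> S"
      then obtain y where y: "h y = 0" "b = to_completion y" by (auto simp: S_def)
      show "a + b \<in> S"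
        unfolding S_def x(2) y(2) using x(1) y(1) h'
        by (intro image_eqI[of _ _ "x + y"]) (simp_all add: to_completion_hom)
    qed
    show "Res l f * s \<in> S \<and> s * Res l f \<in> S" if s: "s \<in> S" for l f s
    proof -
      obtain x where x: "h x = 0" "s = to_completion x" using s by (auto simp: S_def)
      have "Res l f * s = to_completion (gen l f * x)" "s * Res l f = to_completion (x * gen l f)"
        by (simp_all add: x(2) Res_def to_completion_hom)
      then show ?thesis using x(1) h' by (auto simp: S_def)
    qed
  qed
  moreover have "1 \<notin> closure S"
  proof
    assume "1 \<in> closure S"
    then have "\<exists>y\<in>S. dist y 1 < 1" unfolding closure_approachable by (meson zero_less_one)
    then obtain x where x: "h x = 0" "dist (to_completion x) 1 < 1" by (auto simp: S_def)
    then have "snorm (x - 1) < 1"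
      by (simp add: dist_norm norm_to_completion flip: to_completion_hom(2,7))
    then show False using h_le[of "x - 1"] x(1) h' by (simp add: hdiff)
  qed
  moreover have "Res l f - k l f *\<^sub>C 1 \<in> closure S" if "l \<noteq> 0" for l f
  proof -
    have "Res l f - k l f *\<^sub>C 1 = to_completion (gen l f - k l f *\<^sub>C 1)"
      by (simp add: to_completion_hom Res_def)
    moreover have "h (gen l f - k l f *\<^sub>C 1) = 0" using h' by (simp add: hdiff hk that)
    ultimately show ?thesis using closure_subset[of S] by (auto simp: S_def)
  qed
  ultimately show ?thesis by blast
qed

context proper_ideal
begin

lemma eqv_scalar_unique: "c *\<^sub>C 1 \<doteq> d *\<^sub>C 1 \<Longrightarrow> c = d"
  using qnorm_scaleC[of "c - d" 1] qnorm_one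
  by (simp add: eqv_def scaleC_left_diff_distrib flip: qnorm_zero_iff)

lemma closed_eqv_scalar: "closed {a. \<exists>c. a \<doteq> c *\<^sub>C 1}"
  unfolding closed_sequential_limits
proof (intro allI impI)
  fix x a assume H: "(\<forall>n. x n \<in> {a. \<exists>c. a \<doteq> c *\<^sub>C 1}) \<and> x \<longlonglongrightarrow> a"
  then have x: "x \<longlonglongrightarrow> a" by simp
  have "\<forall>n. \<exists>c. x n \<doteq> c *\<^sub>C 1" using H by simp
  then obtain c where c: "\<And>n. x n \<doteq> c n *\<^sub>C 1" by (auto simp: choice_iff)
  have le: "cmod (c m - c n) \<le> norm (x m - x n)" for m n
  proof -
    have "cmod (c m - c n) = qnorm (c m *\<^sub>C 1 - c n *\<^sub>C 1)"
      using qnorm_scaleC[of "c m - c n" 1] by (simp add: qnorm_one scaleC_left_diff_distrib)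
    also have "\<dots> = qnorm (x m - x n)" by (rule qnorm_eqv[OF eqv_sym[OF eqv_diff[OF c c]]])
    also have "\<dots> \<le> norm (x m - x n)" by (rule qnorm_le_norm)
    finally show ?thesis .
  qed
  have "Cauchy c"
    unfolding Cauchy_def dist_norm
    using LIMSEQ_imp_Cauchy[OF x, unfolded Cauchy_def dist_norm] order.strict_trans1[OF le] by fast
  then obtain d where "c \<longlonglongrightarrow> d" by (auto simp: Cauchy_convergent_iff convergent_def)
  then have "(\<lambda>n. x n - c n *\<^sub>C 1) \<longlonglongrightarrow> a - d *\<^sub>C 1"
    by (intro tendsto_diff x tendsto_scaleC_left)
  moreover have "\<And>n. x n - c n *\<^sub>C 1 \<in> J" using c unfolding eqv_def .
  ultimately have "a - d *\<^sub>C 1 \<in> J" by (rule closed_sequentially[OF closed_mem, rotated])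
  then show "a \<in> {a. \<exists>c. a \<doteq> c *\<^sub>C 1}" by (auto simp: eqv_def)
qed

lemma eqv_scalar_maximal:
  assumes "\<And>a. \<exists>c. a \<doteq> c *\<^sub>C 1" shows "proper_maximal_ideal J"
  unfolding proper_maximal_ideal_def
proof (intro conjI ideal proper allI impI notI)
  fix K assume K: "closed_ideal K \<and> K \<noteq> UNIV" and "J \<subset> K"
  then interpret K: proper_ideal K by unfold_locales auto
  obtain a where a: "a \<in> K" "a \<notin> J" using \<open>J \<subset> K\<close> by blast
  obtain c where c: "a \<doteq> c *\<^sub>C 1" using assms by blast
  then have "c \<noteq> 0" using a(2) by (auto simp: eqv_def scaleC_simps)
  have "a - c *\<^sub>C 1 \<in> K" using c \<open>J \<subset> K\<close> by (auto simp: eqv_def)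
  from K.scaleC_mem[OF K.diff_mem[OF a(1) this]]
  have "(1 / c) *\<^sub>C (a - (a - c *\<^sub>C 1)) \<in> K" .
  then show False using \<open>c \<noteq> 0\<close> K.one_not_mem by (simp add: scaleC_simps)
qed

end

lemma eqv_scalar_resolvent_algebra:
  fixes J :: "'x::symplectic_space resolvent_algebra set"
  assumes J: "closed_ideal J" "J \<noteq> UNIV"
    and Res: "\<And>l f. l \<noteq> 0 \<Longrightarrow> \<exists>c. Res l f - c *\<^sub>C 1 \<in> J"
  shows "\<exists>c. a - c *\<^sub>C 1 \<in> J"
proof -
  interpret proper_ideal J using J by unfold_locales
  have "\<exists>c. a \<doteq> c *\<^sub>C 1"
  proof (induction a rule: resolvent_algebra_induct)
    case closed
    show ?case by (rule closed_eqv_scalar)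
  next
    case (Res l f)
    then show ?case using assms(3) by (simp add: eqv_def)
  next
    case (add a b)
    then obtain c d where "a \<doteq> c *\<^sub>C 1" "b \<doteq> d *\<^sub>C 1" by blast
    then have "a + b \<doteq> (c + d) *\<^sub>C 1" using eqv_add[of a "c *\<^sub>C 1" b "d *\<^sub>C 1"]
      by (simp add: scaleC_add_left)
    then show ?case by blast
  next
    case (mult a b)
    then obtain c d where "a \<doteq> c *\<^sub>C 1" "b \<doteq> d *\<^sub>C 1" by blast
    then have "a * b \<doteq> (c * d) *\<^sub>C 1" using eqv_mult[of a "c *\<^sub>C 1" b "d *\<^sub>C 1"]
      by (simp add: scaleC_simps mult.commute)
    then show ?case by blast
  next
    case (scaleC c a)
    then obtain d where "a \<doteq> d *\<^sub>C 1" by blast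
    then have "c *\<^sub>C a \<doteq> (c * d) *\<^sub>C 1" using eqv_scaleC[of a "d *\<^sub>C 1" c]
      by (simp add: scaleC_scaleC)
    then show ?case by blast
  qed
  then show ?thesis by (simp add: eqv_def)
qed

theorem character_ideal_maximal:
  assumes Z: "subspace Z" "isotropic Z" and pure: "pure_state_on (resolvent_subalgebra Z) chi"
  shows "proper_maximal_ideal (character_ideal Z chi)"
proof -
  let ?J = "character_ideal Z chi"
  let ?G = "{Res l f - chi (Res l f) *\<^sub>C 1 | l f. l \<noteq> 0 \<and> f \<in> Z} \<union> {Res m g | m g. m \<noteq> 0 \<and> g \<notin> Z}"
  have ideal: "closed_ideal ?J" unfolding character_ideal_def by (rule closed_ideal_hull)
  obtain K where K: "closed_ideal K" "1 \<notin> K" and Kgen: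
    "\<And>l f. l \<noteq> 0 \<Longrightarrow> Res l f - (if f \<in> Z then chi (Res l f) else 0) *\<^sub>C 1 \<in> K"
    using ex_ideal_of_relations[OF resolvent_relations_pure_state[OF assms]] by blast
  have "?G \<subseteq> K" using Kgen by (force simp: scaleC_simps split: if_splits)
  then have "?J \<subseteq> K" unfolding character_ideal_def using K(1) by (rule hull_minimal)
  then have proper: "?J \<noteq> UNIV" using K(2) by blast
  have gen: "?G \<subseteq> ?J" unfolding character_ideal_def by (rule hull_subset)
  have "\<exists>c. Res l f - c *\<^sub>C 1 \<in> ?J" if "l \<noteq> 0" for l f
  proof (cases "f \<in> Z")
    case True
    then show ?thesis using gen that by blast
  next
    case False
    then have "Res l f \<in> ?J" using gen that by blast
    then show ?thesis by (intro exI[of _ 0]) (simp add: scaleC_simps)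
  qed
  then have scalar: "\<exists>c. a - c *\<^sub>C 1 \<in> ?J" for a
    by (rule eqv_scalar_resolvent_algebra[OF ideal proper])
  interpret proper_ideal ?J using ideal proper by unfold_locales
  show ?thesis using scalar by (intro eqv_scalar_maximal) (simp add: eqv_def)
qed

section \<open>Maximal ideals are given by characters\<close>

text \<open>The analysis of a given maximal ideal \<open>J\<close>.\<close>

locale maximal_ideal =
  fixes J :: "'x::symplectic_space resolvent_algebra set"
  assumes maximal: "proper_maximal_ideal J"
begin

sublocale proper_ideal J
  using maximal by unfold_locales (auto simp: proper_maximal_ideal_def)

text \<open>Two-sided invertibility of the class of \<open>a\<close> in the quotient by \<open>J\<close>.\<close>

definition invertible_mod :: "'x resolvent_algebra \<Rightarrow> bool" where
  "invertible_mod a \<longleftrightarrow> (\<exists>b. a * b \<doteq> 1 \<and> b * a \<doteq> 1)"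

lemma larger_ideal: "closed_ideal K \<Longrightarrow> J \<subseteq> K \<Longrightarrow> K = J \<or> K = UNIV"
  using maximal by (auto simp: proper_maximal_ideal_def)

text \<open>
  If products of \<open>a\<close> with generators on one side can be written, modulo \<open>J\<close>, as products of \<open>a\<close> on
  the other side, then the closure of the right ideal generated by \<open>a\<close> and \<open>J\<close> is a two-sided
  ideal, and so is the right annihilator of \<open>a\<close> modulo \<open>J\<close>. By maximality the former contains \<open>1\<close>, which gives a right inverse \<open>b\<close>; the latter
  is \<open>J\<close> and contains \<open>b * a - 1\<close>.
\<close>

lemma normal_invertible:
  assumes "a \<notin> J"
    and right: "\<And>l f. l \<noteq> 0 \<Longrightarrow> \<exists>b. Res l f * a \<doteq> a * b"
    and left: "\<And>l f. l \<noteq> 0 \<Longrightarrow> \<exists>b. a * Res l f \<doteq> b * a"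
  shows "invertible_mod a"
proof -
  define S where "S = {s. \<exists>x. s \<doteq> a * x}"
  have "closed_ideal (closure S)"
  proof (rule closed_ideal_closure)
    show "complex_subspace S"
      unfolding complex_subspace_def
    proof (intro conjI ballI allI)
      show "0 \<in> S" unfolding S_def using eqv_refl[of 0] by (auto intro: exI[of _ 0])
      fix s assume "s \<in> S"
      then obtain x where x: "s \<doteq> a * x" by (auto simp: S_def)
      show "c *\<^sub>C s \<in> S" for c
        using eqv_scaleC[OF x, of c] by (auto simp: S_def simp flip: mult_scaleC_right)
      fix t assume "t \<in> S"
      then obtain y where y: "t \<doteq> a * y" by (auto simp: S_def)
      show "s + t \<in> S" using eqv_add[OF x y] by (auto simp: S_def simp flip: distrib_left)
    qed
    fix l f s assume l: "(l::real) \<noteq> 0" and "s \<in> S"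
    then obtain x where x: "s \<doteq> a * x" by (auto simp: S_def)
    obtain b where b: "Res l f * a \<doteq> a * b" using right[OF l] by blast
    have "Res l f * s \<doteq> Res l f * (a * x)" by (rule eqv_mult[OF eqv_refl x])
    also have "\<dots> = (Res l f * a) * x" by (simp only: mult.assoc)
    also have "\<dots> \<doteq> (a * b) * x" by (rule eqv_mult[OF b eqv_refl])
    also have "\<dots> = a * (b * x)" by (rule mult.assoc)
    finally have 1: "Res l f * s \<doteq> a * (b * x)" .
    have "s * Res l f \<doteq> (a * x) * Res l f" by (rule eqv_mult[OF x eqv_refl])
    also have "\<dots> = a * (x * Res l f)" by (rule mult.assoc)
    finally have 2: "s * Res l f \<doteq> a * (x * Res l f)" .
    show "Res l f * s \<in> S \<and> s * Res l f \<in> S" unfolding S_def using 1 2 by blast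
  qed
  moreover have "J \<subseteq> S"
  proof
    fix s assume "s \<in> J"
    then have "s \<doteq> a * 0" by (simp add: eqv_zero_iff)
    then show "s \<in> S" unfolding S_def by blast
  qed
  then have "J \<subseteq> closure S" using closure_subset by blast
  moreover have "a \<in> closure S"
  proof -
    have "a \<doteq> a * 1" by (simp add: eqv_refl)
    then have "a \<in> S" unfolding S_def by blast
    then show ?thesis using closure_subset by blast
  qed
  ultimately have "1 \<in> closure S" using larger_ideal assms(1) by blast
  then have "\<exists>s\<in>S. dist s 1 < 1" unfolding closure_approachable by (meson zero_less_one)
  then obtain s x where s: "dist s 1 < 1" "s \<doteq> a * x" by (auto simp: S_def)
  \<comment> \<open>\<open>s\<close> is invertible by the Neumann series.\<close>
  then obtain u where "(1 - (1 - s)) * u = 1"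
    using ex_inverse_one_minus[of "1 - s"] by (auto simp: dist_norm norm_minus_commute)
  then have "a * x * u \<doteq> 1" using eqv_mult[OF eqv_sym[OF s(2)] eqv_refl[of u]] by simp
  then have ab: "a * (x * u) \<doteq> 1" by (simp only: mult.assoc)
  define b where "b = x * u"
  define T where "T = {t. a * t \<in> J}"
  have "closed T"
    unfolding T_def using closed_vimage[OF closed_mem, of "\<lambda>t. a * t"]
    by (simp add: vimage_def continuous_intros)
  moreover have "closed_ideal (closure T)"
  proof (rule closed_ideal_closure)
    show "complex_subspace T"
      by (simp add: complex_subspace_def T_def zero_mem distrib_left add_mem mult_scaleC_right
          scaleC_mem)
    fix l f t assume l: "(l::real) \<noteq> 0" and "t \<in> T"
    then have t: "a * t \<in> J" by (simp add: T_def)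
    obtain c where "a * Res l f \<doteq> c * a" using left[OF l] by blast
    then have "a * Res l f * t \<doteq> c * a * t" by (rule eqv_mult[OF _ eqv_refl])
    also have "c * a * t \<doteq> 0" using mult_mem_left[OF t, of c] by (simp add: eqv_zero_iff mult.assoc)
    finally have "a * (Res l f * t) \<in> J" by (simp only: eqv_zero_iff mult.assoc)
    moreover have "a * (t * Res l f) \<in> J" using mult_mem_right[OF t, of "Res l f"] by (simp only: mult.assoc)
    ultimately show "Res l f * t \<in> T \<and> t * Res l f \<in> T" by (simp add: T_def)
  qed
  moreover have "J \<subseteq> T" by (auto simp: T_def mult_mem_left)
  moreover have "1 \<notin> T" using assms(1) by (simp add: T_def)
  ultimately have "T = J" using larger_ideal[of T] closure_closed[of T] by auto
  have "a * b * a \<doteq> 1 * a" unfolding b_def by (rule eqv_mult[OF ab eqv_refl])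
  then have "b * a - 1 \<in> T"
    by (simp add: T_def eqv_def right_diff_distrib mult.assoc)
  then have "b * a \<doteq> 1" by (simp add: eqv_def \<open>T = J\<close>)
  then show ?thesis using ab unfolding invertible_mod_def b_def by blast
qed

lemma Res_invertible:
  assumes "l \<noteq> 0" "Res l f \<notin> J"
  shows "invertible_mod (Res l f)"
proof (rule normal_invertible[OF assms(2)])
  fix m g assume m: "(m::real) \<noteq> 0"
  have c: "Res l f * Res m g - Res m g * Res l f =
      (\<i> * of_real (sympl f g)) *\<^sub>C (Res l f * (Res m g)\<^sup>2 * Res l f)"
    by (rule Res_commutator[OF assms(1) m])
  then have "Res m g * Res l f = Res l f * Res m g -
      (\<i> * of_real (sympl f g)) *\<^sub>C (Res l f * (Res m g)\<^sup>2 * Res l f)"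
    by (simp add: algebra_simps)
  also have "\<dots> = Res l f * (Res m g - (\<i> * of_real (sympl f g)) *\<^sub>C ((Res m g)\<^sup>2 * Res l f))"
    by (simp add: scaleC_simps right_diff_distrib mult.assoc)
  finally show "\<exists>b. Res m g * Res l f \<doteq> Res l f * b" using eqv_refl by metis
  have "Res l f * Res m g = Res m g * Res l f +
      (\<i> * of_real (sympl f g)) *\<^sub>C (Res l f * (Res m g)\<^sup>2 * Res l f)"
    using c by (simp add: algebra_simps)
  also have "\<dots> = (Res m g + (\<i> * of_real (sympl f g)) *\<^sub>C (Res l f * (Res m g)\<^sup>2)) * Res l f"
    by (simp add: scaleC_simps distrib_right)
  finally show "\<exists>b. Res l f * Res m g \<doteq> b * Res l f" using eqv_refl by metis
qed

text \<open>
  Wielandt's argument, applied to inverses \<open>x\<close>, \<open>y\<close> of the resolvents modulo \<open>J\<close>: from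
  \<open>x * y - y * x \<doteq> c *\<^sub>C 1\<close> follows that \<open>n * cmod c\<close> is bounded uniformly in \<open>n\<close>.
\<close>

lemma invertible_Res_sympl:
  assumes l: "l \<noteq> 0" "Res l f \<notin> J" and m: "m \<noteq> 0" "Res m g \<notin> J"
  shows "sympl f g = 0"
proof (rule ccontr)
  assume "sympl f g \<noteq> 0"
  define F G where "F = Res l f" and "G = Res m g"
  obtain x where x: "F * x \<doteq> 1" "x * F \<doteq> 1"
    using Res_invertible[OF l] by (auto simp: F_def invertible_mod_def)
  obtain y where y: "G * y \<doteq> 1" "y * G \<doteq> 1"
    using Res_invertible[OF m] by (auto simp: G_def invertible_mod_def)
  define c where "c = \<i> * complex_of_real (sympl f g)"
  have FG: "F * G - G * F = c *\<^sub>C (F * G\<^sup>2 * F)"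
    unfolding F_def G_def c_def by (rule Res_commutator[OF l(1) m(1)])
  have "(x * F) * (G * x) - (x * G) * (F * x) = x * (F * G - G * F) * x"
    by (simp add: algebra_simps)
  also have "\<dots> = c *\<^sub>C ((x * F) * G\<^sup>2 * (F * x))"
    unfolding FG by (simp add: scaleC_simps mult.assoc)
  also have "\<dots> \<doteq> c *\<^sub>C (1 * G\<^sup>2 * 1)" by (intro eqv_scaleC eqv_mult eqv_refl x)
  finally have "c *\<^sub>C (1 * G\<^sup>2 * 1) \<doteq> (x * F) * (G * x) - (x * G) * (F * x)" by (rule eqv_sym)
  also have "\<dots> \<doteq> 1 * (G * x) - (x * G) * 1" by (intro eqv_diff eqv_mult eqv_refl x)
  finally have Gx: "c *\<^sub>C (G * G) \<doteq> G * x - x * G" by (simp add: power2_eq_square)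
  have "(y * G) * (x * y) - (y * x) * (G * y) = y * (G * x - x * G) * y"
    by (simp add: algebra_simps)
  also have "\<dots> \<doteq> y * (c *\<^sub>C (G * G)) * y" by (intro eqv_mult eqv_refl eqv_sym[OF Gx])
  also have "y * (c *\<^sub>C (G * G)) * y = c *\<^sub>C ((y * G) * (G * y))"
    by (simp add: scaleC_simps mult.assoc)
  also have "\<dots> \<doteq> c *\<^sub>C (1 * 1)" by (intro eqv_scaleC eqv_mult y)
  finally have "c *\<^sub>C (1 * 1) \<doteq> (y * G) * (x * y) - (y * x) * (G * y)" by (rule eqv_sym)
  also have "\<dots> \<doteq> 1 * (x * y) - (y * x) * 1" by (intro eqv_diff eqv_mult eqv_refl y)
  finally have comm: "x * y - y * x \<doteq> c *\<^sub>C 1" by (simp add: eqv_sym)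
  have power: "x * y ^ Suc n - y ^ Suc n * x \<doteq> (of_nat (Suc n) * c) *\<^sub>C y ^ n" for n
  proof (induction n)
    case 0
    then show ?case using comm by simp
  next
    case (Suc n)
    have "x * y ^ Suc (Suc n) - y ^ Suc (Suc n) * x =
        (x * y ^ Suc n - y ^ Suc n * x) * y + y ^ Suc n * (x * y - y * x)"
      unfolding power_Suc2[of y "Suc n"] by (simp add: algebra_simps del: power_Suc)
    also have "\<dots> \<doteq> ((of_nat (Suc n) * c) *\<^sub>C y ^ n) * y + y ^ Suc n * (c *\<^sub>C 1)"
      by (intro eqv_add eqv_mult eqv_refl Suc.IH comm)
    also have "\<dots> = (of_nat (Suc n) * c + c) *\<^sub>C y ^ Suc n"
      by (simp only: mult_scaleC_left mult_scaleC_right scaleC_add_left power_Suc2 mult_1_right)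
    also have "of_nat (Suc n) * c + c = of_nat (Suc (Suc n)) * c" by (simp add: algebra_simps)
    finally show ?case .
  qed
  have notin: "y ^ n \<notin> J" for n
  proof (induction n)
    case 0
    then show ?case by (simp add: one_not_mem)
  next
    case (Suc n)
    have "y ^ n \<in> J" if "y ^ Suc n \<in> J"
    proof -
      have "1 * y ^ n \<doteq> (G * y) * y ^ n" by (intro eqv_mult eqv_refl eqv_sym[OF y(1)])
      also have "\<dots> = G * y ^ Suc n" by (simp add: mult.assoc)
      also have "\<dots> \<doteq> 0" using mult_mem_left[OF that] by (simp add: eqv_zero_iff)
      finally show ?thesis by (simp add: eqv_zero_iff)
    qed
    then show ?case using Suc by blast
  qed
  have bound: "real (Suc n) * cmod c \<le> 2 * qnorm x * qnorm y" for n
  proof -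
    have pos: "0 < qnorm (y ^ n)"
      using notin[of n] qnorm_nonneg[of "y ^ n"] qnorm_zero_iff[of "y ^ n"] by linarith
    have yn: "qnorm (y ^ Suc n) \<le> qnorm y * qnorm (y ^ n)" using qnorm_mult[of y "y ^ n"] by simp
    have "real (Suc n) * cmod c * qnorm (y ^ n) = qnorm (x * y ^ Suc n - y ^ Suc n * x)"
      unfolding qnorm_eqv[OF power] by (simp only: qnorm_scaleC norm_mult norm_of_nat)
    also have "\<dots> \<le> qnorm x * qnorm (y ^ Suc n) + qnorm (y ^ Suc n) * qnorm x"
      by (rule order_trans[OF qnorm_diff add_mono[OF qnorm_mult qnorm_mult]])
    also have "\<dots> = 2 * qnorm x * qnorm (y ^ Suc n)" by simp
    also have "\<dots> \<le> 2 * qnorm x * (qnorm y * qnorm (y ^ n))"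
      by (intro mult_left_mono yn) (simp add: qnorm_nonneg)
    finally show ?thesis using pos by (simp add: mult.assoc[symmetric])
  qed
  have "0 < cmod c" using \<open>sympl f g \<noteq> 0\<close> by (simp add: c_def)
  then obtain n where "2 * qnorm x * qnorm y < real n * cmod c" using reals_Archimedean3 by blast
  also have "\<dots> \<le> real (Suc n) * cmod c" by (intro mult_right_mono) simp_all
  finally show False using bound[of n] by simp
qed

text \<open>
  The elements whose resolvents do not vanish modulo \<open>J\<close>. The parameter \<open>1\<close> is immaterial, see
  \<open>mem_support_iff\<close>.
\<close>

definition support :: "'x set" where
  "support = {f. Res 1 f \<notin> J}"

lemma mem_support_iff:
  assumes l: "l \<noteq> 0" shows "f \<in> support \<longleftrightarrow> Res l f \<notin> J"
proof -
  have *: "Res m f \<in> J" if "Res l f \<in> J" "l \<noteq> 0" "m \<noteq> 0" for l m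
  proof -
    have "Res m f = Res l f + (\<i> * of_real (l - m)) *\<^sub>C (Res m f * Res l f)"
      using Res_resolvent[OF that(3,2), of f] by (simp add: algebra_simps)
    then show ?thesis using add_mem[OF that(1) scaleC_mem[OF mult_mem_left[OF that(1)]]] by metis
  qed
  show ?thesis using *[of l 1] *[of 1 l] l by (auto simp: support_def)
qed

lemma isotropic_support: "isotropic support"
  by (auto simp: isotropic_def support_def intro: invertible_Res_sympl[of 1 _ 1])

lemma subspace_support: "subspace support"
proof -
  have zero: "0 \<in> support"
  proof (rule ccontr)
    assume "0 \<notin> support"
    then have "\<i> *\<^sub>C Res 1 0 \<in> J" by (simp add: support_def scaleC_mem)
    then show False using one_not_mem by (simp add: Res_zero scaleC_simps)
  qed
  have add: "f + g \<in> support" if f: "f \<in> support" and g: "g \<in> support" for f g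
  proof (rule ccontr)
    assume "f + g \<notin> support"
    then have "Res (1 + 1) (f + g) \<in> J" by (subst (asm) mem_support_iff[of "1 + 1"]) simp_all
    then have 1: "Res 1 f * Res 1 g \<in> J"
      by (subst Res_product) (simp_all add: mult_mem_right)
    obtain x where x: "x * Res 1 f \<doteq> 1"
      using Res_invertible[of 1 f] f by (auto simp: support_def invertible_mod_def)
    have "1 * Res 1 g \<doteq> (x * Res 1 f) * Res 1 g" by (rule eqv_mult[OF eqv_sym[OF x] eqv_refl])
    also have "\<dots> \<doteq> 0" using mult_mem_left[OF 1, of x] by (simp add: eqv_zero_iff mult.assoc)
    finally show False using g by (simp add: support_def eqv_zero_iff)
  qed
  have scale: "r *\<^sub>R f \<in> support" if f: "f \<in> support" for r f
  proof (cases "r = 0")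
    case True
    then show ?thesis using zero by simp
  next
    case False
    have "Res 1 f = of_real r *\<^sub>C Res r (r *\<^sub>R f)" using Res_homogeneous[of 1 r f] False by simp
    then have "Res r (r *\<^sub>R f) \<notin> J" using f scaleC_mem by (auto simp: support_def)
    then show ?thesis by (simp add: mem_support_iff[OF False])
  qed
  show ?thesis using zero add scale by (rule subspaceI)
qed

lemma Res_scalar:
  assumes l: "l \<noteq> 0" shows "\<exists>c. Res l f \<doteq> c *\<^sub>C 1"
proof (cases "f \<in> support")
  case False
  then have "Res l f \<doteq> 0 *\<^sub>C 1" using mem_support_iff[OF l] by (simp add: scaleC_simps eqv_zero_iff)
  then show ?thesis by blast
next
  case True
  obtain c where c: "\<not> invertible_mod (Res l f - c *\<^sub>C 1)"
    using ex_not_invertible[of "Res l f"] unfolding invertible_mod_def by blast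
  have comm: "Res m g * (Res l f - c *\<^sub>C 1) \<doteq> (Res l f - c *\<^sub>C 1) * Res m g" if m: "m \<noteq> 0" for m g
  proof (cases "g \<in> support")
    case True
    then have "sympl f g = 0" using \<open>f \<in> support\<close> isotropic_support by (simp add: isotropic_def)
    then have "Res l f * Res m g = Res m g * Res l f" by (rule Res_commute[OF l m])
    then show ?thesis by (simp add: algebra_simps scaleC_simps eqv_refl)
  next
    case False
    then have "Res m g \<in> J" using mem_support_iff[OF m] by simp
    then show ?thesis unfolding eqv_def by (intro diff_mem mult_mem_left mult_mem_right)
  qed
  have "Res l f - c *\<^sub>C 1 \<in> J"
    using normal_invertible[of "Res l f - c *\<^sub>C 1"] comm eqv_sym[OF comm] c by blast
  then show ?thesis by (auto simp: eqv_def)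
qed

text \<open>The scalar to which \<open>a\<close> is congruent modulo \<open>J\<close>.\<close>

definition character :: "'x resolvent_algebra \<Rightarrow> complex" where
  "character a = (SOME c. a \<doteq> c *\<^sub>C 1)"

lemma eqv_character: "a \<doteq> character a *\<^sub>C 1"
proof -
  have "\<exists>c. a - c *\<^sub>C 1 \<in> J"
    using eqv_scalar_resolvent_algebra[OF ideal proper] Res_scalar by (simp add: eqv_def)
  then have "\<exists>c. a \<doteq> c *\<^sub>C 1" by (simp add: eqv_def)
  then show ?thesis unfolding character_def by (rule someI_ex)
qed

lemma character_eqI: "a \<doteq> c *\<^sub>C 1 \<Longrightarrow> character a = c"
  using eqv_trans[OF eqv_sym[OF eqv_character]] eqv_scalar_unique by blast

lemma character_hom:
  shows "character 1 = 1" "character (a + b) = character a + character b" "character (a * b) = character a * character b"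
    "character (c *\<^sub>C a) = c * character a" "character (a - b) = character a - character b"
proof -
  show "character 1 = 1" by (rule character_eqI) (simp add: scaleC_simps eqv_refl)
  show "character (a + b) = character a + character b"
    using eqv_add[OF eqv_character eqv_character] by (intro character_eqI) (simp add: scaleC_simps)
  show "character (a - b) = character a - character b"
    using eqv_diff[OF eqv_character eqv_character] by (intro character_eqI) (simp add: scaleC_simps)
  show "character (a * b) = character a * character b"
    using eqv_mult[OF eqv_character[of a] eqv_character[of b]]
    by (intro character_eqI) (simp add: scaleC_simps mult.commute)
  show "character (c *\<^sub>C a) = c * character a"
    using eqv_scaleC[OF eqv_character[of a], of c] by (intro character_eqI) (simp add: scaleC_simps)
qed

lemma character_le: "cmod (character a) \<le> norm a"
  using qnorm_le_norm[of a] qnorm_eqv[OF eqv_character, of a] by (simp add: qnorm_scaleC qnorm_one)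

lemma character_LIMSEQ:
  assumes "x \<longlonglongrightarrow> a" shows "(\<lambda>n. character (x n)) \<longlonglongrightarrow> character a"
proof -
  have "(\<lambda>n. character (x n) - character a) \<longlonglongrightarrow> 0"
    by (rule Lim_null_comparison[OF _ tendsto_norm_zero[OF LIM_zero[OF assms]]])
      (simp add: character_le flip: character_hom(5))
  then show ?thesis by (simp add: LIM_zero_iff)
qed

text \<open>
  As \<open>J\<close> is not known to be closed under \<open>star\<close>, compatibility with \<open>star\<close> is derived from norms:
  a unitary and its adjoint are congruent to mutually inverse scalars of modulus at most \<open>1\<close>.
\<close>

lemma character_star_cayley:
  assumes "l \<noteq> 0" shows "character (star (cayley l f)) = cnj (character (cayley l f))"
proof -
  let ?u = "character (cayley l f)" and ?v = "character (star (cayley l f))"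
  have uv: "?u * ?v = 1" by (simp add: cayley_unitary[OF assms] character_hom flip: character_hom(3))
  have le: "cmod ?u \<le> 1" "cmod ?v \<le> 1"
    using character_le[of "cayley l f"] character_le[of "star (cayley l f)"]
    by (simp_all add: norm_star norm_cayley[OF assms])
  have "1 = cmod ?u * cmod ?v" using uv by (metis norm_mult norm_one)
  also have "\<dots> \<le> cmod ?u * 1" using le by (intro mult_left_mono) simp_all
  finally have "cmod ?u = 1" using le by simp
  then have "?u * cnj ?u = 1" by (simp flip: complex_norm_square)
  then have "?u * cnj ?u = ?u * ?v" "?u \<noteq> 0" using uv by auto
  then show ?thesis by simp
qed

lemma character_star: "character (star a) = cnj (character a)"
proof (induction a rule: resolvent_algebra_induct)
  case closed
  show ?case
    unfolding closed_sequential_limits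
  proof (intro allI impI)
    fix x a assume H: "(\<forall>n. x n \<in> {a. character (star a) = cnj (character a)}) \<and> x \<longlonglongrightarrow> a"
    then have x: "x \<longlonglongrightarrow> a" and eq: "\<And>n. character (star (x n)) = cnj (character (x n))" by auto
    have "(\<lambda>n. cnj (character (x n))) \<longlonglongrightarrow> character (star a)"
      using character_LIMSEQ[OF tendsto_star[OF x]] by (simp add: eq)
    moreover have "(\<lambda>n. cnj (character (x n))) \<longlonglongrightarrow> cnj (character a)"
      by (intro tendsto_cnj character_LIMSEQ x)
    ultimately show "a \<in> {a. character (star a) = cnj (character a)}" by (simp add: LIMSEQ_unique)
  qed
next
  case (Res l f)
  then show ?case
    by (simp add: Res_cayley star_simps character_hom character_star_cayley[OF Res])
qed (simp_all add: star_simps character_hom mult.commute)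

lemma star_character_character: "star_character character"
  by (simp add: star_character_def character_hom character_star)

lemma pure_state_on_character: "pure_state_on (resolvent_subalgebra support) character"
  using star_character_character cstar_subalgebra_resolvent_subalgebra
    one_in_resolvent_subalgebra[OF subspace_support] by (rule star_character_pure)

lemma character_ideal_eq: "J = character_ideal support character"
proof -
  have max: "proper_maximal_ideal (character_ideal support character)"
    by (intro character_ideal_maximal subspace_support isotropic_support pure_state_on_character)
  have "character_ideal support character \<subseteq> J"
    unfolding character_ideal_def
  proof (rule hull_minimal)
    show "closed_ideal J" by (rule ideal)
    show "{Res l f - character (Res l f) *\<^sub>C 1 | l f. l \<noteq> 0 \<and> f \<in> support} \<union>
        {Res m g | m g. m \<noteq> 0 \<and> g \<notin> support} \<subseteq> J"
      using eqv_character mem_support_iff by (auto simp: eqv_def)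
  qed
  then show ?thesis using max ideal proper unfolding proper_maximal_ideal_def by blast
qed

end

theorem theorem4p6:
  shows
   "(\<forall>(Z :: 'x::symplectic_space set) chi.
       subspace Z \<and> isotropic Z \<and> pure_state_on (resolvent_subalgebra Z) chi \<and>
       (\<forall>l f. l \<noteq> 0 \<and> f \<in> Z \<longrightarrow> chi (Res l f) \<noteq> 0) \<longrightarrow>
       proper_maximal_ideal (character_ideal Z chi)) \<and>
    (\<forall>J :: 'x resolvent_algebra set.
       proper_maximal_ideal J \<longrightarrow>
       (\<exists>Z chi.
         subspace Z \<and> isotropic Z \<and> pure_state_on (resolvent_subalgebra Z) chi \<and>
         (\<forall>l f. l \<noteq> 0 \<and> f \<in> Z \<longrightarrow> chi (Res l f) \<noteq> 0) \<and>
         J = character_ideal Z chi))"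
proof (intro conjI allI impI)
  fix Z :: "'x set" and chi
  assume "subspace Z \<and> isotropic Z \<and> pure_state_on (resolvent_subalgebra Z) chi \<and>
    (\<forall>l f. l \<noteq> 0 \<and> f \<in> Z \<longrightarrow> chi (Res l f) \<noteq> 0)"
  then show "proper_maximal_ideal (character_ideal Z chi)"
    by (intro character_ideal_maximal) simp_all
next
  fix J :: "'x resolvent_algebra set"
  assume "proper_maximal_ideal J"
  then interpret maximal_ideal J by unfold_locales
  have "character (Res l f) \<noteq> 0" if "l \<noteq> 0" "f \<in> support" for l f
  proof
    assume "character (Res l f) = 0"
    then have "Res l f \<in> J" using eqv_character[of "Res l f"] by (simp add: eqv_def scaleC_simps)
    then show False using mem_support_iff that by blast
  qed
  then show "\<exists>Z chi. subspace Z \<and> isotropic Z \<and> pure_state_on (resolvent_subalgebra Z) chi \<and>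
      (\<forall>l f. l \<noteq> 0 \<and> f \<in> Z \<longrightarrow> chi (Res l f) \<noteq> 0) \<and> J = character_ideal Z chi"
    using subspace_support isotropic_support pure_state_on_character character_ideal_eq by blast
qed

end
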